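(* Let $N$ be an integer and $p,q$ real numbers with $N>2p$ and $2\le p<q<p^{**}:=\frac{Np}{N-2p}$, and let $\beta=N-\frac{q}{p}(N-2p)$. For $\lambda<\gamma_{N,p}^p$ and nonzero $u\in D^{2,p}(\mathbb{R}^N)$ put $$Q_\lambda(u)=\frac{\int_{\mathbb{R}^N}|\Delta u|^p\,dx-\lambda\int_{\mathbb{R}^N}|x|^{-2p}|u|^p\,dx}{\left(\int_{\mathbb{R}^N}|x|^{-\beta}|u|^q\,dx\right)^{p/q}},$$ and let $$S_q(\lambda)=\inf_{u\in D^{2,p}(\mathbb{R}^N),\,u\neq0}Q_\lambda(u),\qquad S_q^{\rm rad}(\lambda)=\inf_{u\in D^{2,p}(\mathbb{R}^N),\,u=u(|x|),\,u\neq 0}Q_\lambda(u).$$ Then there exists $\lambda_0\in\mathbb{R}$ (depending only on $N,p,q$) such that for every $\lambda<\lambda_0$ (with $\lambda<\gamma_{N,p}^p$) one has $S_q(\lambda)<S_q^{\rm rad}(\lambda)$, and hence no extremal for $S_q(\lambda)$ is radially symmetric.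
   Context: $D^{2,p}(\mathbb{R}^N)$ is the closure (completion) of $C^\infty_0(\mathbb{R}^N)$ with respect to the norm $\left(\int_{\mathbb{R}^N}|\Delta u|^p\,dx\right)^{1/p}$; for $N>2p$ it is identified with a space of real-valued functions on $\mathbb{R}^N$. The number $\gamma_{N,p}=\frac{N(p-1)(N-2p)}{p^2}$ is such that $\gamma_{N,p}^p$ is the best constant in the Rellich inequality $\gamma_{N,p}^p\int_{\mathbb{R}^N}|x|^{-2p}|u|^p\,dx\le\int_{\mathbb{R}^N}|\Delta u|^p\,dx$ for $u\in D^{2,p}(\mathbb{R}^N)$. An extremal for $S_q(\lambda)$ is a nonzero $u\in D^{2,p}(\mathbb{R}^N)$ with $Q_\lambda(u)=S_q(\lambda)$. Radially symmetric means radially symmetric about the origin. *)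

theory Defs
  imports "HOL-Analysis.Analysis"
begin

section \<open>Test functions\<close>

definition partial_deriv :: "'n \<Rightarrow> (real^'n \<Rightarrow> real) \<Rightarrow> real^'n::finite \<Rightarrow> real" where
  "partial_deriv i f = (\<lambda>x. frechet_derivative f (at x) (axis i 1))"

text \<open>All iterated partial derivatives are differentiable everywhere; in particular they are
  all continuous, so this is the class of infinitely differentiable functions. (Where \<open>f\<close> is not
  differentiable, \<^const>\<open>frechet_derivative\<close> is a junk value, but this is excluded by
  requiring differentiability for shorter lists of indices too.)\<close>

definition smooth :: "(real^'n::finite \<Rightarrow> real) \<Rightarrow> bool" where
  "smooth f \<longleftrightarrow> (\<forall>is x. foldr partial_deriv is f differentiable (at x))"

definition test_function :: "(real^'n::finite \<Rightarrow> real) \<Rightarrow> bool" where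
  "test_function f \<longleftrightarrow> smooth f \<and> compact (closure {x. f x \<noteq> 0})"

definition laplacian :: "(real^'n::finite \<Rightarrow> real) \<Rightarrow> real^'n \<Rightarrow> real" where
  "laplacian f = (\<lambda>x. \<Sum>i\<in>UNIV. partial_deriv i (partial_deriv i f) x)"


section \<open>The distributional Laplacian\<close>

definition locally_integrable :: "(real^'n::finite \<Rightarrow> real) \<Rightarrow> bool" where
  "locally_integrable f \<longleftrightarrow> (\<forall>K. compact K \<longrightarrow> set_integrable lborel K f)"

definition has_weak_laplacian ::
    "(real^'n::finite \<Rightarrow> real) \<Rightarrow> (real^'n \<Rightarrow> real) \<Rightarrow> bool" where
  "has_weak_laplacian u g \<longleftrightarrow> locally_integrable u \<and> locally_integrable g \<and>
     (\<forall>\<phi>. test_function \<phi> \<longrightarrow>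
        (LINT x|lborel. u x * laplacian \<phi> x) = (LINT x|lborel. g x * \<phi> x))"

text \<open>The choice is immaterial: a weak Laplacian is unique up to a null set, and only integrals
  of it occur below.\<close>

definition weak_laplacian :: "(real^'n::finite \<Rightarrow> real) \<Rightarrow> real^'n \<Rightarrow> real" where
  "weak_laplacian u = (SOME g. has_weak_laplacian u g)"


section \<open>The space \<open>D\<^sup>2\<^sup>,\<^sup>p\<close>\<close>

text \<open>Here \<open>N\<close> is the dimension; the definitions are those of \<open>p\<^sup>*\<^sup>*\<close>, \<open>\<gamma>\<close> and \<open>\<beta>\<close>.\<close>

definition crit_exponent :: "real \<Rightarrow> real \<Rightarrow> real" where
  "crit_exponent N p = N * p / (N - 2 * p)"

definition rellich_gamma :: "real \<Rightarrow> real \<Rightarrow> real" where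
  "rellich_gamma N p = N * (p - 1) * (N - 2 * p) / p\<^sup>2"

definition weight_exponent :: "real \<Rightarrow> real \<Rightarrow> real \<Rightarrow> real" where
  "weight_exponent N p q = N - q / p * (N - 2 * p)"

text \<open>For \<open>1 < p\<close> and \<open>2 * p < N\<close>, the Sobolev inequality bounds the \<open>L\<close>-norm with exponent
  \<open>p\<^sup>*\<^sup>*\<close> of a test function by a multiple of the \<open>L\<^sup>p\<close>-norm of its Laplacian. So a sequence of
  test functions that is Cauchy for the latter norm has a limit \<open>u\<close> for the former, the
  Laplacians converge in \<open>L\<^sup>p\<close> to the weak Laplacian of \<open>u\<close>, and the completion is the set of
  these limits \<open>u\<close>. Elements are represented by Borel functions, equality being equality
  almost everywhere.\<close>

definition D2p :: "real \<Rightarrow> (real^'n::finite \<Rightarrow> real) set" where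
  "D2p p = {u \<in> borel_measurable borel. (\<exists>g. has_weak_laplacian u g) \<and>
     (\<exists>\<phi> :: nat \<Rightarrow> real^'n \<Rightarrow> real. (\<forall>k. test_function (\<phi> k)) \<and>
        (\<lambda>k. \<integral>\<^sup>+x. ennreal (\<bar>\<phi> k x - u x\<bar> powr crit_exponent (real CARD('n)) p) \<partial>lborel)
          \<longlonglongrightarrow> 0 \<and>
        (\<lambda>k. \<integral>\<^sup>+x. ennreal (\<bar>laplacian (\<phi> k) x - weak_laplacian u x\<bar> powr p) \<partial>lborel)
          \<longlonglongrightarrow> 0)}"

definition D2p_nonzero :: "real \<Rightarrow> (real^'n::finite \<Rightarrow> real) set" where
  "D2p_nonzero p = {u \<in> D2p p. \<not> (AE x in lborel. u x = 0)}"

definition radial :: "(real^'n::finite \<Rightarrow> real) \<Rightarrow> bool" where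
  "radial u \<longleftrightarrow> (\<exists>f :: real \<Rightarrow> real. AE x in lborel. u x = f (norm x))"


section \<open>The variational problems\<close>

definition Q :: "real \<Rightarrow> real \<Rightarrow> real \<Rightarrow> (real^'n::finite \<Rightarrow> real) \<Rightarrow> real" where
  "Q p q lam u =
     ((LINT x|lborel. \<bar>weak_laplacian u x\<bar> powr p)
        - lam * (LINT x|lborel. norm x powr (- 2 * p) * \<bar>u x\<bar> powr p))
     / (LINT x|lborel. norm x powr (- weight_exponent (real CARD('n)) p q) * \<bar>u x\<bar> powr q)
         powr (p / q)"

text \<open>For \<open>lam < \<gamma>\<^sup>p\<close> the Rellich inequality gives \<open>Q \<ge> 0\<close>, so these are infima of nonempty sets
  of reals that are bounded below.\<close>

definition S :: "'n::finite itself \<Rightarrow> real \<Rightarrow> real \<Rightarrow> real \<Rightarrow> real" where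
  "S _ p q lam = (INF u \<in> (D2p_nonzero p :: (real^'n \<Rightarrow> real) set). Q p q lam u)"

definition S_rad :: "'n::finite itself \<Rightarrow> real \<Rightarrow> real \<Rightarrow> real \<Rightarrow> real" where
  "S_rad _ p q lam = (INF u \<in> {u \<in> (D2p_nonzero p :: (real^'n \<Rightarrow> real) set). radial u}. Q p q lam u)"

definition extremal :: "real \<Rightarrow> real \<Rightarrow> real \<Rightarrow> (real^'n::finite \<Rightarrow> real) \<Rightarrow> bool" where
  "extremal p q lam u \<longleftrightarrow> u \<in> D2p_nonzero p \<and> Q p q lam u = S TYPE('n) p q lam"

end

theory Submission
  imports Defs "HOL-Computational_Algebra.Polynomial"
begin

text \<open>Put \<open>lam = - \<mu>\<close> with \<open>\<mu>\<close> large. A bump of radius \<open>\<epsilon> = \<mu> powr (- 1 / (2 * p))\<close> centred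
  away from the origin shows that \<open>S\<close> grows at most like \<open>\<epsilon> powr (N - 2 * p - N * p / q)\<close>.
  A radial \<open>u\<close> cannot concentrate at a point: \<open>\<bar>u x\<bar>\<close> is at most a multiple of
  \<open>D powr (1 / p) * norm x powr (2 - N / p)\<close>, where \<open>D\<close> is the integral of \<open>\<bar>\<Delta>u\<bar> powr p\<close>. Hence
  the integral in the denominator of \<open>Q\<close> is at most a multiple of \<open>D powr ((q - p) / p) * H\<close>, where
  \<open>H\<close> is the Hardy integral of \<open>u\<close>, and as \<open>D + \<mu> * H \<ge> D powr (1 - p / q) * (\<mu> * H) powr (p / q)\<close>,
  \<open>S_rad\<close> grows at least like \<open>\<mu> powr (p / q) = \<epsilon> powr (- 2 * p * p / q)\<close>. The two exponents of
  \<open>\<epsilon>\<close> differ by \<open>(N - 2 * p) * (1 - p / q) > 0\<close>.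

  The pointwise bound is dual to an \<open>L\<close>-norm estimate of the Newtonian potential of a radial density.
  It is proved for the test functions approximating \<open>u\<close>, which need not be radial, by testing
  Kato's inequality with that potential; the finiteness of \<open>H\<close>, a Rellich inequality, follows from
  Kato's inequality for the convex function \<open>\<bar>s\<bar> powr p\<close> and the weight
  \<open>(x \<bullet> x + \<epsilon>) powr (1 - p)\<close>.\<close>

section \<open>Smooth functions\<close>

text \<open>Duality is forced: the pointwise bound fails for the approximating test functions, since
  a non-radial one can concentrate off the origin with small energy. What survives approximation is
  the bound integrated against a radial density, that is, a bound on spherical means of the absolute
  value. It passes to the limit by Fatou's lemma, and for radial \<open>u\<close> it says something
  about \<open>u\<close> itself. The power in the bound comes from Hoelder's inequality: in the
  exponent conjugate to \<open>p\<close> the truncated kernel has norm a constant times t^(1 -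
  N/(2p)), finite exactly when N > 2p. The weight exponent makes \<open>Q\<close> invariant under
  dilations about the origin, so concentrating there gains nothing; only concentration elsewhere
  does, and this is what radial symmetry forbids. Radial functions are written in s = x \<bullet> x.
  In contrast to the norm this is smooth at the origin, and the Laplacian of h(x \<bullet> x) is 2 N
  h' + 4 s h''.\<close>

lemma smooth_coinduct:
  assumes "f \<in> F"
    and "\<And>f x. f \<in> F \<Longrightarrow> f differentiable (at x)"
    and "\<And>f i. f \<in> F \<Longrightarrow> partial_deriv i f \<in> F"
  shows "smooth f"
proof -
  have "foldr partial_deriv is f \<in> F" for "is"
    by (induction "is") (use assms in auto)
  then show ?thesis
    unfolding smooth_def using assms(2) by blast
qed

text \<open>The classical function exp(-1/s), extended by zero, with a polynomial factor in 1/s.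
  Differentiation produces such factors, so the family indexed by \<open>P\<close> is closed under
  derivatives.\<close>

definition flat :: "real poly \<Rightarrow> real \<Rightarrow> real" where
  "flat P s = (if s \<le> 0 then 0 else poly P (1 / s) * exp (- 1 / s))"

lemma tendsto_poly_mult_exp_uminus:
  "((\<lambda>y. poly P y * exp (- y)) \<longlongrightarrow> (0::real)) at_top"
proof -
  have "((\<lambda>y::real. \<Sum>i\<le>degree P. coeff P i * (y ^ i / exp y)) \<longlongrightarrow> (\<Sum>i\<le>degree P. coeff P i * 0)) at_top"
    by (intro tendsto_intros tendsto_power_div_exp_0)
  then show ?thesis
    by (simp add: poly_altdef sum_distrib_right exp_minus divide_inverse mult.assoc)
qed

text \<open>In the variable y = 1/s the derivative in s is -y^2 times the one in y, so P(y) exp(-y)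
  becomes y^2 (P(y) - P'(y)) exp(-y). At 0 the right difference quotient is y P(y) exp(-y) with y
  tending to infinity, and the exponential wins.\<close>

lemma flat_has_real_derivative:
  "(flat P has_real_derivative flat ([:0, 0, 1:] * (P - pderiv P)) s) (at s)"
proof -
  consider "s < 0" | "s = 0" | "s > 0" by linarith
  then show ?thesis
  proof cases
    case 1
    have "((\<lambda>_. 0) has_real_derivative 0) (at s)" by simp
    then have "(flat P has_real_derivative 0) (at s)"
      by (rule has_field_derivative_transform_within_open[where S="{..<0}"]) (use 1 in \<open>auto simp: flat_def\<close>)
    then show ?thesis using 1 by (simp add: flat_def)
  next
    case 3
    have "((\<lambda>s. poly P (1 / s) * exp (- 1 / s)) has_real_derivative
        poly ([:0, 0, 1:] * (P - pderiv P)) (1 / s) * exp (- 1 / s)) (at s)"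
    proof -
      have 1: "((\<lambda>s. 1 / s) has_real_derivative - 1 / s\<^sup>2) (at s)"
        using 3 by (auto intro!: derivative_eq_intros simp: power2_eq_square)
      have 2: "((\<lambda>s. exp (- 1 / s)) has_real_derivative exp (- 1 / s) * (1 / s\<^sup>2)) (at s)"
        using 3 by (auto intro!: derivative_eq_intros simp: power2_eq_square)
      show ?thesis
        using 3 by (intro DERIV_cong[OF DERIV_mult[OF DERIV_chain2[OF poly_DERIV 1] 2]])
          (simp add: field_simps power2_eq_square)
    qed
    then have "(flat P has_real_derivative poly ([:0, 0, 1:] * (P - pderiv P)) (1 / s) * exp (- 1 / s)) (at s)"
      by (rule has_field_derivative_transform_within_open[where S="{0<..}"]) (use 3 in \<open>auto simp: flat_def\<close>)
    then show ?thesis using 3 by (simp add: flat_def)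
  next
    case 2
    have "((\<lambda>h. (flat P (0 + h) - flat P 0) / h) \<longlongrightarrow> 0) (at 0)"
    proof (rule filterlim_split_at_real)
      show "((\<lambda>h. (flat P (0 + h) - flat P 0) / h) \<longlongrightarrow> 0) (at_left 0)"
        by (rule tendsto_eventually) (auto simp: eventually_at_filter flat_def)
      have "((\<lambda>h. poly ([:0, 1:] * P) (inverse h) * exp (- inverse h)) \<longlongrightarrow> (0::real)) (at_right 0)"
        by (rule filterlim_compose[OF tendsto_poly_mult_exp_uminus filterlim_inverse_at_top_right])
      then show "((\<lambda>h. (flat P (0 + h) - flat P 0) / h) \<longlongrightarrow> 0) (at_right 0)"
        by (rule Lim_transform_eventually)
          (auto simp: eventually_at_filter flat_def field_simps)
    qed
    then have "(flat P has_real_derivative 0) (at 0)" by (simp add: DERIV_def)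
    then show ?thesis using 2 by (simp add: flat_def)
  qed
qed

text \<open>A syntactic class that contains the explicit test functions built below (box cut-offs
  and bumps) and is closed under partial derivatives, so that smoothness of a concrete function
  reduces to membership.\<close>

inductive_set elementary :: "(real^'n::finite \<Rightarrow> real) set" where
  const: "(\<lambda>x. c) \<in> elementary"
| coord: "(\<lambda>x. x $ i) \<in> elementary"
| add: "f \<in> elementary \<Longrightarrow> g \<in> elementary \<Longrightarrow> (\<lambda>x. f x + g x) \<in> elementary"
| mult: "f \<in> elementary \<Longrightarrow> g \<in> elementary \<Longrightarrow> (\<lambda>x. f x * g x) \<in> elementary"
| flat: "f \<in> elementary \<Longrightarrow> (\<lambda>x. flat P (f x)) \<in> elementary"

lemma elementary_sum:
  "finite I \<Longrightarrow> (\<And>i. i \<in> I \<Longrightarrow> f i \<in> elementary) \<Longrightarrow> (\<lambda>x. \<Sum>i\<in>I. f i x) \<in> elementary"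
  by (induction rule: finite_induct) (auto intro: elementary.intros)

lemma elementary_prod:
  "finite I \<Longrightarrow> (\<And>i. i \<in> I \<Longrightarrow> f i \<in> elementary) \<Longrightarrow> (\<lambda>x. \<Prod>i\<in>I. f i x) \<in> elementary"
  by (induction rule: finite_induct) (auto intro: elementary.intros)

lemma elementary_diff:
  assumes "f \<in> elementary" "g \<in> elementary"
  shows "(\<lambda>x. f x - g x) \<in> elementary"
  using elementary.add[OF assms(1) elementary.mult[OF elementary.const[of "-1"] assms(2)]] by simp

lemma elementary_power: "f \<in> elementary \<Longrightarrow> (\<lambda>x. f x ^ k) \<in> elementary"
  by (induction k) (auto intro: elementary.intros)

text \<open>The total derivative supplies differentiability; its coefficients lie in the class
  again, which is what \<open>smooth_coinduct\<close> iterates.\<close>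

lemma elementary_derivatives:
  fixes f :: "real^'n::finite \<Rightarrow> real"
  assumes "f \<in> elementary"
  shows "\<exists>D. (\<forall>i. D i \<in> elementary) \<and> (\<forall>x. (f has_derivative (\<lambda>h. \<Sum>i\<in>UNIV. h $ i * D i x)) (at x))"
  using assms
proof (induction rule: elementary.induct)
  case (const c)
  show ?case by (intro exI[of _ "\<lambda>i x. 0"]) (auto intro: elementary.intros)
next
  case (coord j)
  have "(\<lambda>h. \<Sum>i\<in>UNIV. h $ i * (if i = j then 1 else 0)) = (\<lambda>h::real^'n. h $ j)"
    by (simp add: fun_eq_iff if_distrib[of "\<lambda>t. _ * t"] cong: if_cong)
  then show ?case
    by (intro exI[of _ "\<lambda>i x. if i = j then 1 else 0"])
      (auto intro: elementary.intros bounded_linear.has_derivative[OF bounded_linear_vec_nth] derivative_eq_intros)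
next
  case (add f g)
  then obtain D E where "\<And>i. D i \<in> elementary" "\<And>i. E i \<in> elementary"
    and D: "\<And>x. (f has_derivative (\<lambda>h. \<Sum>i\<in>UNIV. h $ i * D i x)) (at x)"
    and E: "\<And>x. (g has_derivative (\<lambda>h. \<Sum>i\<in>UNIV. h $ i * E i x)) (at x)"
    by blast
  then show ?case
    by (intro exI[of _ "\<lambda>i x. D i x + E i x"])
      (auto intro!: elementary.intros has_derivative_eq_rhs[OF has_derivative_add[OF D E]]
        simp: fun_eq_iff sum.distrib algebra_simps)
next
  case (mult f g)
  then obtain D E where "\<And>i. D i \<in> elementary" "\<And>i. E i \<in> elementary"
    and D: "\<And>x. (f has_derivative (\<lambda>h. \<Sum>i\<in>UNIV. h $ i * D i x)) (at x)"
    and E: "\<And>x. (g has_derivative (\<lambda>h. \<Sum>i\<in>UNIV. h $ i * E i x)) (at x)"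
    by blast
  then show ?case using mult.hyps
    by (intro exI[of _ "\<lambda>i x. f x * E i x + D i x * g x"])
      (auto intro!: elementary.intros has_derivative_eq_rhs[OF has_derivative_mult[OF D E]]
        simp: fun_eq_iff sum.distrib sum_distrib_left sum_distrib_right algebra_simps)
next
  case (flat f P)
  then obtain D where "\<And>i. D i \<in> elementary"
    and D: "\<And>x. (f has_derivative (\<lambda>h. \<Sum>i\<in>UNIV. h $ i * D i x)) (at x)"
    by blast
  then show ?case using flat.hyps
    by (intro exI[of _ "\<lambda>i x. flat ([:0, 0, 1:] * (P - pderiv P)) (f x) * D i x"])
      (auto intro!: elementary.intros has_derivative_eq_rhs[OF has_derivative_compose[OF D
          flat_has_real_derivative[THEN has_field_derivative_imp_has_derivative]]]
        simp: fun_eq_iff sum_distrib_left sum_distrib_right algebra_simps)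
qed

lemma smooth_elementary:
  assumes "f \<in> elementary"
  shows "smooth f"
proof (rule smooth_coinduct[OF assms])
  fix f :: "real^'a \<Rightarrow> real" and i assume "f \<in> elementary"
  then obtain D where D: "\<And>i. D i \<in> elementary"
    "\<And>x. (f has_derivative (\<lambda>h. \<Sum>i\<in>UNIV. h $ i * D i x)) (at x)"
    using elementary_derivatives by blast
  show "f differentiable (at x)" for x using D(2) by (auto simp: differentiable_def)
  have "partial_deriv i f = D i"
    unfolding partial_deriv_def using frechet_derivative_at[OF D(2), symmetric]
    by (simp add: fun_eq_iff axis_def if_distrib[of "\<lambda>t. t * _"] cong: if_cong)
  then show "partial_deriv i f \<in> elementary" using D(1) by simp
qed

section \<open>Green's identity and Kato's inequality\<close>

lemma continuous_zero_outside_bounded: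
  fixes f :: "'a::euclidean_space \<Rightarrow> real"
  assumes "continuous_on UNIV f" and "\<And>x. norm x > R \<Longrightarrow> f x = 0"
  obtains B where "B \<ge> 0" "\<And>x. \<bar>f x\<bar> \<le> B"
proof -
  have "bounded (f ` cball 0 R)"
    by (rule compact_imp_bounded[OF compact_continuous_image[OF continuous_on_subset[OF assms(1)]]]) auto
  then obtain B where B: "\<And>x. norm x \<le> R \<Longrightarrow> \<bar>f x\<bar> \<le> B"
    by (force simp: bounded_iff)
  have "\<bar>f x\<bar> \<le> max B 0" for x
    using B[of x] assms(2)[of x] by (cases "norm x \<le> R") auto
  then show ?thesis using that[of "max B 0"] by auto
qed

lemma continuous_zero_outside_integrable:
  fixes f :: "'a::euclidean_space \<Rightarrow> real"
  assumes "continuous_on UNIV f" and "\<And>x. norm x > R \<Longrightarrow> f x = 0"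
  shows "integrable lborel f"
proof -
  have "set_integrable lborel (cball 0 R) f"
    by (rule borel_integrable_compact[OF _ continuous_on_subset[OF assms(1)], folded set_integrable_def]) auto
  then show ?thesis
    unfolding set_integrable_def
    by (rule Bochner_Integration.integrable_cong[THEN iffD1, rotated -1])
      (use assms(2) in \<open>auto simp: indicator_def not_le\<close>)
qed

text \<open>Difference quotients along \<open>e\<close> have integral zero by translation
  invariance. The mean value theorem bounds them by the supremum of \<open>f'\<close>, and steps of
  length at most 1 keep their supports in a fixed ball, so dominated convergence applies.\<close>

lemma integral_directional_derivative_eq_0:
  fixes f f' :: "'a::euclidean_space \<Rightarrow> real"
  assumes cont: "continuous_on UNIV f" "continuous_on UNIV f'"
    and deriv: "\<And>x. ((\<lambda>t. f (x + t *\<^sub>R e)) has_real_derivative f' x) (at 0)"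
    and supp: "\<And>x. norm x > R \<Longrightarrow> f x = 0" "\<And>x. norm x > R \<Longrightarrow> f' x = 0"
  shows "(LINT x|lborel. f' x) = 0"
proof -
  obtain B where B: "B \<ge> 0" "\<And>x. \<bar>f' x\<bar> \<le> B"
    using continuous_zero_outside_bounded[OF cont(2) supp(2)] by blast
  have [measurable]: "f \<in> borel_measurable borel" "f' \<in> borel_measurable borel"
    using cont by (auto intro: borel_measurable_continuous_onI)
  have deriv': "((\<lambda>t. f (x + t *\<^sub>R e)) has_real_derivative f' (x + s *\<^sub>R e)) (at s)" for x s
    using DERIV_at_within_shift[of "\<lambda>t. f (x + t *\<^sub>R e)" "f' (x + s *\<^sub>R e)" s 0 UNIV] deriv[of "x + s *\<^sub>R e"]
    by (simp add: algebra_simps)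
  define h where "h n = 1 / real (Suc n)" for n
  have h: "0 < h n" "h n \<le> 1" for n by (auto simp: h_def)
  define d where "d n x = (f (x + h n *\<^sub>R e) - f x) / h n" for n x
  have int_f: "integrable lborel f"
    by (rule continuous_zero_outside_integrable[OF cont(1) supp(1)])
  have shift: "integrable lborel (\<lambda>x. f (x + v))" "(LINT x|lborel. f (x + v)) = (LINT x|lborel. f x)" for v
  proof -
    have "integrable (distr lborel borel ((+) v)) f" using int_f by (simp add: lborel_distr_plus)
    then show "integrable lborel (\<lambda>x. f (x + v))"
      by (subst (asm) integrable_distr_eq) (auto simp: add.commute)
    have "(LINT x|lborel. f x) = integral\<^sup>L (distr lborel borel ((+) v)) f" by (simp add: lborel_distr_plus)
    then show "(LINT x|lborel. f (x + v)) = (LINT x|lborel. f x)"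
      by (subst (asm) integral_distr) (auto simp: add.commute)
  qed
  have "(\<lambda>n. LINT x|lborel. d n x) \<longlonglongrightarrow> (LINT x|lborel. f' x)"
  proof (rule integral_dominated_convergence[where w = "\<lambda>x. indicator (cball 0 (R + norm e)) x * B"])
    show "integrable lborel (\<lambda>x::'a. indicator (cball 0 (R + norm e)) x * B)"
      using emeasure_bounded_finite[OF bounded_cball, of "0::'a" "R + norm e"]
      by (intro integrable_mult_left integrable_real_indicator) auto
    show "AE x in lborel. (\<lambda>n. d n x) \<longlonglongrightarrow> f' x"
    proof (rule AE_I2)
      fix x
      have "((\<lambda>t. (f (x + t *\<^sub>R e) - f x) / t) \<longlongrightarrow> f' x) (at 0)"
        using deriv[of x] by (simp add: DERIV_def)
      moreover have "filterlim h (at 0) sequentially"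
        using h LIMSEQ_inverse_real_of_nat by (auto simp: filterlim_at h_def[abs_def] inverse_eq_divide)
      ultimately show "(\<lambda>n. d n x) \<longlonglongrightarrow> f' x"
        unfolding d_def by (rule filterlim_compose)
    qed
    show "AE x in lborel. norm (d n x) \<le> indicator (cball 0 (R + norm e)) x * B" for n
    proof (rule AE_I2)
      fix x
      obtain z where z: "f (x + h n *\<^sub>R e) - f (x + 0 *\<^sub>R e) = (h n - 0) * f' (x + z *\<^sub>R e)"
        using MVT2[of 0 "h n" "\<lambda>t. f (x + t *\<^sub>R e)" "\<lambda>t. f' (x + t *\<^sub>R e)"] h deriv' by blast
      then have "d n x = f' (x + z *\<^sub>R e)" using h[of n] by (simp add: d_def)
      moreover have "d n x = 0" if "norm x > R + norm e"
      proof -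
        have "norm x \<le> norm (x + h n *\<^sub>R e) + norm (h n *\<^sub>R e)"
          using norm_triangle_ineq4[of "x + h n *\<^sub>R e" "h n *\<^sub>R e"] by simp
        moreover have "norm (h n *\<^sub>R e) \<le> norm e" using h[of n] by (simp add: mult_left_le_one_le)
        ultimately have "norm (x + h n *\<^sub>R e) > R" using that by linarith
        moreover have "norm x > R" using that norm_ge_zero[of e] by linarith
        ultimately show ?thesis using supp by (simp add: d_def)
      qed
      ultimately show "norm (d n x) \<le> indicator (cball 0 (R + norm e)) x * B"
        using B by (cases "norm x \<le> R + norm e") (auto simp: indicator_def)
    qed
  qed (auto simp: d_def)
  moreover have "(LINT x|lborel. d n x) = 0" for n
    unfolding d_def using shift int_f by simp
  ultimately show ?thesis by (simp add: LIMSEQ_const_iff)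
qed

text \<open>Only the pure second partials are recorded, since nothing else enters the Laplacian. The
  notion is wider than \<open>smooth\<close>: potentials of continuous densities and compositions
  with |s|^p are in general merely C2.\<close>

definition has_C2_partials ::
    "(real^'n::finite \<Rightarrow> real) \<Rightarrow> ('n \<Rightarrow> real^'n \<Rightarrow> real) \<Rightarrow> ('n \<Rightarrow> real^'n \<Rightarrow> real) \<Rightarrow> bool" where
  "has_C2_partials f f1 f2 \<longleftrightarrow> continuous_on UNIV f \<and>
     (\<forall>i. continuous_on UNIV (f1 i) \<and> continuous_on UNIV (f2 i) \<and>
       (\<forall>x. ((\<lambda>t. f (x + t *\<^sub>R axis i 1)) has_real_derivative f1 i x) (at 0) \<and>
            ((\<lambda>t. f1 i (x + t *\<^sub>R axis i 1)) has_real_derivative f2 i x) (at 0)))"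

lemma directional_derivative_zero_outside:
  fixes f f' :: "'a::real_normed_vector \<Rightarrow> real"
  assumes deriv: "((\<lambda>t. f (x + t *\<^sub>R e)) has_real_derivative f' x) (at 0)"
    and supp: "\<And>x. norm x > R \<Longrightarrow> f x = 0" and x: "norm x > R"
  shows "f' x = 0"
proof -
  have "((\<lambda>t. x + t *\<^sub>R e) \<longlongrightarrow> x + 0 *\<^sub>R e) (at (0::real))" by (intro tendsto_intros)
  then have "((\<lambda>t. norm (x + t *\<^sub>R e)) \<longlongrightarrow> norm x) (at 0)" by (auto dest: tendsto_norm)
  then have "\<forall>\<^sub>F t in at 0. norm (x + t *\<^sub>R e) > R" using x by (rule order_tendstoD)
  then have "\<forall>\<^sub>F t in nhds 0. f (x + t *\<^sub>R e) = 0"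
    using supp x by (auto simp: eventually_at_filter elim!: eventually_mono)
  then have "((\<lambda>t::real. 0) has_real_derivative f' x) (at 0)"
    using deriv by (subst (asm) DERIV_cong_ev[OF refl _ refl]) auto
  then show ?thesis using DERIV_unique DERIV_const by blast
qed

lemma has_C2_partials_zero_outside:
  assumes "has_C2_partials f f1 f2" "\<And>x. norm x > R \<Longrightarrow> f x = 0" "norm x > R"
  shows "f1 i x = 0" "f2 i x = 0"
proof -
  have "f1 i x = 0" if "norm x > R" for x
    by (rule directional_derivative_zero_outside[of f x "axis i 1" "f1 i", OF _ assms(2) that])
      (use assms(1) in \<open>auto simp: has_C2_partials_def\<close>)
  then show "f1 i x = 0" "f2 i x = 0"
    using directional_derivative_zero_outside[of "f1 i" x "axis i 1" "f2 i" R] assms(1,3)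
    by (auto simp: has_C2_partials_def)
qed

text \<open>In each coordinate, f g'' - f'' g is the derivative of f g' - f' g, whose integral
  vanishes. Compact support is asked of \<open>g\<close> alone, so \<open>f\<close> may be a weight
  or a potential spread over the whole space.\<close>

lemma Green_identity:
  assumes f: "has_C2_partials f f1 f2" and g: "has_C2_partials g g1 g2"
    and supp: "\<And>x. norm x > R \<Longrightarrow> g x = 0"
  shows "(LINT x|lborel. f x * (\<Sum>i\<in>UNIV. g2 i x)) = (LINT x|lborel. (\<Sum>i\<in>UNIV. f2 i x) * g x)"
proof -
  note cont[continuous_intros] = f[unfolded has_C2_partials_def, THEN conjunct1] g[unfolded has_C2_partials_def, THEN conjunct1]
    f[unfolded has_C2_partials_def, THEN conjunct2, rule_format, THEN conjunct1]
    f[unfolded has_C2_partials_def, THEN conjunct2, rule_format, THEN conjunct2, THEN conjunct1]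
    g[unfolded has_C2_partials_def, THEN conjunct2, rule_format, THEN conjunct1]
    g[unfolded has_C2_partials_def, THEN conjunct2, rule_format, THEN conjunct2, THEN conjunct1]
  note z = has_C2_partials_zero_outside[OF g supp]
  have zero: "(LINT x|lborel. f x * g2 i x - f2 i x * g x) = 0" for i
  proof (rule integral_directional_derivative_eq_0[where f = "\<lambda>x. f x * g1 i x - f1 i x * g x" and R = R and e = "axis i 1"])
    fix x
    have "((\<lambda>t. f (x + t *\<^sub>R axis i 1)) has_real_derivative f1 i x) (at 0)"
      "((\<lambda>t. f1 i (x + t *\<^sub>R axis i 1)) has_real_derivative f2 i x) (at 0)"
      "((\<lambda>t. g (x + t *\<^sub>R axis i 1)) has_real_derivative g1 i x) (at 0)"
      "((\<lambda>t. g1 i (x + t *\<^sub>R axis i 1)) has_real_derivative g2 i x) (at 0)"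
      using f g by (auto simp: has_C2_partials_def)
    then show "((\<lambda>t. f (x + t *\<^sub>R axis i 1) * g1 i (x + t *\<^sub>R axis i 1) - f1 i (x + t *\<^sub>R axis i 1) * g (x + t *\<^sub>R axis i 1))
       has_real_derivative f x * g2 i x - f2 i x * g x) (at 0)"
      by (auto intro!: derivative_eq_intros)
  qed (auto intro!: continuous_intros simp: z supp)
  have int: "integrable lborel (\<lambda>x. f x * g2 i x)" "integrable lborel (\<lambda>x. f2 i x * g x)" for i
    by (rule continuous_zero_outside_integrable[where R = R]; auto intro!: continuous_intros simp: z supp)+
  have "(LINT x|lborel. f x * g2 i x) = (LINT x|lborel. f2 i x * g x)" for i
    using zero[of i] int by simp
  then show ?thesis
    using int by (simp add: sum_distrib_left sum_distrib_right)
qed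

section \<open>Smooth, radial and composed functions with C2 partials\<close>

lemma smooth_partial_deriv:
  assumes "smooth f"
  shows "smooth (partial_deriv i f)"
  unfolding smooth_def
proof (intro allI)
  fix "is" x
  have "foldr partial_deriv (is @ [i]) f differentiable (at x)"
    using assms unfolding smooth_def by blast
  then show "foldr partial_deriv is (partial_deriv i f) differentiable (at x)" by simp
qed

lemma smooth_differentiable:
  assumes "smooth f"
  shows "f differentiable (at x)"
  using assms[unfolded smooth_def, rule_format, of "[]" x] by simp

lemma smooth_continuous_on: "smooth f \<Longrightarrow> continuous_on A f"
  by (intro continuous_at_imp_continuous_on ballI differentiable_imp_continuous_within smooth_differentiable)

lemma smooth_partial_has_real_derivative:
  assumes "smooth f"
  shows "((\<lambda>t. f (x + t *\<^sub>R axis i 1)) has_real_derivative partial_deriv i f x) (at 0)"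
proof -
  have f: "(f has_derivative frechet_derivative f (at x)) (at x)"
    using smooth_differentiable[OF assms] frechet_derivative_works by blast
  then have lin: "bounded_linear (frechet_derivative f (at x))" by (rule has_derivative_bounded_linear)
  have "((\<lambda>t::real. f (x + t *\<^sub>R axis i 1)) has_derivative (\<lambda>t. frechet_derivative f (at x) (t *\<^sub>R axis i 1))) (at 0)"
    by (rule has_derivative_compose[of "\<lambda>t. x + t *\<^sub>R axis i 1" "\<lambda>t. t *\<^sub>R axis i 1" 0 UNIV f])
      (auto intro!: derivative_eq_intros simp: f)
  then show ?thesis
    using lin by (simp add: has_field_derivative_def partial_deriv_def mult_commute_abs linear_simps)
qed

lemma has_C2_partials_smooth:
  assumes "smooth f"
  shows "has_C2_partials f (\<lambda>i. partial_deriv i f) (\<lambda>i. partial_deriv i (partial_deriv i f))"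
  unfolding has_C2_partials_def
  by (intro conjI allI smooth_continuous_on smooth_partial_has_real_derivative smooth_partial_deriv assms)

text \<open>The chain rule in s = x \<bullet> x. The derivatives of \<open>h\<close> and
  \<open>h1\<close> are two-sided even at s = 0, so these functions must be defined suitably below 0
  too.\<close>

lemma has_C2_partials_radial:
  assumes "continuous_on {0..} h1" "continuous_on {0..} h2"
    and h: "\<And>s. s \<ge> 0 \<Longrightarrow> (h has_real_derivative h1 s) (at s)"
      "\<And>s. s \<ge> 0 \<Longrightarrow> (h1 has_real_derivative h2 s) (at s)"
  shows "has_C2_partials (\<lambda>x. h (x \<bullet> x)) (\<lambda>i x. 2 * x $ i * h1 (x \<bullet> x))
     (\<lambda>i x. 2 * h1 (x \<bullet> x) + 4 * (x $ i)\<^sup>2 * h2 (x \<bullet> x))"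
proof -
  have "continuous_on {0..} h"
    using h(1) by (metis DERIV_isCont atLeast_iff continuous_at_imp_continuous_on)
  note [continuous_intros] = this[THEN continuous_on_compose2] assms(1,2)[THEN continuous_on_compose2]
  have ip: "((\<lambda>t::real. (x + t *\<^sub>R axis i 1) \<bullet> (x + t *\<^sub>R axis i 1)) has_real_derivative 2 * x $ i) (at 0)" for x :: "real^'b" and i
    unfolding inner_add_left inner_add_right inner_scaleR_left inner_scaleR_right inner_axis inner_axis'
    by (auto intro!: derivative_eq_intros)
  have D: "((\<lambda>t::real. k ((x + t *\<^sub>R axis i 1) \<bullet> (x + t *\<^sub>R axis i 1))) has_real_derivative k' (x \<bullet> x) * (2 * x $ i)) (at 0)"
    if "\<And>s. s \<ge> 0 \<Longrightarrow> (k has_real_derivative k' s) (at s)" for k k' and x :: "real^'b" and i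
  proof -
    have "(k has_real_derivative k' (x \<bullet> x)) (at ((x + 0 *\<^sub>R axis i 1) \<bullet> (x + 0 *\<^sub>R axis i 1)))"
      using that[of "x \<bullet> x"] by simp
    from DERIV_chain2[OF this ip[of x i]] show ?thesis .
  qed
  show ?thesis
    unfolding has_C2_partials_def
  proof (intro conjI allI)
    fix i and x :: "real^'b"
    show "((\<lambda>t. h ((x + t *\<^sub>R axis i 1) \<bullet> (x + t *\<^sub>R axis i 1))) has_real_derivative 2 * x $ i * h1 (x \<bullet> x)) (at 0)"
      using D[OF h(1)] by (simp add: mult.commute)
    have "((\<lambda>t. 2 * (x $ i + t) * h1 ((x + t *\<^sub>R axis i 1) \<bullet> (x + t *\<^sub>R axis i 1)))
        has_real_derivative 2 * h1 (x \<bullet> x) + 4 * (x $ i)\<^sup>2 * h2 (x \<bullet> x)) (at 0)"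
      by (rule derivative_eq_intros D[OF h(2)] refl | assumption)+ (simp add: power2_eq_square)
    then show "((\<lambda>t. 2 * (x + t *\<^sub>R axis i 1) $ i * h1 ((x + t *\<^sub>R axis i 1) \<bullet> (x + t *\<^sub>R axis i 1)))
        has_real_derivative 2 * h1 (x \<bullet> x) + 4 * (x $ i)\<^sup>2 * h2 (x \<bullet> x)) (at 0)"
      by (simp add: axis_def)
  qed (auto intro!: continuous_intros)
qed

lemma has_C2_partials_compose:
  assumes f: "has_C2_partials f f1 f2"
    and "continuous_on UNIV \<beta>1" "continuous_on UNIV \<beta>2"
    and b: "\<And>s. (\<beta> has_real_derivative \<beta>1 s) (at s)" "\<And>s. (\<beta>1 has_real_derivative \<beta>2 s) (at s)"
  shows "has_C2_partials (\<lambda>x. \<beta> (f x)) (\<lambda>i x. \<beta>1 (f x) * f1 i x)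
     (\<lambda>i x. \<beta>2 (f x) * (f1 i x)\<^sup>2 + \<beta>1 (f x) * f2 i x)"
proof -
  have "continuous_on UNIV \<beta>"
    using b(1) by (meson DERIV_isCont continuous_at_imp_continuous_on)
  note [continuous_intros] = this[THEN continuous_on_compose2] assms(2,3)[THEN continuous_on_compose2]
  note cont[continuous_intros] = f[unfolded has_C2_partials_def, THEN conjunct1]
    f[unfolded has_C2_partials_def, THEN conjunct2, rule_format, THEN conjunct1]
    f[unfolded has_C2_partials_def, THEN conjunct2, rule_format, THEN conjunct2, THEN conjunct1]
  have f1: "((\<lambda>t. f (x + t *\<^sub>R axis i 1)) has_real_derivative f1 i x) (at 0)"
    and f2: "((\<lambda>t. f1 i (x + t *\<^sub>R axis i 1)) has_real_derivative f2 i x) (at 0)" for x i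
    using f by (auto simp: has_C2_partials_def)
  have D: "((\<lambda>t. k (f (x + t *\<^sub>R axis i 1))) has_real_derivative k' (f x) * f1 i x) (at 0)"
    if "\<And>s. (k has_real_derivative k' s) (at s)" for k k' x i
    using DERIV_chain2[OF that f1[of x i]] by simp
  show ?thesis
    unfolding has_C2_partials_def
  proof (intro conjI allI)
    fix i x
    show "((\<lambda>t. \<beta> (f (x + t *\<^sub>R axis i 1))) has_real_derivative \<beta>1 (f x) * f1 i x) (at 0)"
      using D[OF b(1)] by simp
    show "((\<lambda>t. \<beta>1 (f (x + t *\<^sub>R axis i 1)) * f1 i (x + t *\<^sub>R axis i 1)) has_real_derivative
        \<beta>2 (f x) * (f1 i x)\<^sup>2 + \<beta>1 (f x) * f2 i x) (at 0)"
      by (rule DERIV_cong[OF DERIV_mult[OF D[OF b(2)] f2]]) (simp add: power2_eq_square algebra_simps)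
  qed (auto intro!: continuous_intros)
qed

section \<open>Supports of test functions and of their Laplacians\<close>

lemma test_function_zero_outside:
  assumes "test_function f"
  obtains R where "R > 0" "\<And>x. norm x > R \<Longrightarrow> f x = 0"
proof -
  have "bounded (closure {x. f x \<noteq> 0})"
    using assms by (simp add: test_function_def compact_imp_bounded)
  then obtain R where "R > 0" "closure {x. f x \<noteq> 0} \<subseteq> ball 0 R"
    using bounded_subset_ballD[of "closure {x. f x \<noteq> 0}" 0] by blast
  then show ?thesis
    using that[of R] closure_subset[of "{x. f x \<noteq> 0}"] by force
qed

lemma test_functionI:
  assumes "smooth f" "\<And>x. norm x > R \<Longrightarrow> f x = 0"
  shows "test_function f"
proof -
  have "{x. f x \<noteq> 0} \<subseteq> cball 0 R" using assms(2) by (force simp: not_le[symmetric])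
  then have "bounded (closure {x. f x \<noteq> 0})" by (rule bounded_closure[OF bounded_subset[OF bounded_cball]])
  then show ?thesis using assms(1) by (simp add: test_function_def compact_eq_bounded_closed)
qed

lemma laplacian_zero_outside:
  assumes "smooth f" "\<And>x. norm x > R \<Longrightarrow> f x = 0" "norm x > R"
  shows "laplacian f x = 0"
  using has_C2_partials_zero_outside(2)[OF has_C2_partials_smooth[OF assms(1)] assms(2,3)]
  by (simp add: laplacian_def)

lemma laplacian_continuous_on: "smooth f \<Longrightarrow> continuous_on A (laplacian f)"
  unfolding laplacian_def by (intro continuous_intros smooth_continuous_on smooth_partial_deriv)

text \<open>The Laplacian of \<beta>(\<phi>) is \<beta>''(\<phi>) times the squared gradient plus
  \<beta>'(\<phi>) times the Laplacian of \<phi>. Convexity gives the first term a sign, and Green's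
  identity moves the Laplacian onto \<open>V\<close>. The condition \<beta>(0) = 0 keeps the support
  compact.\<close>

lemma Kato_inequality:
  assumes \<phi>: "smooth \<phi>" "\<And>x. norm x > R \<Longrightarrow> \<phi> x = 0"
    and V: "has_C2_partials V V1 V2" "\<And>x. V x \<ge> 0"
    and b: "continuous_on UNIV \<beta>1" "continuous_on UNIV \<beta>2"
      "\<And>s. (\<beta> has_real_derivative \<beta>1 s) (at s)" "\<And>s. (\<beta>1 has_real_derivative \<beta>2 s) (at s)"
    and "\<beta> 0 = 0" "\<And>s. \<beta>2 s \<ge> 0"
  shows "(LINT x|lborel. - (\<Sum>i\<in>UNIV. V2 i x) * \<beta> (\<phi> x)) \<le> (LINT x|lborel. V x * (\<bar>\<beta>1 (\<phi> x)\<bar> * \<bar>laplacian \<phi> x\<bar>))"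
proof -
  note C = has_C2_partials_compose[OF has_C2_partials_smooth[OF \<phi>(1)] b]
  note z = has_C2_partials_zero_outside[OF has_C2_partials_smooth[OF \<phi>(1)] \<phi>(2)]
  have "continuous_on UNIV \<beta>"
    using b(3) by (meson DERIV_isCont continuous_at_imp_continuous_on)
  note [continuous_intros] = this[THEN continuous_on_compose2] b(1,2)[THEN continuous_on_compose2]
    smooth_continuous_on[OF \<phi>(1)] smooth_continuous_on[OF smooth_partial_deriv[OF \<phi>(1)]]
    smooth_continuous_on[OF smooth_partial_deriv[OF smooth_partial_deriv[OF \<phi>(1)]]]
    laplacian_continuous_on[OF \<phi>(1)]
    V(1)[unfolded has_C2_partials_def, THEN conjunct1]
  define L where "L x = (\<Sum>i\<in>UNIV. \<beta>2 (\<phi> x) * (partial_deriv i \<phi> x)\<^sup>2 + \<beta>1 (\<phi> x) * partial_deriv i (partial_deriv i \<phi>) x)" for x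
  have L: "L x \<ge> - (\<bar>\<beta>1 (\<phi> x)\<bar> * \<bar>laplacian \<phi> x\<bar>)" for x
  proof -
    have "L x = (\<Sum>i\<in>UNIV. \<beta>2 (\<phi> x) * (partial_deriv i \<phi> x)\<^sup>2) + \<beta>1 (\<phi> x) * laplacian \<phi> x"
      by (simp add: L_def laplacian_def sum.distrib sum_distrib_left)
    moreover have "(\<Sum>i\<in>UNIV. \<beta>2 (\<phi> x) * (partial_deriv i \<phi> x)\<^sup>2) \<ge> 0"
      by (intro sum_nonneg mult_nonneg_nonneg assms) auto
    moreover have "\<beta>1 (\<phi> x) * laplacian \<phi> x \<ge> - \<bar>\<beta>1 (\<phi> x) * laplacian \<phi> x\<bar>" by (rule abs_ge_minus_self[THEN le_imp_neg_le, simplified])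
    ultimately show ?thesis by (simp add: abs_mult)
  qed
  have "(LINT x|lborel. - (\<Sum>i\<in>UNIV. V2 i x) * \<beta> (\<phi> x)) = (LINT x|lborel. - (V x * L x))"
    using Green_identity[OF V(1) C, of R] \<phi>(2) \<open>\<beta> 0 = 0\<close> by (simp add: L_def)
  also have "\<dots> \<le> (LINT x|lborel. V x * (\<bar>\<beta>1 (\<phi> x)\<bar> * \<bar>laplacian \<phi> x\<bar>))"
  proof (rule integral_mono)
    show "integrable lborel (\<lambda>x. - (V x * L x))"
      unfolding L_def by (rule continuous_zero_outside_integrable[where R = R]) (auto intro!: continuous_intros simp: z)
    show "integrable lborel (\<lambda>x. V x * (\<bar>\<beta>1 (\<phi> x)\<bar> * \<bar>laplacian \<phi> x\<bar>))"
      by (rule continuous_zero_outside_integrable[where R = R]) (auto intro!: continuous_intros simp: laplacian_zero_outside[OF \<phi>])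
    show "- (V x * L x) \<le> V x * (\<bar>\<beta>1 (\<phi> x)\<bar> * \<bar>laplacian \<phi> x\<bar>)" for x
      using mult_left_mono[OF L[of x] V(2)[of x]] by simp
  qed
  finally show ?thesis .
qed

section \<open>Integrals of radial functions\<close>

text \<open>Polar coordinates in the variable t = x \<bullet> x. It suffices to compare half-lines:
  the preimage of \<open>{..a}\<close> is the ball of radius \<open>sqrt a\<close>, its volume is a
  constant times a^(N/2), and the density is the derivative of this.\<close>

lemma distr_norm_square_lborel:
  defines "c \<equiv> unit_ball_vol (real CARD('n)) * (real CARD('n) / 2)"
  shows "distr lborel borel (\<lambda>x::real^'n::finite. x \<bullet> x) =
    density lborel (\<lambda>t. ennreal (c * t powr (real CARD('n) / 2 - 1)) * indicator {0..} t)" (is "?M = ?N")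
proof (rule measure_eqI_generator_eq[where E = "range (\<lambda>a. {..a::real})" and A = "\<lambda>n. {..real n}" and \<Omega> = UNIV])
  let ?m = "real CARD('n) / 2"
  have m: "?m > 0" by simp
  have M: "emeasure ?M {..a} = (if a \<ge> 0 then ennreal (unit_ball_vol (real CARD('n)) * a powr ?m) else 0)" for a
  proof -
    have "emeasure ?M {..a} = emeasure lborel {x::real^'n. x \<bullet> x \<le> a}"
      by (subst emeasure_distr) (auto simp: vimage_def)
    moreover have "{x::real^'n. x \<bullet> x \<le> a} = cball 0 (sqrt a)" if "a \<ge> 0"
    proof -
      have "x \<bullet> x \<le> a \<longleftrightarrow> norm x \<le> sqrt a" for x :: "real^'n"
        by (metis norm_eq_sqrt_inner real_sqrt_le_iff)
      then show ?thesis by (simp add: set_eq_iff)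
    qed
    moreover have "{x::real^'n. x \<bullet> x \<le> a} = {}" if "\<not> a \<ge> 0"
    proof -
      have "\<not> x \<bullet> x \<le> a" for x :: "real^'n" using that inner_ge_zero[of x] by linarith
      then show ?thesis by blast
    qed
    moreover have "sqrt a ^ CARD('n) = a powr ?m" if "a \<ge> 0"
      using that by (cases "a = 0") (simp_all add: powr_half_sqrt[symmetric] powr_powr powr_realpow[symmetric])
    ultimately show ?thesis
      by (simp add: emeasure_cball)
  qed
  have N: "emeasure ?N {..a} = (if a \<ge> 0 then ennreal (unit_ball_vol (real CARD('n)) * a powr ?m) else 0)" for a
  proof (cases "a \<ge> 0")
    case True
    have "((\<lambda>t. t powr (?m - 1)) has_integral (a powr (?m - 1 + 1) / (?m - 1 + 1))) {0..a}"
      using True m by (intro has_integral_powr_from_0) auto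
    from has_integral_mult_right[OF this, of c]
    have "((\<lambda>t. c * t powr (?m - 1)) has_integral (unit_ball_vol (real CARD('n)) * a powr ?m)) {0..a}"
      by (simp add: c_def)
    from nn_integral_has_integral_lebesgue[OF _ this]
    have "(\<integral>\<^sup>+t. indicator {0..a} t * (c * t powr (?m - 1)) \<partial>lborel) = unit_ball_vol (real CARD('n)) * a powr ?m"
      by (simp add: c_def)
    moreover have "emeasure ?N {..a} = (\<integral>\<^sup>+t. indicator {0..a} t * (c * t powr (?m - 1)) \<partial>lborel)"
      by (subst emeasure_density) (auto intro!: nn_integral_cong simp: indicator_def)
    ultimately show ?thesis using True by simp
  next
    case False
    then show ?thesis
      by (subst emeasure_density; (subst nn_integral_cong[where v = "\<lambda>_. 0"])?) (auto simp: indicator_def)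
  qed
  show "emeasure ?M X = emeasure ?N X" if "X \<in> range (\<lambda>a. {..a})" for X
    using that M N by auto
  show "emeasure ?M {..real n} \<noteq> \<infinity>" for n by (simp add: M)
  show "Int_stable (range (\<lambda>a. {..a::real}))" by (auto simp: Int_stable_def)
  have "sets (borel :: real measure) = sigma_sets UNIV (range (\<lambda>a. {..a::real}))"
    by (subst borel_eq_atMost) simp
  then show "sets ?M = sigma_sets UNIV (range (\<lambda>a. {..a::real}))" "sets ?N = sigma_sets UNIV (range (\<lambda>a. {..a::real}))"
    by auto
  show "(\<Union>n. {..real n}) = UNIV" using real_arch_simple by auto
qed auto

lemma nn_integral_radial:
  fixes h :: "real \<Rightarrow> ennreal"
  assumes [measurable]: "h \<in> borel_measurable borel"
  shows "(\<integral>\<^sup>+(x::real^'n::finite). h (x \<bullet> x) \<partial>lborel) =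
    (\<integral>\<^sup>+t. ennreal (unit_ball_vol (real CARD('n)) * (real CARD('n) / 2) * t powr (real CARD('n) / 2 - 1))
        * indicator {0..} t * h t \<partial>lborel)"
proof -
  have "(\<integral>\<^sup>+(x::real^'n). h (x \<bullet> x) \<partial>lborel) = integral\<^sup>N (distr lborel borel (\<lambda>x::real^'n. x \<bullet> x)) h"
    by (subst nn_integral_distr) auto
  also have "\<dots> = (\<integral>\<^sup>+t. ennreal (unit_ball_vol (real CARD('n)) * (real CARD('n) / 2) * t powr (real CARD('n) / 2 - 1))
        * indicator {0..} t * h t \<partial>lborel)"
    unfolding distr_norm_square_lborel by (subst nn_integral_density) auto
  finally show ?thesis .
qed

text \<open>With m = N/2 and t the squared norm, split at t = s: the radial integrand is a multiple
  of s^e t^(m-1) below and of t^(e+m-1) above. Both pieces are multiples of s^(e+m), and the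
  hypothesis makes the outer one converge. The use is e = (1 - m) p / (p - 1), the conjugate norm of
  the truncated kernel.\<close>

lemma nn_integral_truncated_power:
  fixes e :: real
  assumes e: "e + real CARD('n) / 2 < 0"
  shows "\<exists>K > 0. \<forall>s > 0. (\<integral>\<^sup>+(x::real^'n::finite). ennreal (max (x \<bullet> x) s powr e) \<partial>lborel)
      \<le> ennreal (K * s powr (e + real CARD('n) / 2))"
proof -
  define m where "m = real CARD('n) / 2"
  have m: "m > 0" "e + m < 0" using e by (auto simp: m_def)
  define c where "c = unit_ball_vol (real CARD('n)) * m"
  have c: "c > 0" using m by (simp add: c_def)
  define d where "d = - (e + m)"
  have d: "d > 0" using m by (simp add: d_def)
  show ?thesis
  proof (intro exI conjI allI impI)
    \<comment> \<open>The summands 1/m and 1/d come from the inner and the outer piece.\<close>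
    show "c * (1 / m + 1 / d) > 0"
      using c m d by (intro mult_pos_pos add_pos_pos divide_pos_pos) auto
    fix s :: real assume s: "s > 0"
    have "((\<lambda>t. t powr (m - 1)) has_integral (s powr (m - 1 + 1) / (m - 1 + 1))) {0..s}"
      using s m by (intro has_integral_powr_from_0) auto
    from has_integral_mult_right[OF this, of "c * s powr e"]
    have "((\<lambda>t. c * s powr e * t powr (m - 1)) has_integral (c * (1 / m) * s powr (e + m))) {0..s}"
      by (simp add: powr_add mult.assoc)
    from nn_integral_has_integral_lebesgue[OF _ this]
    have 1: "(\<integral>\<^sup>+t. indicator {0..s} t * (c * s powr e * t powr (m - 1)) \<partial>lborel) = c * (1 / m) * s powr (e + m)"
      using c by simp
    have "((\<lambda>t. t powr (e + m - 1)) has_integral -(s powr (e + m - 1 + 1)) / (e + m - 1 + 1)) {s..}"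
      using s m by (intro has_integral_powr_to_inf) auto
    from has_integral_mult_right[OF this, of c]
    have "((\<lambda>t. c * t powr (e + m - 1)) has_integral c * (-(s powr (e + m)) / (e + m))) {s..}"
      by simp
    moreover have "c * (-(s powr (e + m)) / (e + m)) = c * (1 / d) * s powr (e + m)"
    proof -
      have "e + m = - d" by (simp add: d_def)
      then show ?thesis by (simp only:) simp
    qed
    ultimately have "((\<lambda>t. c * t powr (e + m - 1)) has_integral c * (1 / d) * s powr (e + m)) {s..}"
      by simp
    from nn_integral_has_integral_lebesgue[OF _ this]
    have 2: "(\<integral>\<^sup>+t. indicator {s..} t * (c * t powr (e + m - 1)) \<partial>lborel) = c * (1 / d) * s powr (e + m)"
      using c d by simp
    have "(\<integral>\<^sup>+(x::real^'n). ennreal (max (x \<bullet> x) s powr e) \<partial>lborel)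
       = (\<integral>\<^sup>+t. ennreal (c * t powr (m - 1)) * indicator {0..} t * ennreal (max t s powr e) \<partial>lborel)"
      unfolding c_def m_def by (rule nn_integral_radial) simp
    also have "\<dots> \<le> (\<integral>\<^sup>+t. ennreal (indicator {0..s} t * (c * s powr e * t powr (m - 1)))
        + ennreal (indicator {s..} t * (c * t powr (e + m - 1))) \<partial>lborel)"
    proof (rule nn_integral_mono)
      fix t
      show "ennreal (c * t powr (m - 1)) * indicator {0..} t * ennreal (max t s powr e)
        \<le> ennreal (indicator {0..s} t * (c * s powr e * t powr (m - 1)))
        + ennreal (indicator {s..} t * (c * t powr (e + m - 1)))"
      proof (cases "t < s")
        case True
        then show ?thesis using c by (auto simp: indicator_def max_def ennreal_mult'[symmetric] mult_ac)
      next
        case False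
        then have "ennreal (c * t powr (m - 1)) * indicator {0..} t * ennreal (max t s powr e) = ennreal (indicator {s..} t * (c * t powr (e + m - 1)))"
          using c s by (auto simp: indicator_def max_def ennreal_mult'[symmetric] mult_ac powr_add[symmetric] algebra_simps)
        then show ?thesis by simp
      qed
    qed
    also have "\<dots> = ennreal (c * (1 / m) * s powr (e + m)) + ennreal (c * (1 / d) * s powr (e + m))"
      using 1 2 by (subst nn_integral_add) auto
    also have "\<dots> = ennreal (c * (1 / m + 1 / d) * s powr (e + m))"
      using c m d by (subst ennreal_plus[symmetric]) (auto simp: algebra_simps)
    finally show "(\<integral>\<^sup>+(x::real^'n). ennreal (max (x \<bullet> x) s powr e) \<partial>lborel)
      \<le> ennreal (c * (1 / m + 1 / d) * s powr (e + real CARD('n) / 2))"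
      unfolding m_def .
  qed
qed

text \<open>Young's inequality for \<open>f\<close> and \<open>g\<close> divided by A^(1/p) and
  B^(1/q). Since \<open>A\<close> and \<open>B\<close> are positive upper bounds rather than the
  integrals themselves, no vanishing or infinite norm has to be treated apart.\<close>

lemma nn_integral_Holder:
  fixes f g :: "'a \<Rightarrow> real"
  assumes [measurable]: "f \<in> borel_measurable M" "g \<in> borel_measurable M"
    and nn: "\<And>x. f x \<ge> 0" "\<And>x. g x \<ge> 0"
    and pq: "p > 1" "q > 1" "1 / p + 1 / q = 1" and AB: "A > 0" "B > 0"
    and A: "(\<integral>\<^sup>+x. ennreal (f x powr p) \<partial>M) \<le> ennreal A"
    and B: "(\<integral>\<^sup>+x. ennreal (g x powr q) \<partial>M) \<le> ennreal B"
  shows "(\<integral>\<^sup>+x. ennreal (f x * g x) \<partial>M) \<le> ennreal (A powr (1 / p) * B powr (1 / q))"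
proof -
  define C where "C = A powr (1 / p) * B powr (1 / q)"
  have C: "C > 0" using AB by (simp add: C_def)
  have "(\<integral>\<^sup>+x. ennreal (f x * g x) \<partial>M) \<le>
      (\<integral>\<^sup>+x. ennreal (C / (p * A)) * ennreal (f x powr p) + ennreal (C / (q * B)) * ennreal (g x powr q) \<partial>M)"
  proof (rule nn_integral_mono)
    fix x
    have "f x / A powr (1 / p) * (g x / B powr (1 / q)) \<le>
      (f x / A powr (1 / p)) powr p / p + (g x / B powr (1 / q)) powr q / q"
      using pq nn by (intro Youngs_inequality) auto
    then have "f x * g x / C \<le> f x powr p / A / p + g x powr q / B / q"
      using pq AB nn by (simp add: C_def powr_divide powr_powr)
    then have "f x * g x \<le> C * (f x powr p / A / p + g x powr q / B / q)"
      using C by (simp add: pos_divide_le_eq mult.commute)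
    also have "\<dots> = C / (p * A) * f x powr p + C / (q * B) * g x powr q"
      using AB pq by (simp add: field_simps)
    finally show "ennreal (f x * g x) \<le> ennreal (C / (p * A)) * ennreal (f x powr p) + ennreal (C / (q * B)) * ennreal (g x powr q)"
      using C AB pq by (simp add: ennreal_mult''[symmetric] ennreal_plus[symmetric] del: ennreal_plus)
  qed
  also have "\<dots> = ennreal (C / (p * A)) * (\<integral>\<^sup>+x. ennreal (f x powr p) \<partial>M) + ennreal (C / (q * B)) * (\<integral>\<^sup>+x. ennreal (g x powr q) \<partial>M)"
    by (subst nn_integral_add) (auto simp: nn_integral_cmult)
  also have "\<dots> \<le> ennreal (C / (p * A)) * ennreal A + ennreal (C / (q * B)) * ennreal B"
    by (intro add_mono mult_left_mono A B) auto
  also have "\<dots> = ennreal (C * (1 / p + 1 / q))"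
    using C AB pq by (simp add: ennreal_mult''[symmetric] ennreal_plus[symmetric] field_simps del: ennreal_plus)
  finally show ?thesis using pq by (simp add: C_def)
qed

lemma integral_lborel_affine:
  fixes f :: "'a::euclidean_space \<Rightarrow> real"
  assumes [measurable]: "f \<in> borel_measurable borel" and c: "c \<noteq> 0"
  shows "(LINT x|lborel. f x) = \<bar>c\<bar> ^ DIM('a) * (LINT x|lborel. f (t + c *\<^sub>R x))"
  by (subst lborel_affine[OF c, of t])
    (simp add: integral_density integral_distr)

section \<open>The Rellich inequality\<close>

text \<open>The case r = 1 is separate because \<open>0 powr 0 = 0\<close>: the general formula
  would give 0 instead of 1 at s = 0. It occurs for p = 2, when the derivative of |s|^p is
  differentiated once more with r = p - 1.\<close>

lemma sgn_abs_powr_has_real_derivative: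
  assumes "r \<ge> 1"
  shows "((\<lambda>s. sgn s * \<bar>s\<bar> powr r) has_real_derivative (if r = 1 then 1 else r * \<bar>s\<bar> powr (r - 1))) (at s)"
proof (cases "r = 1")
  case True
  have "((\<lambda>s. s) has_real_derivative 1) (at s)" by simp
  moreover have "(\<lambda>s::real. sgn s * \<bar>s\<bar> powr 1) = (\<lambda>s. s)" by (auto simp: fun_eq_iff sgn_mult_abs)
  ultimately show ?thesis using True by simp
next
  case False
  then have r: "r > 1" using assms by simp
  consider "s < 0" | "s = 0" | "s > 0" by linarith
  then show ?thesis
  proof cases
    case 1
    have "((\<lambda>s. - ((- s) powr r)) has_real_derivative r * (- s) powr (r - 1)) (at s)"
      using 1 by (auto intro!: derivative_eq_intros)
    then have "((\<lambda>s. sgn s * \<bar>s\<bar> powr r) has_real_derivative r * (- s) powr (r - 1)) (at s)"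
      by (rule has_field_derivative_transform_within_open[where S="{..<0}"]) (use 1 in auto)
    then show ?thesis using 1 r by simp
  next
    case 2
    have "((\<lambda>h. \<bar>h\<bar> powr (r - 1)) \<longlongrightarrow> \<bar>0\<bar> powr (r - 1)) (at (0::real))"
      by (intro tendsto_intros) (use r in auto)
    then have "((\<lambda>h. \<bar>h\<bar> powr (r - 1)) \<longlongrightarrow> 0) (at (0::real))" by simp
    then have "((\<lambda>h. (sgn (0 + h) * \<bar>0 + h\<bar> powr r - sgn 0 * \<bar>0\<bar> powr r) / h) \<longlongrightarrow> 0) (at 0)"
      by (rule Lim_transform_eventually)
        (auto simp: eventually_at_filter powr_diff sgn_if field_simps)
    then show ?thesis using 2 r by (simp add: DERIV_def)
  next
    case 3
    have "((\<lambda>s. s powr r) has_real_derivative r * s powr (r - 1)) (at s)"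
      using 3 by (auto intro!: derivative_eq_intros)
    then have "((\<lambda>s. sgn s * \<bar>s\<bar> powr r) has_real_derivative r * s powr (r - 1)) (at s)"
      by (rule has_field_derivative_transform_within_open[where S="{0<..}"]) (use 3 in auto)
    then show ?thesis using 3 r by simp
  qed
qed

lemma abs_powr_has_real_derivative:
  assumes "p > 1"
  shows "((\<lambda>s. \<bar>s\<bar> powr p) has_real_derivative p * (sgn s * \<bar>s\<bar> powr (p - 1))) (at s)"
proof -
  consider "s < 0" | "s = 0" | "s > 0" by linarith
  then show ?thesis
  proof cases
    case 1
    have "((\<lambda>s. (- s) powr p) has_real_derivative - (p * (- s) powr (p - 1))) (at s)"
      using 1 by (auto intro!: derivative_eq_intros)
    then have "((\<lambda>s. \<bar>s\<bar> powr p) has_real_derivative - (p * (- s) powr (p - 1))) (at s)"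
      by (rule has_field_derivative_transform_within_open[where S="{..<0}"]) (use 1 in auto)
    then show ?thesis using 1 by simp
  next
    case 2
    have "((\<lambda>h. sgn h * \<bar>h\<bar> powr (p - 1)) \<longlongrightarrow> 0) (at (0::real))"
    proof (rule Lim_null_comparison)
      have "((\<lambda>h. \<bar>h\<bar> powr (p - 1)) \<longlongrightarrow> \<bar>0\<bar> powr (p - 1)) (at (0::real))"
        by (intro tendsto_intros) (use assms in auto)
      then show "((\<lambda>h. \<bar>h\<bar> powr (p - 1)) \<longlongrightarrow> 0) (at (0::real))" by simp
    qed (auto simp: abs_mult sgn_if)
    then have "((\<lambda>h. (\<bar>0 + h\<bar> powr p - \<bar>0\<bar> powr p) / h) \<longlongrightarrow> 0) (at 0)"
      by (rule Lim_transform_eventually)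
        (auto simp: eventually_at_filter powr_diff sgn_if field_simps)
    then show ?thesis using 2 by (simp add: DERIV_def)
  next
    case 3
    have "((\<lambda>s. s powr p) has_real_derivative p * s powr (p - 1)) (at s)"
      using 3 by (auto intro!: derivative_eq_intros)
    then have "((\<lambda>s. \<bar>s\<bar> powr p) has_real_derivative p * s powr (p - 1)) (at s)"
      by (rule has_field_derivative_transform_within_open[where S="{0<..}"]) (use 3 in auto)
    then show ?thesis using 3 by simp
  qed
qed

lemma sum_inner_square: "(\<Sum>i\<in>UNIV. (x $ i)\<^sup>2) = x \<bullet> (x::real^'n::finite)"
  by (simp add: inner_vec_def power2_eq_square)

lemma sum_radial_second_partials:
  "(\<Sum>i\<in>UNIV. 2 * a + 4 * (x $ i)\<^sup>2 * b) = 2 * real CARD('n) * a + 4 * (x \<bullet> x) * (b::real)" for x :: "real^'n::finite"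
  by (simp add: sum.distrib sum_inner_square[symmetric] sum_distrib_left sum_distrib_right)

text \<open>The small factor \<delta> lets the term with a^p be absorbed into the left-hand side of
  an estimate.\<close>

lemma weighted_Young:
  fixes p \<delta> :: real
  assumes "p > 1" "\<delta> > 0"
  shows "\<exists>C > 0. \<forall>a \<ge> 0. \<forall>b \<ge> 0. a powr (p - 1) * b \<le> \<delta> * a powr p + C * b powr p"
proof -
  define q where "q = p / (p - 1)"
  \<comment> \<open>Chosen so that k^q / q = \<delta>; the price is the factor k^(-p) / p on the
    other term.\<close>
  define k where "k = (\<delta> * q) powr (1 / q)"
  have q: "q > 1" "1 / q + 1 / p = 1" using assms by (auto simp: q_def field_simps)
  have k: "k > 0" "k powr q = \<delta> * q" using assms q by (auto simp: k_def powr_powr)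
  show ?thesis
  proof (intro exI conjI allI impI)
    show "inverse k powr p / p > 0" using assms k by simp
    fix a b :: real assume ab: "a \<ge> 0" "b \<ge> 0"
    have "a powr (p - 1) * b = (k * a powr (p - 1)) * (inverse k * b)" using k by simp
    also have "\<dots> \<le> (k * a powr (p - 1)) powr q / q + (inverse k * b) powr p / p"
      using assms q k ab by (intro Youngs_inequality) auto
    also have "(k * a powr (p - 1)) powr q / q = \<delta> * a powr p"
      using q k assms by (simp add: powr_mult powr_powr) (simp add: q_def)
    also have "(inverse k * b) powr p / p = inverse k powr p / p * b powr p"
      using k ab by (simp add: powr_mult)
    finally show "a powr (p - 1) * b \<le> \<delta> * a powr p + inverse k powr p / p * b powr p" .
  qed
qed

text \<open>Minus the Laplacian of V = (x \<bullet> x + \<epsilon>)^(1-p) dominates a multiple of (x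
  \<bullet> x + \<epsilon>)^(-p), and V |\<phi>|^(p-1) is the (p-1)-th power of |\<phi>| / (x
  \<bullet> x + \<epsilon>). Kato's inequality thus bounds the shifted Hardy integral by a mixed
  term, which Young's inequality splits into half of the left-hand side and a multiple of the
  energy. The shift removes the singularity at the origin, and \<open>C\<close> does not depend on
  it.\<close>

lemma Rellich_test_function:
  fixes p :: real
  assumes N: "real CARD('n::finite) > 2 * p" and p: "2 \<le> p"
  shows "\<exists>C > 0. \<forall>\<phi> :: real^'n \<Rightarrow> real. \<forall>\<epsilon> > 0. test_function \<phi> \<longrightarrow>
    (\<integral>\<^sup>+x. ennreal ((x \<bullet> x + \<epsilon>) powr (- p) * \<bar>\<phi> x\<bar> powr p) \<partial>lborel)
      \<le> ennreal (C * (LINT x|lborel. \<bar>laplacian \<phi> x\<bar> powr p))"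
proof -
  \<comment> \<open>The factor of (x \<bullet> x + \<epsilon>)^(-p) in the lower bound for minus the
    Laplacian of the weight; its sign is where N > 2p enters.\<close>
  define c where "c = (p - 1) * (2 * real CARD('n) - 4 * p)"
  have c: "c > 0" using N p by (simp add: c_def)
  \<comment> \<open>The factor p in \<open>\<beta>1\<close> turns c / (2p) into c / 2, half of what
    the left-hand side offers.\<close>
  obtain C where C: "C > 0" "\<And>a b. a \<ge> 0 \<Longrightarrow> b \<ge> 0 \<Longrightarrow> a powr (p - 1) * b \<le> c / (2 * p) * a powr p + C * b powr p"
    using weighted_Young[of p "c / (2 * p)"] c p by force
  have "(\<integral>\<^sup>+x. ennreal ((x \<bullet> x + \<epsilon>) powr (- p) * \<bar>\<phi> x\<bar> powr p) \<partial>lborel)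
      \<le> ennreal (2 * p * C / c * (LINT x|lborel. \<bar>laplacian \<phi> x\<bar> powr p))"
    if tf: "test_function \<phi>" and \<epsilon>: "\<epsilon> > 0" for \<phi> :: "real^'n \<Rightarrow> real" and \<epsilon> :: real
  proof -
    obtain R where R: "R > 0" "\<And>x. norm x > R \<Longrightarrow> \<phi> x = 0" using test_function_zero_outside[OF tf] by blast
    have sm: "smooth \<phi>" using tf by (simp add: test_function_def)
    define h where "h s = (s + \<epsilon>) powr (1 - p)" for s
    define h1 where "h1 s = (1 - p) * (s + \<epsilon>) powr (- p)" for s
    define h2 where "h2 s = (1 - p) * (- p) * (s + \<epsilon>) powr (- p - 1)" for s
    have pos: "x \<bullet> x + \<epsilon> > 0" for x :: "real^'n" using \<epsilon> inner_ge_zero[of x] by linarith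
    have V: "has_C2_partials (\<lambda>x::real^'n. h (x \<bullet> x)) (\<lambda>i x. 2 * x $ i * h1 (x \<bullet> x))
       (\<lambda>i x. 2 * h1 (x \<bullet> x) + 4 * (x $ i)\<^sup>2 * h2 (x \<bullet> x))"
    proof (rule has_C2_partials_radial)
      show "continuous_on {0..} h1" "continuous_on {0..} h2"
        unfolding h1_def h2_def using \<epsilon> by (auto intro!: continuous_intros)
      show "(h has_real_derivative h1 s) (at s)" "(h1 has_real_derivative h2 s) (at s)" if "s \<ge> 0" for s
        unfolding h_def h1_def h2_def using \<epsilon> that by (auto intro!: derivative_eq_intros)
    qed
    define \<beta>1 where "\<beta>1 s = p * (sgn s * \<bar>s\<bar> powr (p - 1))" for s :: real
    define \<beta>2 where "\<beta>2 s = p * (if p - 1 = 1 then 1 else (p - 1) * \<bar>s\<bar> powr (p - 1 - 1))" for s :: real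
    have b: "((\<lambda>s. \<bar>s\<bar> powr p) has_real_derivative \<beta>1 s) (at s)" "(\<beta>1 has_real_derivative \<beta>2 s) (at s)" for s
      unfolding \<beta>1_def \<beta>2_def using p
      by (intro abs_powr_has_real_derivative, simp, intro DERIV_cmult sgn_abs_powr_has_real_derivative, simp)
    have cb: "continuous_on UNIV \<beta>1"
      using b(2) by (meson DERIV_isCont continuous_at_imp_continuous_on)
    have cb2: "continuous_on UNIV \<beta>2"
      unfolding \<beta>2_def using p by (cases "p = 2") (auto intro!: continuous_intros continuous_on_powr')
    define w where "w x = (x \<bullet> x + \<epsilon>) powr (- p) * \<bar>\<phi> x\<bar> powr p" for x
    note [continuous_intros] = smooth_continuous_on[OF sm] laplacian_continuous_on[OF sm]
    have w: "continuous_on UNIV w"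
      unfolding w_def using p by (auto intro!: continuous_intros continuous_on_powr' simp: pos pos[THEN less_imp_le] pos[THEN less_imp_neq, THEN not_sym])
    have iw: "integrable lborel w"
      by (rule continuous_zero_outside_integrable[OF w, of R]) (auto simp: w_def R)
    have iL: "integrable lborel (\<lambda>x. \<bar>laplacian \<phi> x\<bar> powr p)"
      using p by (intro continuous_zero_outside_integrable[of _ R])
        (auto intro!: continuous_intros continuous_on_powr' simp: laplacian_zero_outside[OF sm R(2)])
    have cV2: "continuous_on UNIV (\<lambda>x::real^'n. 2 * real CARD('n) * h1 (x \<bullet> x) + 4 * (x \<bullet> x) * h2 (x \<bullet> x))"
      unfolding h1_def h2_def by (auto intro!: continuous_intros simp: pos pos[THEN less_imp_le] pos[THEN less_imp_neq, THEN not_sym])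
    have cV: "continuous_on UNIV (\<lambda>x::real^'n. h (x \<bullet> x))"
      unfolding h_def by (auto intro!: continuous_intros simp: pos pos[THEN less_imp_le] pos[THEN less_imp_neq, THEN not_sym])
    have cap: "continuous_on UNIV (\<lambda>x. \<bar>\<phi> x\<bar> powr p)"
      using p by (auto intro!: continuous_intros continuous_on_powr')
    have "c * (LINT x|lborel. w x) = (LINT x|lborel. c * w x)" by simp
    also have "\<dots> \<le> (LINT x|lborel. - (\<Sum>i\<in>UNIV. 2 * h1 (x \<bullet> x) + 4 * (x $ i)\<^sup>2 * h2 (x \<bullet> x)) * \<bar>\<phi> x\<bar> powr p)"
      unfolding sum_radial_second_partials
    proof (rule integral_mono)
      show "integrable lborel (\<lambda>x::real^'n. - (2 * real CARD('n) * h1 (x \<bullet> x) + 4 * (x \<bullet> x) * h2 (x \<bullet> x)) * \<bar>\<phi> x\<bar> powr p)"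
        by (rule continuous_zero_outside_integrable[OF continuous_on_mult[OF continuous_on_minus[OF cV2] cap], of R]) (use p in \<open>simp add: R\<close>)
      fix x :: "real^'n"
      have "c * (x \<bullet> x + \<epsilon>) powr (- p) \<le> - (2 * real CARD('n) * h1 (x \<bullet> x) + 4 * (x \<bullet> x) * h2 (x \<bullet> x))"
      proof -
        \<comment> \<open>One factor is split off so that both derivatives of the weight share the
          power -p - 1; what remains beyond the term with \<open>c\<close> is a nonnegative multiple
          of \<epsilon>.\<close>
        have eq: "(x \<bullet> x + \<epsilon>) powr (- p) = (x \<bullet> x + \<epsilon>) * (x \<bullet> x + \<epsilon>) powr (- p - 1)"
          using pos[of x] powr_mult_base[of "x \<bullet> x + \<epsilon>" "- p - 1"] by simp
        have "- (2 * real CARD('n) * h1 (x \<bullet> x) + 4 * (x \<bullet> x) * h2 (x \<bullet> x)) - c * (x \<bullet> x + \<epsilon>) powr (- p)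
          = 4 * p * (p - 1) * \<epsilon> * (x \<bullet> x + \<epsilon>) powr (- p - 1)"
          unfolding h1_def h2_def c_def eq by (simp add: algebra_simps)
        moreover have "4 * p * (p - 1) * \<epsilon> * (x \<bullet> x + \<epsilon>) powr (- p - 1) \<ge> 0" using p \<epsilon> by simp
        ultimately show ?thesis by linarith
      qed
      then have "(c * (x \<bullet> x + \<epsilon>) powr (- p)) * \<bar>\<phi> x\<bar> powr p \<le> - (2 * real CARD('n) * h1 (x \<bullet> x) + 4 * (x \<bullet> x) * h2 (x \<bullet> x)) * \<bar>\<phi> x\<bar> powr p"
        by (rule mult_right_mono) simp
      then show "c * w x \<le> - (2 * real CARD('n) * h1 (x \<bullet> x) + 4 * (x \<bullet> x) * h2 (x \<bullet> x)) * \<bar>\<phi> x\<bar> powr p"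
        by (simp add: w_def mult.assoc)
    qed (use iw in simp)
    also have "\<dots> \<le> (LINT x|lborel. h (x \<bullet> x) * (\<bar>\<beta>1 (\<phi> x)\<bar> * \<bar>laplacian \<phi> x\<bar>))"
      by (rule Kato_inequality[OF sm R(2) V _ cb cb2 b]) (use p in \<open>auto simp: h_def \<beta>2_def\<close>)
    also have "\<dots> \<le> (LINT x|lborel. c / 2 * w x + p * C * \<bar>laplacian \<phi> x\<bar> powr p)"
    proof (rule integral_mono)
      show "integrable lborel (\<lambda>x::real^'n. h (x \<bullet> x) * (\<bar>\<beta>1 (\<phi> x)\<bar> * \<bar>laplacian \<phi> x\<bar>))"
        by (rule continuous_zero_outside_integrable[of _ R])
          (auto intro!: continuous_intros cV continuous_on_compose2[OF cb] simp: laplacian_zero_outside[OF sm R(2)])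
      fix x :: "real^'n"
      let ?r = "x \<bullet> x + \<epsilon>"
      have "h (x \<bullet> x) = (?r powr (- 1)) powr (p - 1)"
        by (simp only: h_def powr_powr) simp
      then have "h (x \<bullet> x) * (\<bar>\<beta>1 (\<phi> x)\<bar> * \<bar>laplacian \<phi> x\<bar>) = p * ((?r powr (- 1) * \<bar>\<phi> x\<bar>) powr (p - 1) * \<bar>laplacian \<phi> x\<bar>)"
        using p by (cases "\<phi> x = 0") (simp_all only: \<beta>1_def powr_mult abs_mult, simp_all add: sgn_if)
      also have "\<dots> \<le> p * (c / (2 * p) * (?r powr (- 1) * \<bar>\<phi> x\<bar>) powr p + C * \<bar>laplacian \<phi> x\<bar> powr p)"
        using p by (intro mult_left_mono C) auto
      also have "(?r powr (- 1) * \<bar>\<phi> x\<bar>) powr p = w x"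
        using pos[of x] by (simp only: w_def powr_mult powr_powr powr_ge_zero abs_ge_zero) simp
      finally show "h (x \<bullet> x) * (\<bar>\<beta>1 (\<phi> x)\<bar> * \<bar>laplacian \<phi> x\<bar>) \<le> c / 2 * w x + p * C * \<bar>laplacian \<phi> x\<bar> powr p"
        using p by (simp add: algebra_simps)
    qed (use iw iL in simp)
    also have "\<dots> = c / 2 * (LINT x|lborel. w x) + p * C * (LINT x|lborel. \<bar>laplacian \<phi> x\<bar> powr p)"
      using iw iL by simp
    finally have "(LINT x|lborel. w x) \<le> 2 * p * C / c * (LINT x|lborel. \<bar>laplacian \<phi> x\<bar> powr p)"
      using c by (simp add: field_simps)
    moreover have "(\<integral>\<^sup>+x. ennreal (w x) \<partial>lborel) = ennreal (LINT x|lborel. w x)"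
      by (rule nn_integral_eq_integral[OF iw]) (auto simp: w_def)
    ultimately show ?thesis by (simp add: w_def ennreal_leI)
  qed
  moreover have "2 * p * C / c > 0" using p C c by simp
  ultimately show ?thesis by blast
qed

section \<open>Radial potentials\<close>

text \<open>For s < 0 the interval \<open>{0..s}\<close> is empty and the integral 0, which agrees
  with \<open>G\<close> vanishing up to \<alpha>. Hence the derivative at s = 0 is two-sided, as
  \<open>has_C2_partials_radial\<close> demands.\<close>

lemma primitive_has_real_derivative:
  fixes G :: "real \<Rightarrow> real"
  assumes G: "continuous_on UNIV G" "\<And>t. t \<le> \<alpha> \<Longrightarrow> G t = 0" and "\<alpha> > 0" and "s \<ge> 0"
  shows "((\<lambda>s. integral {0..s} G) has_real_derivative G s) (at s)"
proof (cases "s < \<alpha>")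
  case True
  have "((\<lambda>_. 0) has_real_derivative 0) (at s)" by simp
  then have "((\<lambda>s. integral {0..s} G) has_real_derivative 0) (at s)"
  proof (rule has_field_derivative_transform_within_open[where S="{..<\<alpha>}"])
    show "0 = integral {0..t} G" if "t \<in> {..<\<alpha>}" for t
      using that G(2) by (subst integral_cong[where g = "\<lambda>_. 0"]) auto
  qed (use True in auto)
  then show ?thesis using G(2) True by simp
next
  case False
  then have s: "s \<in> {0<..<s + 1}" using \<open>\<alpha> > 0\<close> by simp
  have "((\<lambda>u. integral {0..u} G) has_real_derivative G s) (at s within {0..s + 1})"
    using s by (intro integral_has_real_derivative continuous_on_subset[OF G(1)]) auto
  then have "((\<lambda>u. integral {0..u} G) has_real_derivative G s) (at s within {0<..<s + 1})"
    by (rule has_field_derivative_subset) auto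
  then show ?thesis by (simp only: at_within_open[OF s open_greaterThanLessThan])
qed

text \<open>With \<open>m = N / 2\<close>, the function \<open>x \<mapsto> h (x \<bullet> x)\<close> is the Newtonian potential of
  \<open>x \<mapsto> \<eta> (x \<bullet> x)\<close> up to a constant factor: the mean of the fundamental solution over a sphere
  centred at the origin is the truncated kernel \<open>max (x \<bullet> x) t powr (1 - m)\<close>.\<close>

lemma radial_potential:
  fixes \<eta> :: "real \<Rightarrow> real"
  assumes m: "m > 1" and \<eta>: "continuous_on UNIV \<eta>" "\<And>t. \<eta> t \<ge> 0"
    and \<alpha>: "\<alpha> > 0" "\<And>t. t \<le> \<alpha> \<Longrightarrow> \<eta> t = 0" and b: "\<And>t. t \<ge> b \<Longrightarrow> \<eta> t = 0"
  obtains h h1 h2 :: "real \<Rightarrow> real"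
  where "continuous_on {0..} h1" "continuous_on {0..} h2"
    and "\<And>s. s \<ge> 0 \<Longrightarrow> (h has_real_derivative h1 s) (at s)"
    and "\<And>s. s \<ge> 0 \<Longrightarrow> (h1 has_real_derivative h2 s) (at s)"
    and "\<And>s. s \<ge> 0 \<Longrightarrow> 4 * m * h1 s + 4 * s * h2 s = - 4 * (m - 1) * \<eta> s"
    and "\<And>s. s \<ge> 0 \<Longrightarrow> h s \<ge> 0"
    and "\<And>s. s \<ge> 0 \<Longrightarrow> ennreal (h s) \<le>
      (\<integral>\<^sup>+t. ennreal (\<eta> t * t powr (m - 1) * max s t powr (1 - m)) * indicator {0..} t \<partial>lborel)"
proof
  \<comment> \<open>Truncating the powers at \<kappa> makes them continuous down to s = 0 and
    changes nothing, because \<eta> and both primitives vanish up to \<alpha>. As \<kappa> <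
    \<alpha>, the region where everything is constant overlaps the one where the truncation is
    inactive, and derivatives can be computed in either.\<close>
  define \<kappa> where "\<kappa> = \<alpha> / 2"
  have \<kappa>: "\<kappa> > 0" "\<kappa> < \<alpha>" using \<alpha> by (auto simp: \<kappa>_def)
  define F where "F t = \<eta> t * max t \<kappa> powr (m - 1)" for t
  define J where "J s = integral {0..s} F" for s
  define Y where "Y s = integral {0..s} \<eta>" for s
  \<comment> \<open>The integral of \<eta> against t^(m-1) max(s,t)^(1-m), split at t = s: the part
    inside gives s^(1-m) J(s), the part outside the integral of \<eta> from s on.
    \<open>max b 0\<close> guards against a negative \<open>b\<close>.\<close>
  define h where "h s = max s \<kappa> powr (1 - m) * J s + (Y (max b 0) - Y s)" for s
  \<comment> \<open>Differentiating \<open>h\<close> produces \<eta>(s) from both parts with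
    opposite signs, so only the derivative of the power survives.\<close>
  define h1 where "h1 s = (1 - m) * (max s \<kappa> powr (- m) * J s)" for s
  define h2 where "h2 s = (1 - m) * (- m * max s \<kappa> powr (- m - 1) * J s + max s \<kappa> powr (- m) * F s)" for s
  have mk: "max s \<kappa> > 0" "max s \<kappa> \<noteq> 0" for s using \<kappa> by (auto simp: max_def)
  have cF: "continuous_on UNIV F"
    unfolding F_def using mk by (auto intro!: continuous_intros \<eta>)
  have F: "F t = 0" if "t \<le> \<alpha>" for t using that \<alpha> by (simp add: F_def)
  have Fnn: "F t \<ge> 0" for t using \<eta> by (simp add: F_def)
  have dJ: "(J has_real_derivative F s) (at s)" if "s \<ge> 0" for s
    unfolding J_def using primitive_has_real_derivative[OF cF F \<alpha>(1) that] by simp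
  have dY: "(Y has_real_derivative \<eta> s) (at s)" if "s \<ge> 0" for s
    unfolding Y_def using primitive_has_real_derivative[OF \<eta>(1) \<alpha>(2) \<alpha>(1) that] by simp
  have J0: "J s = 0" if "s \<le> \<alpha>" for s
    unfolding J_def using that F by (subst integral_cong[where g = "\<lambda>_. 0"]) auto
  have Y0: "Y s = 0" if "s \<le> \<alpha>" for s
    unfolding Y_def using that \<alpha> by (subst integral_cong[where g = "\<lambda>_. 0"]) auto
  have cJ: "continuous_on {0..} J"
    using dJ by (metis DERIV_isCont atLeast_iff continuous_at_imp_continuous_on)
  note [continuous_intros] = continuous_on_subset[OF cF] cJ
  show "continuous_on {0..} h1" "continuous_on {0..} h2"
    unfolding h1_def h2_def using mk by (auto intro!: continuous_intros)
  have flat: "(k has_real_derivative 0) (at s)"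
    if "s < \<alpha>" and "\<And>t. t < \<alpha> \<Longrightarrow> k t = c" for k :: "real \<Rightarrow> real" and c s
  proof -
    have "((\<lambda>_. c) has_real_derivative 0) (at s)" by simp
    then show ?thesis
      by (rule has_field_derivative_transform_within_open[where S="{..<\<alpha>}"]) (use that in auto)
  qed
  have sharp: "(k has_real_derivative d) (at s)"
    if "s \<ge> \<alpha>" and "(l has_real_derivative d) (at s)" and "\<And>t. t > \<kappa> \<Longrightarrow> k t = l t" for k l :: "real \<Rightarrow> real" and d s
    using that(2) by (rule has_field_derivative_transform_within_open[where S="{\<kappa><..}"]) (use that \<kappa> in auto)
  show "(h has_real_derivative h1 s) (at s)" if "s \<ge> 0" for s
  proof (cases "s < \<alpha>")
    case True
    have "(h has_real_derivative 0) (at s)"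
      by (rule flat[OF True, of _ "Y (max b 0)"]) (simp add: h_def J0 Y0)
    then show ?thesis using True by (simp add: h1_def J0)
  next
    case False
    then have s: "s > 0" "s > \<kappa>" using \<alpha> \<kappa> by auto
    have p: "((\<lambda>t. t powr (1 - m)) has_real_derivative (1 - m) * s powr (- m)) (at s)"
      using s by (auto intro!: derivative_eq_intros)
    have "s powr (m - 1) * s powr (1 - m) = 1" using s by (simp add: powr_add[symmetric])
    then have "(1 - m) * s powr (- m) * J s + F s * s powr (1 - m) + (0 - \<eta> s) = h1 s"
      using s by (simp add: F_def h1_def max_absorb1 mult.assoc)
    then have "((\<lambda>t. t powr (1 - m) * J t + (Y (max b 0) - Y t)) has_real_derivative h1 s) (at s)"
      using DERIV_add[OF DERIV_mult[OF p dJ[OF that]] DERIV_diff[OF DERIV_const dY[OF that]]] by simp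
    then show ?thesis
      by (rule sharp[rotated]) (use False in \<open>auto simp: h_def max_absorb1\<close>)
  qed
  show "(h1 has_real_derivative h2 s) (at s)" if "s \<ge> 0" for s
  proof (cases "s < \<alpha>")
    case True
    have "(h1 has_real_derivative 0) (at s)"
      by (rule flat[OF True, of _ 0]) (simp add: h1_def J0)
    then show ?thesis using True by (simp add: h2_def J0 F)
  next
    case False
    then have s: "s > 0" "s > \<kappa>" using \<alpha> \<kappa> by auto
    have p: "((\<lambda>t. t powr (- m)) has_real_derivative (- m) * s powr (- m - 1)) (at s)"
      using s by (auto intro!: derivative_eq_intros)
    have "(1 - m) * ((- m) * s powr (- m - 1) * J s + F s * s powr (- m)) = h2 s"
      using s by (simp add: h2_def max_absorb1 mult.commute)
    then have "((\<lambda>t. (1 - m) * (t powr (- m) * J t)) has_real_derivative h2 s) (at s)"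
      using DERIV_cmult[OF DERIV_mult[OF p dJ[OF that]], of "1 - m"] by simp
    then show ?thesis
      by (rule sharp[rotated]) (use False in \<open>auto simp: h1_def max_absorb1\<close>)
  qed
  show "4 * m * h1 s + 4 * s * h2 s = - 4 * (m - 1) * \<eta> s" if "s \<ge> 0" for s
  proof (cases "s < \<alpha>")
    case True
    then show ?thesis using \<alpha> by (simp add: h1_def h2_def J0 F)
  next
    case False
    then have s: "s > 0" "s > \<kappa>" using \<alpha> \<kappa> by auto
    have "s * s powr (- m - 1) = s powr (- m)" "s * (s powr (- m) * s powr (m - 1)) = 1"
      using s by (simp_all add: powr_mult_base powr_add[symmetric])
    note e = this
    have "4 * m * h1 s + 4 * s * h2 s
       = 4 * (1 - m) * (m * s powr (- m) * J s - m * (s * s powr (- m - 1)) * J s + \<eta> s * (s * (s powr (- m) * s powr (m - 1))))"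
      using s by (simp add: h1_def h2_def F_def max_absorb1 algebra_simps)
    then show ?thesis unfolding e by (simp add: algebra_simps)
  qed
  have intF: "F integrable_on {u..v}" and int\<eta>: "\<eta> integrable_on {u..v}" for u v
    by (auto intro!: integrable_continuous_interval continuous_on_subset[OF cF] continuous_on_subset[OF \<eta>(1)])
  have Ydiff: "Y (max b 0) - Y s = integral {s..max b s} \<eta>" if "s \<ge> 0" for s
  proof (cases "s \<le> b")
    case True
    then have "Y s + integral {s..b} \<eta> = Y b"
      unfolding Y_def using that int\<eta> by (intro Henstock_Kurzweil_Integration.integral_combine) auto
    then show ?thesis using True that by (simp add: max_absorb1)
  next
    case False
    then have "Y (max b 0) + integral {max b 0..s} \<eta> = Y s"
      unfolding Y_def using that int\<eta> by (intro Henstock_Kurzweil_Integration.integral_combine) auto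
    moreover have "integral {max b 0..s} \<eta> = 0"
      using b by (subst integral_cong[where g = "\<lambda>_. 0"]) auto
    ultimately show ?thesis using False by (simp add: max_absorb2)
  qed
  show "h s \<ge> 0" if "s \<ge> 0" for s
    unfolding h_def Ydiff[OF that] J_def
    using Fnn \<eta>(2) intF int\<eta> by (intro add_nonneg_nonneg mult_nonneg_nonneg Henstock_Kurzweil_Integration.integral_nonneg) auto
  show "ennreal (h s) \<le> (\<integral>\<^sup>+t. ennreal (\<eta> t * t powr (m - 1) * max s t powr (1 - m)) * indicator {0..} t \<partial>lborel)"
    if "s \<ge> 0" for s
  proof -
    let ?c = "max s \<kappa> powr (1 - m)"
    have [measurable]: "\<eta> \<in> borel_measurable borel" "F \<in> borel_measurable borel"
      using \<eta>(1) cF by (auto intro: borel_measurable_continuous_onI)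
    have "(F has_integral J s) {0..s}" unfolding J_def using intF by (rule integrable_integral)
    from nn_integral_has_integral_lebesgue'[OF _ has_integral_mult_right[OF this, of ?c]]
    have 1: "(\<integral>\<^sup>+t. ennreal (?c * F t) * indicator {0..s} t \<partial>lborel) = ennreal (?c * J s)"
      using Fnn by simp
    have "(\<eta> has_integral (Y (max b 0) - Y s)) {s..max b s}"
      unfolding Ydiff[OF that] using int\<eta> by (rule integrable_integral)
    from nn_integral_has_integral_lebesgue'[OF _ this]
    have 2: "(\<integral>\<^sup>+t. ennreal (\<eta> t) * indicator {s..max b s} t \<partial>lborel) = ennreal (Y (max b 0) - Y s)"
      using \<eta>(2) by simp
    have nn: "?c * J s \<ge> 0" "Y (max b 0) - Y s \<ge> 0"
      unfolding Ydiff[OF that] J_def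
      using Fnn \<eta>(2) intF int\<eta> by (auto intro!: mult_nonneg_nonneg Henstock_Kurzweil_Integration.integral_nonneg)
    have "ennreal (h s) = ennreal (?c * J s) + ennreal (Y (max b 0) - Y s)"
      unfolding h_def using nn by (rule ennreal_plus)
    also have "\<dots> = (\<integral>\<^sup>+t. ennreal (?c * F t) * indicator {0..s} t + ennreal (\<eta> t) * indicator {s..max b s} t \<partial>lborel)"
      unfolding 1[symmetric] 2[symmetric] by (rule nn_integral_add[symmetric]) auto
    also have "\<dots> \<le> (\<integral>\<^sup>+t. ennreal (\<eta> t * t powr (m - 1) * max s t powr (1 - m)) * indicator {0..} t \<partial>lborel)"
    proof (rule nn_integral_mono_AE)
      \<comment> \<open>At t = s both indicators are 1 and would count the point twice.\<close>
      have "AE t in lborel. t \<noteq> s" by (rule AE_lborel_singleton)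
      then show "AE t in lborel. ennreal (?c * F t) * indicator {0..s} t + ennreal (\<eta> t) * indicator {s..max b s} t
        \<le> ennreal (\<eta> t * t powr (m - 1) * max s t powr (1 - m)) * indicator {0..} t"
      proof eventually_elim
        fix t assume "t \<noteq> s"
        consider "t \<le> \<alpha>" | "t > \<alpha>" "t < s" | "t > \<alpha>" "t > s" using \<open>t \<noteq> s\<close> by linarith
        then show "ennreal (?c * F t) * indicator {0..s} t + ennreal (\<eta> t) * indicator {s..max b s} t
          \<le> ennreal (\<eta> t * t powr (m - 1) * max s t powr (1 - m)) * indicator {0..} t"
        proof cases
          case 1
          then show ?thesis by (simp add: F \<alpha>)
        next
          case 2
          then have "t > \<kappa>" "s > \<kappa>" "t > 0" using \<kappa> \<alpha> by auto
          then show ?thesis using 2 by (simp add: F_def max_absorb1 mult_ac)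
        next
          case 3
          then have t: "t > 0" using \<alpha> by auto
          then have "t powr (m - 1) * t powr (1 - m) = 1" by (simp add: powr_add[symmetric])
          then show ?thesis using 3 t by (auto simp: max_absorb2 indicator_def mult.assoc)
        qed
      qed
    qed
    finally show ?thesis .
  qed
qed

text \<open>A C2 convex substitute for |s| in Kato's inequality: subtracting \<delta> gives the
  value 0 at 0, and slopes of modulus at most 1 leave the Laplacian without an extra factor.\<close>

lemma sqrt_regularisation:
  fixes \<delta> :: real
  assumes "\<delta> > 0"
  defines "\<beta> \<equiv> \<lambda>s. sqrt (s\<^sup>2 + \<delta>\<^sup>2) - \<delta>"
    and "\<beta>1 \<equiv> \<lambda>s. s / sqrt (s\<^sup>2 + \<delta>\<^sup>2)"
    and "\<beta>2 \<equiv> \<lambda>s. \<delta>\<^sup>2 / sqrt (s\<^sup>2 + \<delta>\<^sup>2) ^ 3"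
  shows "continuous_on UNIV \<beta>1" "continuous_on UNIV \<beta>2" "(\<beta> has_real_derivative \<beta>1 s) (at s)"
    "(\<beta>1 has_real_derivative \<beta>2 s) (at s)" "\<beta> 0 = 0" "\<beta>2 s \<ge> 0" "\<bar>\<beta>1 s\<bar> \<le> 1" "\<bar>s\<bar> - \<delta> \<le> \<beta> s" "0 \<le> \<beta> s"
proof -
  have pos: "s\<^sup>2 + \<delta>\<^sup>2 > 0" for s using assms(1) by (simp add: add_nonneg_pos)
  have nz: "s\<^sup>2 + \<delta>\<^sup>2 \<noteq> 0" for s using pos[of s] by (rule less_imp_neq[THEN not_sym])
  have sz: "sqrt (s\<^sup>2 + \<delta>\<^sup>2) \<noteq> 0" for s using nz[of s] by (simp only: real_sqrt_eq_0_iff not_False_eq_True)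
  show "continuous_on UNIV \<beta>1" "continuous_on UNIV \<beta>2"
    unfolding \<beta>1_def \<beta>2_def using assms(1) by (auto intro!: continuous_intros)
  have "((\<lambda>s. s\<^sup>2 + \<delta>\<^sup>2) has_real_derivative 2 * s) (at s)"
    by (rule derivative_eq_intros refl)+ simp
  from DERIV_chain2[where f = sqrt and g = "\<lambda>s. s\<^sup>2 + \<delta>\<^sup>2", OF DERIV_real_sqrt[OF pos[of s]] this]
  have dsq: "((\<lambda>s. sqrt (s\<^sup>2 + \<delta>\<^sup>2)) has_real_derivative s / sqrt (s\<^sup>2 + \<delta>\<^sup>2)) (at s)"
  proof (rule DERIV_cong)
    show "inverse (sqrt (s\<^sup>2 + \<delta>\<^sup>2)) / 2 * (2 * s) = s / sqrt (s\<^sup>2 + \<delta>\<^sup>2)"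
      by (simp only: divide_inverse) simp
  qed
  show "(\<beta> has_real_derivative \<beta>1 s) (at s)"
    unfolding \<beta>_def \<beta>1_def using DERIV_diff[OF dsq DERIV_const[of \<delta>]] by simp
  let ?r = "sqrt (s\<^sup>2 + \<delta>\<^sup>2)"
  have r: "?r > 0" "?r\<^sup>2 = s\<^sup>2 + \<delta>\<^sup>2" using pos[of s] assms(1) by auto
  have "(1 * ?r - s * (s / ?r)) / (?r * ?r) = (?r\<^sup>2 - s\<^sup>2) / ?r ^ 3"
    using r(1) by (simp add: divide_simps power2_eq_square power3_eq_cube)
  also have "\<dots> = \<beta>2 s" by (simp add: \<beta>2_def r(2))
  finally show "(\<beta>1 has_real_derivative \<beta>2 s) (at s)"
    unfolding \<beta>1_def by (rule DERIV_cong[OF DERIV_divide[OF DERIV_ident dsq sz]])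
  have "\<bar>s\<bar> \<le> ?r" using real_sqrt_le_mono[of "s\<^sup>2" "s\<^sup>2 + \<delta>\<^sup>2"] by simp
  then show "\<bar>s\<bar> - \<delta> \<le> \<beta> s" "\<bar>\<beta>1 s\<bar> \<le> 1" using r(1) by (auto simp: \<beta>_def \<beta>1_def)
  have "\<bar>\<delta>\<bar> \<le> ?r" using real_sqrt_le_mono[of "\<delta>\<^sup>2" "s\<^sup>2 + \<delta>\<^sup>2"] by simp
  then show "0 \<le> \<beta> s" by (simp add: \<beta>_def)
  show "\<beta> 0 = 0" using assms(1) by (simp add: \<beta>_def)
  show "\<beta>2 s \<ge> 0" by (simp add: \<beta>2_def)
qed

text \<open>Kato's inequality with the potential \<open>h\<close> of \<eta> bounds the integral of
  |\<phi>| \<eta> by that of \<open>h\<close> times the modulus of the Laplacian. Write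
  \<open>h\<close> through the truncated kernel, exchange the integrals, and apply Hoelder's
  inequality in x for each fixed t. The symmetry sits in \<eta>, so \<phi> may be arbitrary.\<close>

lemma radial_test_estimate:
  fixes p :: real
  assumes N: "real CARD('n::finite) > 2 * p" and p: "2 \<le> p"
  shows "\<exists>M > 0. \<forall>\<phi> :: real^'n \<Rightarrow> real. \<forall>\<eta> \<alpha> b D. test_function \<phi> \<longrightarrow> continuous_on UNIV \<eta> \<longrightarrow> (\<forall>t. \<eta> t \<ge> 0) \<longrightarrow>
    \<alpha> > 0 \<longrightarrow> (\<forall>t\<le>\<alpha>. \<eta> t = 0) \<longrightarrow> (\<forall>t\<ge>b. \<eta> t = 0) \<longrightarrow> D > 0 \<longrightarrow> (LINT x|lborel. \<bar>laplacian \<phi> x\<bar> powr p) \<le> D \<longrightarrow>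
    (\<integral>\<^sup>+x. ennreal (\<bar>\<phi> x\<bar> * \<eta> (x \<bullet> x)) \<partial>lborel)
      \<le> ennreal (M * D powr (1 / p)) * (\<integral>\<^sup>+(x::real^'n). ennreal (\<eta> (x \<bullet> x) * (x \<bullet> x) powr (1 - real CARD('n) / (2 * p))) \<partial>lborel)"
proof -
  define m where "m = real CARD('n) / 2"
  \<comment> \<open>Here \<open>q\<close> is the exponent conjugate to \<open>p\<close>. The
    exponent (1 - m) q + m of the kernel integral equals (p - m) / (p - 1), negative because m = N/2
    > p.\<close>
  define q where "q = p / (p - 1)"
  have m: "m > p" "m > 1" using N p by (auto simp: m_def)
  have q: "q > 1" "1 / p + 1 / q = 1" "q > 0" using p by (auto simp: q_def field_simps)
  have e: "(1 - m) * q + m < 0"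
  proof -
    have "(1 - m) * q + m = (p - m) / (p - 1)" using p by (simp add: q_def field_simps)
    also have "\<dots> < 0" using m p by (intro divide_neg_pos) auto
    finally show ?thesis .
  qed
  obtain K where K: "K > 0" "\<And>s. s > 0 \<Longrightarrow>
      (\<integral>\<^sup>+(x::real^'n). ennreal (max (x \<bullet> x) s powr ((1 - m) * q)) \<partial>lborel) \<le> ennreal (K * s powr ((1 - m) * q + m))"
    using nn_integral_truncated_power[of "(1 - m) * q", where 'n = 'n] e unfolding m_def by blast
  define c where "c = unit_ball_vol (real CARD('n)) * m"
  have c: "c > 0" using m by (simp add: c_def)
  have "(\<integral>\<^sup>+x. ennreal (\<bar>\<phi> x\<bar> * \<eta> (x \<bullet> x)) \<partial>lborel)
      \<le> ennreal (K powr (1 / q) / (4 * (m - 1) * c) * D powr (1 / p)) *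
        (\<integral>\<^sup>+(x::real^'n). ennreal (\<eta> (x \<bullet> x) * (x \<bullet> x) powr (1 - real CARD('n) / (2 * p))) \<partial>lborel)"
    if tf: "test_function \<phi>" and \<eta>: "continuous_on UNIV \<eta>" "\<And>t. \<eta> t \<ge> 0"
      and \<alpha>: "\<alpha> > 0" "\<And>t. t \<le> \<alpha> \<Longrightarrow> \<eta> t = 0" and b: "\<And>t. t \<ge> b \<Longrightarrow> \<eta> t = 0"
      and D: "D > 0" "(LINT x|lborel. \<bar>laplacian \<phi> x\<bar> powr p) \<le> D"
    for \<phi> :: "real^'n \<Rightarrow> real" and \<eta> \<alpha> b D
  proof -
    obtain R where R: "R > 0" "\<And>x. norm x > R \<Longrightarrow> \<phi> x = 0" using test_function_zero_outside[OF tf] by blast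
    have sm: "smooth \<phi>" using tf by (simp add: test_function_def)
    obtain h h1 h2 where c12: "continuous_on {0..} h1" "continuous_on {0..} h2"
      and d1: "\<And>s. s \<ge> 0 \<Longrightarrow> (h has_real_derivative h1 s) (at s)"
      and d2: "\<And>s. s \<ge> 0 \<Longrightarrow> (h1 has_real_derivative h2 s) (at s)"
      and ode: "\<And>s. s \<ge> 0 \<Longrightarrow> 4 * m * h1 s + 4 * s * h2 s = - 4 * (m - 1) * \<eta> s"
      and h0: "\<And>s. s \<ge> 0 \<Longrightarrow> h s \<ge> 0"
      and h_le: "\<And>s. s \<ge> 0 \<Longrightarrow> ennreal (h s) \<le>
        (\<integral>\<^sup>+t. ennreal (\<eta> t * t powr (m - 1) * max s t powr (1 - m)) * indicator {0..} t \<partial>lborel)"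
      by (rule radial_potential[of m \<eta> \<alpha> b]; (rule m(2) \<eta> \<alpha> b that; assumption))
    have V: "has_C2_partials (\<lambda>x::real^'n. h (x \<bullet> x)) (\<lambda>i x. 2 * x $ i * h1 (x \<bullet> x))
       (\<lambda>i x. 2 * h1 (x \<bullet> x) + 4 * (x $ i)\<^sup>2 * h2 (x \<bullet> x))"
      by (rule has_C2_partials_radial[OF c12 d1 d2])
    have ode': "- (\<Sum>i\<in>UNIV. 2 * h1 (x \<bullet> x) + 4 * (x $ i)\<^sup>2 * h2 (x \<bullet> x)) = 4 * (m - 1) * \<eta> (x \<bullet> x)" for x :: "real^'n"
      using ode[of "x \<bullet> x"] unfolding sum_radial_second_partials by (simp add: m_def algebra_simps)
    note [continuous_intros] = smooth_continuous_on[OF sm] laplacian_continuous_on[OF sm]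
      continuous_on_compose2[OF \<eta>(1), simplified] V[unfolded has_C2_partials_def, THEN conjunct1]
    have [measurable]: "\<eta> \<in> borel_measurable borel" "laplacian \<phi> \<in> borel_measurable borel" "\<phi> \<in> borel_measurable borel"
      using \<eta>(1) laplacian_continuous_on[OF sm] smooth_continuous_on[OF sm] by (auto intro: borel_measurable_continuous_onI)
    have z: "laplacian \<phi> x = 0" if "norm x > R" for x by (rule laplacian_zero_outside[OF sm R(2) that])
    have ip: "integrable lborel (\<lambda>x. h (x \<bullet> x) * \<bar>laplacian \<phi> x\<bar>)"
      by (rule continuous_zero_outside_integrable[of _ R]) (auto intro!: continuous_intros simp: z)
    have i\<phi>: "integrable lborel (\<lambda>x. \<bar>\<phi> x\<bar> * \<eta> (x \<bullet> x))"
      by (rule continuous_zero_outside_integrable[of _ R]) (auto intro!: continuous_intros simp: R)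
    have i\<eta>: "integrable lborel (\<lambda>x::real^'n. \<eta> (x \<bullet> x))"
    proof (rule continuous_zero_outside_integrable)
      fix x :: "real^'n" assume "norm x > sqrt (max b 0)"
      then have "x \<bullet> x > max b 0"
        by (metis norm_eq_sqrt_inner real_sqrt_less_iff)
      then show "\<eta> (x \<bullet> x) = 0" using b by simp
    qed (auto intro!: continuous_intros)
    have iL: "integrable lborel (\<lambda>x. \<bar>laplacian \<phi> x\<bar> powr p)"
      using p by (intro continuous_zero_outside_integrable[of _ R])
        (auto intro!: continuous_intros continuous_on_powr' simp: z)
    \<comment> \<open>The cost of regularising |s| is \<delta> times the integral of \<eta>; that
      integral is finite, so the cost disappears as \<delta> tends to 0.\<close>
    have step: "4 * (m - 1) * ((LINT x|lborel. \<bar>\<phi> x\<bar> * \<eta> (x \<bullet> x)) - \<delta> * (LINT x|lborel. \<eta> ((x::real^'n) \<bullet> x)))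
        \<le> (LINT x|lborel. h (x \<bullet> x) * \<bar>laplacian \<phi> x\<bar>)" if "\<delta> > 0" for \<delta>
    proof -
      let ?\<beta> = "\<lambda>s::real. sqrt (s\<^sup>2 + \<delta>\<^sup>2) - \<delta>" and ?\<beta>1 = "\<lambda>s::real. s / sqrt (s\<^sup>2 + \<delta>\<^sup>2)"
      note reg = sqrt_regularisation[OF that]
      have "4 * (m - 1) * ((LINT x|lborel. \<bar>\<phi> x\<bar> * \<eta> (x \<bullet> x)) - \<delta> * (LINT x|lborel. \<eta> ((x::real^'n) \<bullet> x)))
         = (LINT x|lborel. 4 * (m - 1) * (\<bar>\<phi> x\<bar> * \<eta> (x \<bullet> x) - \<delta> * \<eta> (x \<bullet> x)))"
        using i\<phi> i\<eta> by simp
      also have "\<dots> \<le> (LINT x|lborel. 4 * (m - 1) * \<eta> (x \<bullet> x) * ?\<beta> (\<phi> x))"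
      proof (rule integral_mono)
        show "integrable lborel (\<lambda>x. 4 * (m - 1) * \<eta> (x \<bullet> x) * ?\<beta> (\<phi> x))"
          using that by (intro continuous_zero_outside_integrable[of _ R]) (auto intro!: continuous_intros simp: R)
        fix x
        have "4 * (m - 1) * \<eta> (x \<bullet> x) * (\<bar>\<phi> x\<bar> - \<delta>) \<le> 4 * (m - 1) * \<eta> (x \<bullet> x) * ?\<beta> (\<phi> x)"
          using m \<eta>(2) by (intro mult_left_mono reg(8)) auto
        then show "4 * (m - 1) * (\<bar>\<phi> x\<bar> * \<eta> (x \<bullet> x) - \<delta> * \<eta> (x \<bullet> x)) \<le> 4 * (m - 1) * \<eta> (x \<bullet> x) * ?\<beta> (\<phi> x)"
          by (simp add: algebra_simps)
      qed (use i\<phi> i\<eta> in auto)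
      also have "\<dots> \<le> (LINT x|lborel. h (x \<bullet> x) * (\<bar>?\<beta>1 (\<phi> x)\<bar> * \<bar>laplacian \<phi> x\<bar>))"
        using Kato_inequality[OF sm R(2) V _ reg(1-4,5,6)] h0 unfolding ode' by auto
      also have "\<dots> \<le> (LINT x|lborel. h (x \<bullet> x) * \<bar>laplacian \<phi> x\<bar>)"
      proof (rule integral_mono)
        show "integrable lborel (\<lambda>x. h (x \<bullet> x) * (\<bar>?\<beta>1 (\<phi> x)\<bar> * \<bar>laplacian \<phi> x\<bar>))"
          using that by (intro continuous_zero_outside_integrable[of _ R])
            (auto intro!: continuous_intros continuous_on_compose2[OF reg(1)] simp: z)
        show "h (x \<bullet> x) * (\<bar>?\<beta>1 (\<phi> x)\<bar> * \<bar>laplacian \<phi> x\<bar>) \<le> h (x \<bullet> x) * \<bar>laplacian \<phi> x\<bar>" for x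
          by (intro mult_left_mono mult_left_le_one_le reg(7) h0) auto
      qed (rule ip)
      finally show ?thesis .
    qed
    have "((\<lambda>\<delta>. 4 * (m - 1) * ((LINT x|lborel. \<bar>\<phi> x\<bar> * \<eta> (x \<bullet> x)) - \<delta> * (LINT x|lborel. \<eta> ((x::real^'n) \<bullet> x))))
        \<longlongrightarrow> 4 * (m - 1) * ((LINT x|lborel. \<bar>\<phi> x\<bar> * \<eta> (x \<bullet> x)) - 0 * (LINT x|lborel. \<eta> ((x::real^'n) \<bullet> x)))) (at_right 0)"
      by (intro tendsto_intros)
    then have "4 * (m - 1) * ((LINT x|lborel. \<bar>\<phi> x\<bar> * \<eta> (x \<bullet> x)) - 0 * (LINT x|lborel. \<eta> ((x::real^'n) \<bullet> x)))
       \<le> (LINT x|lborel. h (x \<bullet> x) * \<bar>laplacian \<phi> x\<bar>)"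
      by (rule tendsto_upperbound[OF _ eventually_mono[OF eventually_at_right_less step]]) simp_all
    then have "(LINT x|lborel. \<bar>\<phi> x\<bar> * \<eta> (x \<bullet> x)) \<le> 1 / (4 * (m - 1)) * (LINT x|lborel. h (x \<bullet> x) * \<bar>laplacian \<phi> x\<bar>)"
      using m by (simp add: field_simps)
    then have A: "(\<integral>\<^sup>+x. ennreal (\<bar>\<phi> x\<bar> * \<eta> (x \<bullet> x)) \<partial>lborel)
       \<le> ennreal (1 / (4 * (m - 1))) * (\<integral>\<^sup>+x. ennreal (h (x \<bullet> x) * \<bar>laplacian \<phi> x\<bar>) \<partial>lborel)"
      using i\<phi> ip \<eta>(2) h0 m by (simp add: nn_integral_eq_integral ennreal_mult''[symmetric])
    let ?k = "\<lambda>x t. ennreal (\<eta> t * t powr (m - 1) * max (x \<bullet> x) t powr (1 - m)) * indicator {0..} t * ennreal \<bar>laplacian \<phi> x\<bar>"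
    let ?d = "1 - real CARD('n) / (2 * p)"
    have "(\<integral>\<^sup>+x. ennreal (h (x \<bullet> x) * \<bar>laplacian \<phi> x\<bar>) \<partial>lborel) \<le> (\<integral>\<^sup>+x. (\<integral>\<^sup>+t. ?k x t \<partial>lborel) \<partial>lborel)"
    proof (rule nn_integral_mono)
      fix x
      have "ennreal (h (x \<bullet> x) * \<bar>laplacian \<phi> x\<bar>) = ennreal (h (x \<bullet> x)) * ennreal \<bar>laplacian \<phi> x\<bar>"
        by (rule ennreal_mult'') simp
      also have "\<dots> \<le> (\<integral>\<^sup>+t. ennreal (\<eta> t * t powr (m - 1) * max (x \<bullet> x) t powr (1 - m)) * indicator {0..} t \<partial>lborel) * ennreal \<bar>laplacian \<phi> x\<bar>"
        by (intro mult_right_mono h_le) auto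
      also have "\<dots> = (\<integral>\<^sup>+t. ?k x t \<partial>lborel)"
        by (rule nn_integral_multc[symmetric]) auto
      finally show "ennreal (h (x \<bullet> x) * \<bar>laplacian \<phi> x\<bar>) \<le> (\<integral>\<^sup>+t. ?k x t \<partial>lborel)" .
    qed
    also have "\<dots> = (\<integral>\<^sup>+t. (\<integral>\<^sup>+x. ?k x t \<partial>lborel) \<partial>lborel)"
      by (rule pair_sigma_finite.Fubini'[symmetric]) (auto intro!: pair_sigma_finite.intro lborel.sigma_finite_measure_axioms)
    \<comment> \<open>The measure c t^(m-1) dt is the radial part of Lebesgue measure;
      \<open>c\<close> is inserted and divided out so that the t-integral can be read as one over
      space again.\<close>
    also have "\<dots> \<le> (\<integral>\<^sup>+t. ennreal (K powr (1 / q) * D powr (1 / p) / c) * (ennreal (c * t powr (m - 1)) * indicator {0..} t * ennreal (\<eta> t * t powr ?d)) \<partial>lborel)"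
    proof (rule nn_integral_mono)
      fix t :: real
      show "(\<integral>\<^sup>+x. ?k x t \<partial>lborel)
        \<le> ennreal (K powr (1 / q) * D powr (1 / p) / c) * (ennreal (c * t powr (m - 1)) * indicator {0..} t * ennreal (\<eta> t * t powr ?d))"
      proof (cases "t > 0")
        case False
        then have "\<eta> t = 0" using \<alpha> by simp
        then show ?thesis by simp
      next
        case t: True
        have H: "(\<integral>\<^sup>+x. ennreal (max (x \<bullet> x) t powr (1 - m) * \<bar>laplacian \<phi> x\<bar>) \<partial>lborel)
          \<le> ennreal ((K * t powr ((1 - m) * q + m)) powr (1 / q) * D powr (1 / p))"
        proof (rule nn_integral_Holder)
          show "(\<integral>\<^sup>+(x::real^'n). ennreal ((max (x \<bullet> x) t powr (1 - m)) powr q) \<partial>lborel) \<le> ennreal (K * t powr ((1 - m) * q + m))"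
            using K(2)[OF t] by (simp add: powr_powr)
          show "(\<integral>\<^sup>+x. ennreal (\<bar>laplacian \<phi> x\<bar> powr p) \<partial>lborel) \<le> ennreal D"
            using nn_integral_eq_integral[OF iL] D(2) by (simp add: ennreal_leI)
        qed (use q p D K t in auto)
        \<comment> \<open>The exponent is 1 - m + m/q = 1 - m/p with m = N/2.\<close>
        have E: "(K * t powr ((1 - m) * q + m)) powr (1 / q) = K powr (1 / q) * t powr ?d"
        proof -
          have "((1 - m) * q + m) / q = 1 - m + m * (1 / q)" using q by (simp add: field_simps)
          also have "\<dots> = 1 - m + m * (1 - 1 / p)" proof -
            have "1 / q = 1 - 1 / p" using q(2) by linarith
            then show ?thesis by (simp only:)
          qed
          also have "\<dots> = ?d" using p by (simp add: m_def field_simps)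
          finally show ?thesis using K(1) t by (simp add: powr_mult powr_powr)
        qed
        have "(\<integral>\<^sup>+x. ?k x t \<partial>lborel) = (\<integral>\<^sup>+x. ennreal (\<eta> t * t powr (m - 1)) * ennreal (max (x \<bullet> x) t powr (1 - m) * \<bar>laplacian \<phi> x\<bar>) \<partial>lborel)"
          using t \<eta>(2) by (intro nn_integral_cong) (simp add: ennreal_mult''[symmetric] mult_ac)
        also have "\<dots> = ennreal (\<eta> t * t powr (m - 1)) * (\<integral>\<^sup>+x. ennreal (max (x \<bullet> x) t powr (1 - m) * \<bar>laplacian \<phi> x\<bar>) \<partial>lborel)"
          by (rule nn_integral_cmult) auto
        also have "\<dots> \<le> ennreal (\<eta> t * t powr (m - 1)) * ennreal ((K * t powr ((1 - m) * q + m)) powr (1 / q) * D powr (1 / p))"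
          by (rule mult_left_mono[OF H]) simp
        also have "\<dots> = ennreal (K powr (1 / q) * D powr (1 / p) / c) * (ennreal (c * t powr (m - 1)) * indicator {0..} t * ennreal (\<eta> t * t powr ?d))"
          unfolding E using t c \<eta>(2)[of t] by (simp add: ennreal_mult''[symmetric] mult_ac)
        finally show ?thesis .
      qed
    qed
    also have "\<dots> = ennreal (K powr (1 / q) * D powr (1 / p) / c) * (\<integral>\<^sup>+t. (ennreal (c * t powr (m - 1)) * indicator {0..} t * ennreal (\<eta> t * t powr ?d)) \<partial>lborel)"
      by (rule nn_integral_cmult) auto
    also have "(\<integral>\<^sup>+t. (ennreal (c * t powr (m - 1)) * indicator {0..} t * ennreal (\<eta> t * t powr ?d)) \<partial>lborel)
       = (\<integral>\<^sup>+(x::real^'n). ennreal (\<eta> (x \<bullet> x) * (x \<bullet> x) powr ?d) \<partial>lborel)"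
      unfolding c_def m_def by (rule nn_integral_radial[symmetric]) simp
    finally have B: "(\<integral>\<^sup>+x. ennreal (h (x \<bullet> x) * \<bar>laplacian \<phi> x\<bar>) \<partial>lborel) \<le>
      ennreal (K powr (1 / q) * D powr (1 / p) / c) * (\<integral>\<^sup>+(x::real^'n). ennreal (\<eta> (x \<bullet> x) * (x \<bullet> x) powr ?d) \<partial>lborel)" .
    have "(\<integral>\<^sup>+x. ennreal (\<bar>\<phi> x\<bar> * \<eta> (x \<bullet> x)) \<partial>lborel) \<le> ennreal (1 / (4 * (m - 1))) * (ennreal (K powr (1 / q) * D powr (1 / p) / c) *
       (\<integral>\<^sup>+(x::real^'n). ennreal (\<eta> (x \<bullet> x) * (x \<bullet> x) powr ?d) \<partial>lborel))"
      using A B by (meson mult_left_mono order_trans zero_le)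
    also have "\<dots> = ennreal (K powr (1 / q) / (4 * (m - 1) * c) * D powr (1 / p)) * (\<integral>\<^sup>+(x::real^'n). ennreal (\<eta> (x \<bullet> x) * (x \<bullet> x) powr ?d) \<partial>lborel)"
      using m c by (simp add: mult.assoc[symmetric] ennreal_mult''[symmetric])
    finally show ?thesis .
  qed
  moreover have "K powr (1 / q) / (4 * (m - 1) * c) > 0" using m c K by simp
  ultimately show ?thesis by blast
qed

section \<open>Weak Laplacians of test functions\<close>

lemma locally_integrable_borel_measurable:
  assumes "locally_integrable g"
  shows "g \<in> borel_measurable borel"
proof (rule borel_measurable_LIMSEQ_metric)
  fix n :: nat
  have "set_integrable lborel (cball 0 (real n)) g"
    using assms compact_cball unfolding locally_integrable_def by blast
  then show "(\<lambda>x. indicator (cball 0 (real n)) x *\<^sub>R g x) \<in> borel_measurable borel"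
    unfolding set_integrable_def by (auto dest: borel_measurable_integrable)
next
  fix x
  have "\<forall>\<^sub>F n in sequentially. indicator (cball 0 (real n)) x *\<^sub>R g x = g x"
    using eventually_ge_at_top[of "nat \<lceil>norm x\<rceil>"]
    by eventually_elim (auto simp: indicator_def nat_le_iff ceiling_le_iff)
  then show "(\<lambda>n. indicator (cball 0 (real n)) x *\<^sub>R g x) \<longlonglongrightarrow> g x"
    by (rule tendsto_eventually)
qed

lemma locally_integrable_continuous: "continuous_on UNIV f \<Longrightarrow> locally_integrable f"
  unfolding locally_integrable_def set_integrable_def
  by (intro allI impI borel_integrable_compact) (auto intro: continuous_on_subset)

lemma flat_one: "flat [:1:] s = (if s \<le> 0 then 0 else exp (- 1 / s))"
  by (simp add: flat_def)

text \<open>exp(-1/s), extended by zero, is positive exactly for s > 0; applied to the signed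
  distances to all faces, the product is positive exactly inside the box.\<close>

lemma box_cutoff:
  fixes a b :: "real^'n::finite"
  obtains B where "B \<in> elementary" "\<And>x. 0 \<le> B x" "\<And>x. B x \<le> 1" "\<And>x. B x > 0 \<longleftrightarrow> x \<in> box a b"
proof
  define B where "B x = (\<Prod>i\<in>UNIV. flat [:1:] (x $ i - a $ i) * flat [:1:] (b $ i - x $ i))" for x :: "real^'n"
  show "B \<in> elementary"
    unfolding B_def
    by (intro elementary_prod elementary.mult elementary.flat elementary_diff elementary.coord elementary.const) simp
  have 01: "0 \<le> flat [:1:] s" "flat [:1:] s \<le> 1" "0 < flat [:1:] s \<longleftrightarrow> s > 0" for s
    by (auto simp: flat_one)
  show "0 \<le> B x" "B x \<le> 1" for x
    unfolding B_def by (auto intro!: prod_nonneg prod_le_1 mult_le_one 01 mult_nonneg_nonneg)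
  have "B x > 0 \<longleftrightarrow> (\<forall>i. flat [:1:] (x $ i - a $ i) * flat [:1:] (b $ i - x $ i) > 0)" for x
  proof
    assume "B x > 0"
    have "flat [:1:] (x $ i - a $ i) * flat [:1:] (b $ i - x $ i) \<noteq> 0" for i
    proof
      assume "flat [:1:] (x $ i - a $ i) * flat [:1:] (b $ i - x $ i) = 0"
      then have "B x = 0" unfolding B_def by (intro prod_zero bexI[of _ i]) auto
      then show False using \<open>B x > 0\<close> by simp
    qed
    moreover have "flat [:1:] (x $ i - a $ i) * flat [:1:] (b $ i - x $ i) \<ge> 0" for i
      by (intro mult_nonneg_nonneg 01)
    ultimately show "\<forall>i. flat [:1:] (x $ i - a $ i) * flat [:1:] (b $ i - x $ i) > 0"
      by (simp only: less_le) metis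
  qed (auto simp: B_def intro!: prod_pos)
  moreover have "flat [:1:] s * flat [:1:] t > 0 \<longleftrightarrow> s > 0 \<and> t > 0" for s t
    by (cases "s \<le> 0"; cases "t \<le> 0") (auto simp: flat_one)
  ultimately show "B x > 0 \<longleftrightarrow> x \<in> box a b" for x
    by (simp add: mem_box_cart)
qed

text \<open>Test functions increasing to the indicator of an open box show that \<open>g\<close> has
  integral 0 over every box. Boxes form an intersection-stable generator, so the positive and the
  negative part of \<open>g\<close> are densities of the same measure.\<close>

lemma fundamental_lemma:
  fixes g :: "real^'n::finite \<Rightarrow> real"
  assumes g: "locally_integrable g"
    and orth: "\<And>\<phi>. test_function \<phi> \<Longrightarrow> (LINT x|lborel. g x * \<phi> x) = 0"
  shows "AE x in lborel. g x = 0"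
proof -
  have [measurable]: "g \<in> borel_measurable borel" by (rule locally_integrable_borel_measurable[OF g])
  have int: "integrable lborel (\<lambda>x. indicator (box a b) x * g x)" for a b
  proof -
    have "set_integrable lborel (cbox a b) g"
      using g unfolding locally_integrable_def by simp
    then have "set_integrable lborel (box a b) g"
      by (rule set_integrable_subset) (auto simp: box_subset_cbox)
    then show ?thesis by (simp add: set_integrable_def)
  qed
  have zero: "(LINT x|lborel. indicator (box a b) x * g x) = 0" for a b
  proof -
    obtain B where B: "B \<in> elementary" "\<And>x. 0 \<le> B x" "\<And>x. B x \<le> 1" "\<And>x. B x > 0 \<longleftrightarrow> x \<in> box a b"
      by (rule box_cutoff[of a b]) (rule that; assumption)
    have B0: "B x = 0" if "x \<notin> box a b" for x
      using B(2)[of x] B(4)[of x] that by linarith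
    \<comment> \<open>1 - B is less than 1 inside the box and equal to 1 outside, so its powers
      sharpen the cut-off to the indicator without leaving \<open>elementary\<close>.\<close>
    define \<phi> where "\<phi> n x = 1 - (1 - B x) ^ n" for n :: nat and x
    have el: "\<phi> n \<in> elementary" for n
      unfolding \<phi>_def by (intro elementary_diff elementary_power elementary.const B(1))
    obtain R where R: "box a b \<subseteq> ball 0 R"
      using bounded_subset_ballD[OF bounded_box] by blast
    have tf: "test_function (\<phi> n)" for n
    proof (rule test_functionI[OF smooth_elementary[OF el]])
      fix x :: "real^'n" assume "norm x > R"
      then have "x \<notin> box a b" using R by auto
      then show "\<phi> n x = 0" by (simp add: \<phi>_def B0)
    qed
    have [measurable]: "\<phi> n \<in> borel_measurable borel" for n
      using smooth_continuous_on[OF smooth_elementary[OF el]] by (rule borel_measurable_continuous_onI)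
    have "(\<lambda>n. LINT x|lborel. g x * \<phi> n x) \<longlonglongrightarrow> (LINT x|lborel. indicator (box a b) x * g x)"
    proof (rule integral_dominated_convergence[where w = "\<lambda>x. norm (indicator (box a b) x * g x)"])
      show "integrable lborel (\<lambda>x. norm (indicator (box a b) x * g x))"
        using int by (rule integrable_norm)
      show "AE x in lborel. (\<lambda>n. g x * \<phi> n x) \<longlonglongrightarrow> indicator (box a b) x * g x"
      proof (rule AE_I2)
        fix x
        show "(\<lambda>n. g x * \<phi> n x) \<longlonglongrightarrow> indicator (box a b) x * g x"
        proof (cases "x \<in> box a b")
          case True
          then have "0 \<le> 1 - B x" "1 - B x < 1" using B(3,4)[of x] by auto
          then have "(\<lambda>n. (1 - B x) ^ n) \<longlonglongrightarrow> 0" by (rule LIMSEQ_realpow_zero)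
          then have "(\<lambda>n. g x * \<phi> n x) \<longlonglongrightarrow> g x * (1 - 0)"
            unfolding \<phi>_def by (intro tendsto_mult tendsto_diff tendsto_const)
          then show ?thesis using True by simp
        next
          case False
          then show ?thesis by (simp add: \<phi>_def B0)
        qed
      qed
      show "AE x in lborel. norm (g x * \<phi> n x) \<le> norm (indicator (box a b) x * g x)" for n
      proof (rule AE_I2)
        fix x
        have "0 \<le> (1 - B x) ^ n" "(1 - B x) ^ n \<le> 1"
          using B(2,3)[of x] by (auto intro: power_le_one)
        then have "\<bar>\<phi> n x\<bar> \<le> 1" unfolding \<phi>_def by linarith
        then show "norm (g x * \<phi> n x) \<le> norm (indicator (box a b) x * g x)"
          by (cases "x \<in> box a b") (auto simp: \<phi>_def B0 abs_mult intro: mult_left_le)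
      qed
    qed auto
    then show ?thesis using orth[OF tf] by (simp add: LIMSEQ_const_iff)
  qed
  \<comment> \<open>\<open>ennreal\<close> sends negative numbers to 0, so these densities are the
    positive and the negative part of \<open>g\<close>.\<close>
  let ?M = "density lborel (\<lambda>x. ennreal (g x))" and ?N = "density lborel (\<lambda>x. ennreal (- g x))"
  have M: "emeasure ?M (box a b) = ennreal (LINT x|lborel. max 0 (indicator (box a b) x * g x))"
    and N: "emeasure ?N (box a b) = ennreal (LINT x|lborel. max 0 (- (indicator (box a b) x * g x)))" for a b
  proof -
    have "emeasure ?M (box a b) = (\<integral>\<^sup>+x. ennreal (max 0 (indicator (box a b) x * g x)) \<partial>lborel)"
      by (subst emeasure_density) (auto intro!: nn_integral_cong simp: indicator_def max_def ennreal_neg)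
    then show "emeasure ?M (box a b) = ennreal (LINT x|lborel. max 0 (indicator (box a b) x * g x))"
      using int by (simp add: nn_integral_eq_integral)
    have "emeasure ?N (box a b) = (\<integral>\<^sup>+x. ennreal (max 0 (- (indicator (box a b) x * g x))) \<partial>lborel)"
      by (subst emeasure_density) (auto intro!: nn_integral_cong simp: indicator_def max_def ennreal_neg)
    then show "emeasure ?N (box a b) = ennreal (LINT x|lborel. max 0 (- (indicator (box a b) x * g x)))"
      using int by (simp add: nn_integral_eq_integral)
  qed
  have eq: "emeasure ?M (box a b) = emeasure ?N (box a b)" for a b
  proof -
    have "(LINT x|lborel. max 0 (indicator (box a b) x * g x)) - (LINT x|lborel. max 0 (- (indicator (box a b) x * g x)))
        = (LINT x|lborel. max 0 (indicator (box a b) x * g x) - max 0 (- (indicator (box a b) x * g x)))"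
      using int by (intro Bochner_Integration.integral_diff[symmetric]) auto
    also have "\<dots> = (LINT x|lborel. indicator (box a b) x * g x)"
      by (rule Bochner_Integration.integral_cong) auto
    finally show ?thesis unfolding M N using zero[of a b] by simp
  qed
  have "?M = ?N"
  proof (rule measure_eqI_generator_eq[where E = "range (\<lambda>(a, b). box a b)" and \<Omega> = UNIV and A = "\<lambda>n. box (\<chi> i. - real n) (\<chi> i. real n)"])
    show "Int_stable (range (\<lambda>(a::real^'n, b). box a b))"
    proof (rule Int_stableI)
      fix A B :: "(real^'n) set"
      assume "A \<in> range (\<lambda>(a, b). box a b)" "B \<in> range (\<lambda>(a, b). box a b)"
      then obtain a b c d where "A = box a b" "B = box c d" by auto
      moreover obtain u v where "box a b \<inter> box c d = box u v" by (rule that[OF box_Int_box])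
      ultimately show "A \<inter> B \<in> range (\<lambda>(a, b). box a b)" by auto
    qed
    have "sets (borel :: (real^'n) measure) = sigma_sets UNIV (range (\<lambda>(a, b). box a b))"
      by (subst borel_eq_box) simp
    then show "sets ?M = sigma_sets UNIV (range (\<lambda>(a, b). box a b))" "sets ?N = sigma_sets UNIV (range (\<lambda>(a, b). box a b))"
      by auto
    show "(\<Union>n. box (\<chi> i. - real n) (\<chi> i. real n)) = (UNIV :: (real^'n) set)"
    proof -
      have "\<exists>n. x \<in> box (\<chi> i. - real n) (\<chi> i. real n)" for x :: "real^'n"
      proof -
        obtain n where n: "norm x < real n" using reals_Archimedean2 by blast
        have "\<bar>x $ i\<bar> < real n" for i using component_le_norm_cart[of x i] n by linarith
        then show ?thesis by (auto simp: mem_box_cart abs_less_iff minus_less_iff intro!: exI[of _ n])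
      qed
      then show ?thesis by blast
    qed
  qed (auto simp: eq N)
  then have "AE x in lborel. ennreal (g x) = ennreal (- g x)"
    by (intro sigma_finite_measure.density_unique sigma_finite_lborel) auto
  then show ?thesis
  proof eventually_elim
    case (elim x)
    then show ?case by (cases "g x \<ge> 0") (auto simp: ennreal_neg ennreal_eq_0_iff)
  qed
qed

text \<open>Pins down the choice in \<open>weak_laplacian\<close> up to a null set; for test
  functions it may then be replaced by the classical Laplacian.\<close>

lemma has_weak_laplacian_unique:
  assumes "has_weak_laplacian u g" "has_weak_laplacian u g'"
  shows "AE x in lborel. g x = g' x"
proof -
  have loc: "locally_integrable g" "locally_integrable g'"
    using assms by (auto simp: has_weak_laplacian_def)
  have "AE x in lborel. g x - g' x = 0"
  proof (rule fundamental_lemma)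
    show "locally_integrable (\<lambda>x. g x - g' x)"
      using loc by (auto simp: locally_integrable_def intro: set_integral_diff)
    fix \<phi> :: "real^'a \<Rightarrow> real" assume tf: "test_function \<phi>"
    obtain R where R: "R > 0" "\<And>x. norm x > R \<Longrightarrow> \<phi> x = 0" using test_function_zero_outside[OF tf] by blast
    have c: "continuous_on UNIV \<phi>" using tf by (simp add: test_function_def smooth_continuous_on)
    obtain B where B: "B \<ge> 0" "\<And>x. \<bar>\<phi> x\<bar> \<le> B"
      using continuous_zero_outside_bounded[OF c R(2)] by blast
    have [measurable]: "\<phi> \<in> borel_measurable borel" using c by (rule borel_measurable_continuous_onI)
    have int: "integrable lborel (\<lambda>x. k x * \<phi> x)" if "locally_integrable k" for k
    proof (rule Bochner_Integration.integrable_bound)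
      have [measurable]: "k \<in> borel_measurable borel" by (rule locally_integrable_borel_measurable[OF that])
      have "set_integrable lborel (cball 0 R) k"
        using that compact_cball unfolding locally_integrable_def by blast
      then show "integrable lborel (\<lambda>x. B * (indicator (cball 0 R) x *\<^sub>R k x))"
        unfolding set_integrable_def by (rule integrable_mult_right)
      show "(\<lambda>x. k x * \<phi> x) \<in> borel_measurable lborel" by simp
      show "AE x in lborel. norm (k x * \<phi> x) \<le> norm (B * (indicator (cball 0 R) x *\<^sub>R k x))"
      proof (rule AE_I2)
        fix x
        show "norm (k x * \<phi> x) \<le> norm (B * (indicator (cball 0 R) x *\<^sub>R k x))"
          using R(2)[of x] B mult_left_mono[OF B(2), of "\<bar>k x\<bar>" x]
          by (cases "norm x \<le> R") (auto simp: abs_mult mult.commute)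
      qed
    qed
    have "(LINT x|lborel. g x * \<phi> x) = (LINT x|lborel. g' x * \<phi> x)"
      using assms tf unfolding has_weak_laplacian_def by metis
    then show "(LINT x|lborel. (g x - g' x) * \<phi> x) = 0"
      using int[OF loc(1)] int[OF loc(2)] by (simp add: left_diff_distrib)
  qed
  then show ?thesis by simp
qed

section \<open>Test functions as elements of \<open>D2p\<close>\<close>

lemma has_weak_laplacian_test_function:
  assumes "test_function u"
  shows "has_weak_laplacian u (laplacian u)"
proof -
  have sm: "smooth u" using assms by (simp add: test_function_def)
  have "(LINT x|lborel. u x * laplacian \<phi> x) = (LINT x|lborel. laplacian u x * \<phi> x)"
    if tf: "test_function \<phi>" for \<phi>
  proof -
    obtain R where R: "R > 0" "\<And>x. norm x > R \<Longrightarrow> \<phi> x = 0" using test_function_zero_outside[OF tf] by blast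
    show ?thesis
      using Green_identity[OF has_C2_partials_smooth[OF sm] has_C2_partials_smooth R(2)] tf
      by (simp add: test_function_def laplacian_def)
  qed
  then show ?thesis
    unfolding has_weak_laplacian_def
    by (intro conjI allI impI locally_integrable_continuous smooth_continuous_on laplacian_continuous_on sm)
qed

lemma has_weak_laplacian_weak_laplacian:
  "has_weak_laplacian u g \<Longrightarrow> has_weak_laplacian u (weak_laplacian u)"
  unfolding weak_laplacian_def by (rule someI[of "has_weak_laplacian u"])

lemma weak_laplacian_borel_measurable:
  assumes "has_weak_laplacian u g"
  shows "weak_laplacian u \<in> borel_measurable borel"
  using has_weak_laplacian_weak_laplacian[OF assms]
  by (auto simp: has_weak_laplacian_def intro: locally_integrable_borel_measurable)

lemma weak_laplacian_test_function:
  assumes "test_function u"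
  shows "AE x in lborel. weak_laplacian u x = laplacian u x"
  using has_weak_laplacian_unique has_weak_laplacian_weak_laplacian has_weak_laplacian_test_function[OF assms] by blast

lemma test_function_borel_measurable:
  "test_function u \<Longrightarrow> u \<in> borel_measurable borel" "test_function u \<Longrightarrow> laplacian u \<in> borel_measurable borel"
  by (auto simp: test_function_def intro: borel_measurable_continuous_onI smooth_continuous_on laplacian_continuous_on)

text \<open>The constant sequence approximates: its Laplacian agrees almost everywhere with the
  chosen weak one.\<close>

lemma test_function_in_D2p:
  assumes "test_function u"
  shows "u \<in> D2p p"
proof -
  note w = has_weak_laplacian_test_function[OF assms]
  have "AE x in lborel. ennreal (\<bar>laplacian u x - weak_laplacian u x\<bar> powr p) = 0"
    using weak_laplacian_test_function[OF assms] by eventually_elim simp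
  then have "(\<integral>\<^sup>+x. ennreal (\<bar>laplacian u x - weak_laplacian u x\<bar> powr p) \<partial>lborel) = 0"
    using test_function_borel_measurable[OF assms] weak_laplacian_borel_measurable[OF w]
    by (subst nn_integral_0_iff_AE) auto
  then show ?thesis
    unfolding D2p_def using test_function_borel_measurable[OF assms] w assms
    by (auto intro!: exI[of _ "\<lambda>_. u"])
qed

section \<open>Translated and dilated bumps\<close>

lemma partial_deriv_affine:
  assumes "\<And>x. f differentiable (at x)"
  shows "partial_deriv i (\<lambda>y. a * f (k *\<^sub>R (y - c))) = (\<lambda>y. a * k * partial_deriv i f (k *\<^sub>R (y - c)))"
proof
  fix y
  have f: "(f has_derivative frechet_derivative f (at x)) (at x)" for x
    using assms frechet_derivative_works by blast
  have lin: "linear (frechet_derivative f (at x))" for x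
    using f has_derivative_linear by blast
  have "((\<lambda>y. a * f (k *\<^sub>R (y - c))) has_derivative (\<lambda>h. a * frechet_derivative f (at (k *\<^sub>R (y - c))) (k *\<^sub>R h))) (at y)"
    by (rule has_derivative_mult_right has_derivative_compose[OF _ f] derivative_eq_intros refl)+ simp
  from frechet_derivative_at[OF this, symmetric]
  show "partial_deriv i (\<lambda>y. a * f (k *\<^sub>R (y - c))) y = a * k * partial_deriv i f (k *\<^sub>R (y - c))"
    by (simp add: partial_deriv_def linear_cmul[OF lin])
qed

lemma laplacian_affine:
  assumes "smooth f"
  shows "laplacian (\<lambda>y. f (k *\<^sub>R (y - c))) y = k\<^sup>2 * laplacian f (k *\<^sub>R (y - c))"
proof -
  have 1: "partial_deriv i (\<lambda>y. f (k *\<^sub>R (y - c))) = (\<lambda>y. k * partial_deriv i f (k *\<^sub>R (y - c)))" for i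
    using partial_deriv_affine[of f i 1 k c] smooth_differentiable[OF assms] by simp
  have "partial_deriv i (partial_deriv i (\<lambda>y. f (k *\<^sub>R (y - c)))) = (\<lambda>y. k * k * partial_deriv i (partial_deriv i f) (k *\<^sub>R (y - c)))" for i
    unfolding 1 by (rule partial_deriv_affine) (intro smooth_differentiable smooth_partial_deriv assms)
  then show ?thesis
    by (simp add: laplacian_def sum_distrib_left power2_eq_square)
qed

text \<open>The standard mollifier exp(-1/(1 - |x|^2)) of the unit ball. Its affine copies are the
  competitors for \<open>S\<close>; the centred one shows that there are nonzero radial
  elements.\<close>

definition bump :: "real^'n::finite \<Rightarrow> real" where
  "bump x = flat [:1:] (1 - x \<bullet> x)"

lemma bump_affine_elementary: "(\<lambda>y. bump (k *\<^sub>R (y - c))) \<in> elementary"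
proof -
  have "(\<lambda>y. bump (k *\<^sub>R (y - c))) = (\<lambda>y. flat [:1:] (1 - (\<Sum>i\<in>UNIV. (k * (y $ i - c $ i))\<^sup>2)))"
    by (simp add: bump_def inner_vec_def power2_eq_square fun_eq_iff)
  also have "\<dots> \<in> elementary"
    by (intro elementary.flat elementary_diff elementary.const elementary_sum elementary_power elementary.mult elementary.coord finite_class.finite_UNIV)
  finally show ?thesis .
qed

lemma smooth_bump_affine: "smooth (\<lambda>y. bump (k *\<^sub>R (y - c)))"
  by (rule smooth_elementary[OF bump_affine_elementary])

lemma smooth_bump: "smooth bump"
  using smooth_bump_affine[of 1 0] by simp

lemma bump_nonneg: "bump x \<ge> 0"
  by (simp add: bump_def flat_one)

lemma bump_pos_iff: "bump x > 0 \<longleftrightarrow> norm x < 1"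
proof -
  have "bump x > 0 \<longleftrightarrow> x \<bullet> x < 1" by (simp add: bump_def flat_one)
  then show ?thesis by (simp add: norm_eq_sqrt_inner)
qed

lemma bump_eq_0: "norm x \<ge> 1 \<Longrightarrow> bump x = 0"
  using bump_pos_iff[of x] bump_nonneg[of x] by linarith

lemma test_function_bump_affine:
  assumes "k > 0"
  shows "test_function (\<lambda>y. bump (k *\<^sub>R (y - c)))"
proof (rule test_functionI[OF smooth_bump_affine])
  fix x :: "real^'a" assume "norm x > norm c + 1 / k"
  then have "norm (x - c) > 1 / k" using norm_triangle_ineq2[of x c] by linarith
  then have "1 \<le> k * norm (x - c)" using assms by (simp add: field_simps)
  then show "bump (k *\<^sub>R (x - c)) = 0" using assms by (intro bump_eq_0) (simp only: norm_scaleR abs_of_pos)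
qed

lemma test_function_bump: "test_function bump"
  using test_function_bump_affine[of 1 0] by simp

lemma bump_affine_nonzero:
  fixes c :: "real^'n::finite"
  assumes "k > 0"
  shows "\<not> (AE y in lborel. bump (k *\<^sub>R (y - c)) = 0)"
proof
  assume "AE y in lborel. bump (k *\<^sub>R (y - c)) = 0"
  then have "AE y in lborel. y \<notin> ball c (1 / k)"
  proof eventually_elim
    case (elim y)
    then have "\<not> norm (k *\<^sub>R (y - c)) < 1" using bump_pos_iff[of "k *\<^sub>R (y - c)"] by simp
    then have "\<not> k * norm (y - c) < 1" using assms by (simp only: norm_scaleR abs_of_pos not_False_eq_True)
    then show ?case using assms by (simp add: dist_norm norm_minus_commute field_simps)
  qed
  then have "emeasure lborel (ball c (1 / k)) = 0"
    by (subst (asm) AE_iff_null_sets[symmetric]) auto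
  then show False using assms unit_ball_vol_pos[of "real CARD('n)"] by (simp add: emeasure_ball)
qed

lemma bump_affine_in_D2p_nonzero:
  assumes "k > 0"
  shows "(\<lambda>y. bump (k *\<^sub>R (y - c))) \<in> D2p_nonzero p"
  unfolding D2p_nonzero_def
  using test_function_in_D2p[OF test_function_bump_affine[OF assms]] bump_affine_nonzero[OF assms] by blast

lemma radial_D2p_nonempty: "{u \<in> D2p_nonzero p. radial u} \<noteq> {}"
proof -
  have "(\<lambda>y. bump (1 *\<^sub>R (y - 0))) \<in> D2p_nonzero p" by (rule bump_affine_in_D2p_nonzero) simp
  moreover have "radial bump"
    unfolding radial_def bump_def
    by (intro exI[of _ "\<lambda>r. flat [:1:] (1 - r\<^sup>2)"]) (simp add: power2_norm_eq_inner)
  ultimately show ?thesis by auto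
qed

section \<open>Passage to the limit\<close>

lemma nn_integral_Fatou_bound:
  fixes f :: "nat \<Rightarrow> 'a \<Rightarrow> ennreal"
  assumes [measurable]: "\<And>k. f k \<in> borel_measurable M" "g \<in> borel_measurable M"
    and lim: "AE x in M. (\<lambda>k. f k x) \<longlonglongrightarrow> g x" and le: "\<And>k. integral\<^sup>N M (f k) \<le> C"
  shows "integral\<^sup>N M g \<le> C"
proof -
  have "integral\<^sup>N M g = (\<integral>\<^sup>+x. liminf (\<lambda>k. f k x) \<partial>M)"
    by (rule nn_integral_cong_AE, use lim in eventually_elim) (simp add: lim_imp_Liminf)
  also have "\<dots> \<le> liminf (\<lambda>k. integral\<^sup>N M (f k))"
    by (rule nn_integral_liminf) simp
  also have "\<dots> \<le> C"
    using le by (intro Liminf_le) simp_all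
  finally show ?thesis .
qed

lemma abs_add_powr_le:
  fixes a b p :: real
  assumes "p > 0"
  shows "\<bar>a + b\<bar> powr p \<le> 2 powr p * (\<bar>a\<bar> powr p + \<bar>b\<bar> powr p)"
proof -
  have "\<bar>a + b\<bar> \<le> 2 * max \<bar>a\<bar> \<bar>b\<bar>" by linarith
  then have "\<bar>a + b\<bar> powr p \<le> (2 * max \<bar>a\<bar> \<bar>b\<bar>) powr p"
    using assms by (intro powr_mono2) auto
  also have "\<dots> = 2 powr p * max \<bar>a\<bar> \<bar>b\<bar> powr p" by (simp add: powr_mult)
  also have "\<dots> \<le> 2 powr p * (\<bar>a\<bar> powr p + \<bar>b\<bar> powr p)"
    by (intro mult_left_mono) (auto simp: max_def)
  finally show ?thesis .
qed

text \<open>Convergence in L^s is L^1 convergence of |v - u|^s to 0, and this yields a subsequence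
  converging almost everywhere.\<close>

lemma AE_tendsto_subseq:
  fixes v :: "nat \<Rightarrow> 'a \<Rightarrow> real"
  assumes [measurable]: "\<And>k. v k \<in> borel_measurable M" "u \<in> borel_measurable M" and s: "s > 0"
    and lim: "(\<lambda>k. \<integral>\<^sup>+x. ennreal (\<bar>v k x - u x\<bar> powr s) \<partial>M) \<longlonglongrightarrow> 0"
    and fin: "\<And>k. (\<integral>\<^sup>+x. ennreal (\<bar>v k x - u x\<bar> powr s) \<partial>M) < \<infinity>"
  obtains r :: "nat \<Rightarrow> nat" where "AE x in M. (\<lambda>k. v (r k) x) \<longlonglongrightarrow> u x"
proof -
  have int: "integrable M (\<lambda>x. \<bar>v k x - u x\<bar> powr s)" for k
    using fin[of k] by (intro integrableI_nonneg) auto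
  have "(\<lambda>k. LINT x|M. norm (\<bar>v k x - u x\<bar> powr s)) \<longlonglongrightarrow> 0"
  proof -
    have "(LINT x|M. norm (\<bar>v k x - u x\<bar> powr s)) = enn2real (\<integral>\<^sup>+x. ennreal (\<bar>v k x - u x\<bar> powr s) \<partial>M)" for k
      by (simp add: integral_eq_nn_integral)
    moreover have "(\<lambda>k. enn2real (\<integral>\<^sup>+x. ennreal (\<bar>v k x - u x\<bar> powr s) \<partial>M)) \<longlonglongrightarrow> enn2real (ennreal 0)"
      using lim by (intro tendsto_enn2real) auto
    ultimately show ?thesis by simp
  qed
  from tendsto_L1_AE_subseq[OF int this] obtain r where r: "AE x in M. (\<lambda>k. \<bar>v (r k) x - u x\<bar> powr s) \<longlonglongrightarrow> 0"
    by blast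
  have "AE x in M. (\<lambda>k. v (r k) x) \<longlonglongrightarrow> u x"
    using r
  proof eventually_elim
    case (elim x)
    have "(\<lambda>k. (\<bar>v (r k) x - u x\<bar> powr s) powr (1 / s)) \<longlonglongrightarrow> 0"
      by (rule tendsto_zero_powrI[OF elim tendsto_const]) (use s in auto)
    then have "(\<lambda>k. \<bar>v (r k) x - u x\<bar>) \<longlonglongrightarrow> 0" using s by (simp add: powr_powr)
    then show ?case by (simp add: tendsto_rabs_zero_iff LIM_zero_iff)
  qed
  then show ?thesis using that by blast
qed

text \<open>Almost everywhere convergence comes from the critical norm, the energy bound from the
  convergence of the Laplacians. The factor 2^p is that of \<open>abs_add_powr_le\<close>, which
  replaces the triangle inequality; it only affects constants. Integrability is recorded because the
  Bochner integral of a non-integrable function is 0 and would bound nothing.\<close>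

lemma D2p_approximation:
  fixes u :: "real^'n::finite \<Rightarrow> real"
  assumes u: "u \<in> D2p p" and p: "p > 0" and N: "real CARD('n) > 2 * p"
  shows "integrable lborel (\<lambda>x. \<bar>weak_laplacian u x\<bar> powr p)"
    and "(LINT x|lborel. \<bar>weak_laplacian u x\<bar> powr p) < D \<Longrightarrow>
      \<exists>v. (\<forall>k. test_function (v k)) \<and> (AE x in lborel. (\<lambda>k. v k x) \<longlonglongrightarrow> u x) \<and>
        (\<forall>k. (LINT x|lborel. \<bar>laplacian (v k) x\<bar> powr p) \<le> 2 powr p * D)"
proof -
  let ?g = "weak_laplacian u"
  define s where "s = crit_exponent (real CARD('n)) p"
  have s: "s > 0" using p N by (simp add: s_def crit_exponent_def)
  obtain g \<phi> where g: "has_weak_laplacian u g" and tf: "\<And>k. test_function (\<phi> k)"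
    and a: "(\<lambda>k. \<integral>\<^sup>+x. ennreal (\<bar>\<phi> k x - u x\<bar> powr s) \<partial>lborel) \<longlonglongrightarrow> 0"
    and b: "(\<lambda>k. \<integral>\<^sup>+x. ennreal (\<bar>laplacian (\<phi> k) x - ?g x\<bar> powr p) \<partial>lborel) \<longlonglongrightarrow> 0"
    and [measurable]: "u \<in> borel_measurable borel"
    using u unfolding D2p_def s_def by blast
  have [measurable]: "?g \<in> borel_measurable borel" using g by (rule weak_laplacian_borel_measurable)
  have [measurable]: "\<phi> k \<in> borel_measurable borel" "laplacian (\<phi> k) \<in> borel_measurable borel" for k
    using test_function_borel_measurable tf by auto
  have int: "integrable lborel (\<lambda>x. \<bar>laplacian (\<phi> k) x\<bar> powr p)" for k
  proof -
    have sm: "smooth (\<phi> k)" using tf[of k] by (simp add: test_function_def)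
    obtain R where R: "R > 0" "\<And>x. norm x > R \<Longrightarrow> \<phi> k x = 0" using test_function_zero_outside[OF tf] by blast
    show ?thesis
      using p by (intro continuous_zero_outside_integrable[of _ R])
        (auto intro!: continuous_intros continuous_on_powr' laplacian_continuous_on[OF sm] simp: laplacian_zero_outside[OF sm R(2)])
  qed
  have fin1: "\<forall>\<^sub>F k in sequentially. (\<integral>\<^sup>+x. ennreal (\<bar>\<phi> k x - u x\<bar> powr s) \<partial>lborel) < 1"
    using a by (rule order_tendstoD) simp
  have small: "\<forall>\<^sub>F k in sequentially. (\<integral>\<^sup>+x. ennreal (\<bar>laplacian (\<phi> k) x - ?g x\<bar> powr p) \<partial>lborel) < ennreal e" if "e > 0" for e
    by (rule order_tendstoD(2)[OF b]) (use that in \<open>simp add: ennreal_less_zero_iff\<close>)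
  obtain k where k: "(\<integral>\<^sup>+x. ennreal (\<bar>laplacian (\<phi> k) x - ?g x\<bar> powr p) \<partial>lborel) < ennreal 1"
    using small[of 1] by (auto simp: eventually_sequentially)
  show ig: "integrable lborel (\<lambda>x. \<bar>?g x\<bar> powr p)"
  proof (rule integrableI_nonneg)
    have "(\<integral>\<^sup>+x. ennreal (\<bar>?g x\<bar> powr p) \<partial>lborel)
      \<le> (\<integral>\<^sup>+x. ennreal (2 powr p) * (ennreal (\<bar>laplacian (\<phi> k) x - ?g x\<bar> powr p) + ennreal (\<bar>laplacian (\<phi> k) x\<bar> powr p)) \<partial>lborel)"
    proof (rule nn_integral_mono)
      fix x
      have "\<bar>?g x\<bar> powr p \<le> 2 powr p * (\<bar>?g x - laplacian (\<phi> k) x\<bar> powr p + \<bar>laplacian (\<phi> k) x\<bar> powr p)"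
        using abs_add_powr_le[OF p, of "?g x - laplacian (\<phi> k) x" "laplacian (\<phi> k) x"] by simp
      then show "ennreal (\<bar>?g x\<bar> powr p) \<le> ennreal (2 powr p) * (ennreal (\<bar>laplacian (\<phi> k) x - ?g x\<bar> powr p) + ennreal (\<bar>laplacian (\<phi> k) x\<bar> powr p))"
        by (simp add: ennreal_plus[symmetric] ennreal_mult''[symmetric] abs_minus_commute del: ennreal_plus)
    qed
    also have "\<dots> = ennreal (2 powr p) * ((\<integral>\<^sup>+x. ennreal (\<bar>laplacian (\<phi> k) x - ?g x\<bar> powr p) \<partial>lborel) + (\<integral>\<^sup>+x. ennreal (\<bar>laplacian (\<phi> k) x\<bar> powr p) \<partial>lborel))"
      by (simp add: nn_integral_cmult nn_integral_add)
    also have "\<dots> \<le> ennreal (2 powr p) * (ennreal 1 + ennreal (LINT x|lborel. \<bar>laplacian (\<phi> k) x\<bar> powr p))"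
      using k nn_integral_eq_integral[OF int[of k]] by (intro mult_left_mono add_mono less_imp_le) auto
    also have "\<dots> < \<infinity>"
      by (simp only: ennreal_plus[symmetric] ennreal_mult''[symmetric] zero_le_one Bochner_Integration.integral_nonneg powr_ge_zero) (simp add: ennreal_mult_less_top)
    finally show "(\<integral>\<^sup>+x. ennreal (\<bar>?g x\<bar> powr p) \<partial>lborel) < \<infinity>" .
  qed auto
  show "\<exists>v. (\<forall>k. test_function (v k)) \<and> (AE x in lborel. (\<lambda>k. v k x) \<longlonglongrightarrow> u x) \<and>
        (\<forall>k. (LINT x|lborel. \<bar>laplacian (v k) x\<bar> powr p) \<le> 2 powr p * D)"
    if D: "(LINT x|lborel. \<bar>?g x\<bar> powr p) < D"
  proof -
    let ?I = "LINT x|lborel. \<bar>?g x\<bar> powr p"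
    have I0: "0 \<le> ?I" by (rule Bochner_Integration.integral_nonneg) simp
    then have D0: "0 \<le> D" using D by linarith
    have "\<forall>\<^sub>F k in sequentially. (\<integral>\<^sup>+x. ennreal (\<bar>\<phi> k x - u x\<bar> powr s) \<partial>lborel) < 1 \<and>
        (\<integral>\<^sup>+x. ennreal (\<bar>laplacian (\<phi> k) x - ?g x\<bar> powr p) \<partial>lborel) < ennreal (D - ?I)"
      using fin1 small[of "D - ?I"] D by (auto intro: eventually_conj)
    \<comment> \<open>From \<open>K\<close> on both distances are small: the first is finite, as the
      choice of a subsequence requires, and the second fits into the gap between \<open>D\<close>
      and the energy of \<open>u\<close>.\<close>
    then obtain K where K0: "\<forall>k\<ge>K. (\<integral>\<^sup>+x. ennreal (\<bar>\<phi> k x - u x\<bar> powr s) \<partial>lborel) < 1 \<and>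
        (\<integral>\<^sup>+x. ennreal (\<bar>laplacian (\<phi> k) x - ?g x\<bar> powr p) \<partial>lborel) < ennreal (D - ?I)"
      unfolding eventually_sequentially by (rule exE)
    have K: "(\<integral>\<^sup>+x. ennreal (\<bar>\<phi> (k + K) x - u x\<bar> powr s) \<partial>lborel) < 1"
        "(\<integral>\<^sup>+x. ennreal (\<bar>laplacian (\<phi> (k + K)) x - ?g x\<bar> powr p) \<partial>lborel) < ennreal (D - ?I)" for k
      using K0[rule_format, of "k + K"] by simp_all
    obtain r :: "nat \<Rightarrow> nat" where r: "AE x in lborel. (\<lambda>k. \<phi> (r k + K) x) \<longlonglongrightarrow> u x"
    proof (rule AE_tendsto_subseq[of "\<lambda>k. \<phi> (k + K)" lborel u s])
      show "(\<lambda>k. \<integral>\<^sup>+x. ennreal (\<bar>\<phi> (k + K) x - u x\<bar> powr s) \<partial>lborel) \<longlonglongrightarrow> 0"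
        using a by (rule LIMSEQ_ignore_initial_segment)
      show "(\<integral>\<^sup>+x. ennreal (\<bar>\<phi> (k + K) x - u x\<bar> powr s) \<partial>lborel) < \<infinity>" for k
        using order.strict_trans[OF K(1)[of k] ennreal_one_less_top] by simp
    qed (use s in auto)
    have "(LINT x|lborel. \<bar>laplacian (\<phi> (k + K)) x\<bar> powr p) \<le> 2 powr p * D" for k
    proof -
      let ?L = "laplacian (\<phi> (k + K))"
      have "ennreal (LINT x|lborel. \<bar>?L x\<bar> powr p) = (\<integral>\<^sup>+x. ennreal (\<bar>?L x\<bar> powr p) \<partial>lborel)"
        using nn_integral_eq_integral[OF int] by simp
      also have "\<dots> \<le> (\<integral>\<^sup>+x. ennreal (2 powr p) * (ennreal (\<bar>?L x - ?g x\<bar> powr p) + ennreal (\<bar>?g x\<bar> powr p)) \<partial>lborel)"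
      proof (rule nn_integral_mono)
        fix x
        have "\<bar>?L x\<bar> powr p \<le> 2 powr p * (\<bar>?L x - ?g x\<bar> powr p + \<bar>?g x\<bar> powr p)"
          using abs_add_powr_le[OF p, of "?L x - ?g x" "?g x"] by simp
        then show "ennreal (\<bar>?L x\<bar> powr p) \<le> ennreal (2 powr p) * (ennreal (\<bar>?L x - ?g x\<bar> powr p) + ennreal (\<bar>?g x\<bar> powr p))"
          by (simp add: ennreal_plus[symmetric] ennreal_mult''[symmetric] del: ennreal_plus)
      qed
      also have "\<dots> = ennreal (2 powr p) * ((\<integral>\<^sup>+x. ennreal (\<bar>?L x - ?g x\<bar> powr p) \<partial>lborel) + (\<integral>\<^sup>+x. ennreal (\<bar>?g x\<bar> powr p) \<partial>lborel))"
        by (simp add: nn_integral_cmult nn_integral_add)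
      also have "\<dots> \<le> ennreal (2 powr p) * (ennreal (D - ?I) + ennreal ?I)"
        using K(2)[of k] nn_integral_eq_integral[OF ig] by (intro mult_left_mono add_mono) auto
      also have "\<dots> = ennreal (2 powr p * D)"
      proof -
        have "ennreal (D - ?I) + ennreal ?I = ennreal D"
          using D I0 by (subst ennreal_plus[symmetric]) auto
        then show ?thesis using ennreal_mult[of "2 powr p" D] D0 by simp
      qed
      finally have "ennreal (LINT x|lborel. \<bar>?L x\<bar> powr p) \<le> ennreal (2 powr p * D)" .
      moreover have "0 \<le> 2 powr p * D" using D0 by simp
      ultimately show ?thesis by (simp only: ennreal_le_iff)
    qed
    then show ?thesis
      using tf r by (intro exI[of _ "\<lambda>k. \<phi> (r k + K)"]) auto
  qed
qed

lemma norm_powr_eq: "norm x powr a = (x \<bullet> x) powr (a / 2)" for x :: "'a::real_inner"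
proof (cases "x = 0")
  case False
  then have "(x \<bullet> x) powr (a / 2) = (norm x powr 2) powr (a / 2)"
    by (simp add: power2_norm_eq_inner[symmetric] powr_numeral)
  then show ?thesis by (simp only: powr_powr) simp
qed simp

text \<open>The k-th approximant is paired with the shift 1 / (k + 1), so a single application of
  Fatou's lemma removes both the approximation and the shift.\<close>

lemma Rellich_D2p:
  fixes u :: "real^'n::finite \<Rightarrow> real"
  assumes N: "real CARD('n) > 2 * p" and p: "2 \<le> p" and u: "u \<in> D2p p"
  shows "integrable lborel (\<lambda>x. norm x powr (- 2 * p) * \<bar>u x\<bar> powr p)"
proof -
  have [measurable]: "u \<in> borel_measurable borel" using u by (simp add: D2p_def)
  obtain C where C: "C > 0" "\<And>(\<phi> :: real^'n \<Rightarrow> real) \<epsilon>. \<epsilon> > 0 \<Longrightarrow> test_function \<phi> \<Longrightarrow>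
    (\<integral>\<^sup>+x. ennreal ((x \<bullet> x + \<epsilon>) powr (- p) * \<bar>\<phi> x\<bar> powr p) \<partial>lborel)
      \<le> ennreal (C * (LINT x|lborel. \<bar>laplacian \<phi> x\<bar> powr p))"
    using Rellich_test_function[OF N p] by blast
  define D where "D = (LINT x|lborel. \<bar>weak_laplacian u x\<bar> powr p) + 1"
  obtain v where tf: "\<And>k. test_function (v k)" and v: "AE x in lborel. (\<lambda>k. v k x) \<longlonglongrightarrow> u x"
    and D: "\<And>k. (LINT x|lborel. \<bar>laplacian (v k) x\<bar> powr p) \<le> 2 powr p * D"
    using D2p_approximation(2)[OF u _ N, of D] p by (auto simp: D_def)
  have [measurable]: "v k \<in> borel_measurable borel" for k
    using test_function_borel_measurable tf by auto
  have "(\<integral>\<^sup>+x. ennreal (norm x powr (- 2 * p) * \<bar>u x\<bar> powr p) \<partial>lborel) \<le> ennreal (C * (2 powr p * D))"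
  proof (rule nn_integral_Fatou_bound)
    let ?f = "\<lambda>k x. ennreal ((x \<bullet> x + inverse (real (Suc k))) powr (- p) * \<bar>v k x\<bar> powr p)"
    show "integral\<^sup>N lborel (?f k) \<le> ennreal (C * (2 powr p * D))" for k
    proof -
      have "integral\<^sup>N lborel (?f k) \<le> ennreal (C * (LINT x|lborel. \<bar>laplacian (v k) x\<bar> powr p))"
        by (rule C) (simp_all add: tf)
      also have "\<dots> \<le> ennreal (C * (2 powr p * D))"
        using C(1) D[of k] by (intro ennreal_leI mult_left_mono) auto
      finally show ?thesis .
    qed
    have "AE x in lborel. x \<noteq> (0 :: real^'n)" by (rule AE_lborel_singleton)
    with v show "AE x in lborel. (\<lambda>k. ?f k x) \<longlonglongrightarrow> ennreal (norm x powr (- 2 * p) * \<bar>u x\<bar> powr p)"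
    proof eventually_elim
      case (elim x)
      have "(\<lambda>k. x \<bullet> x + inverse (real (Suc k))) \<longlonglongrightarrow> x \<bullet> x + 0"
        by (intro tendsto_intros LIMSEQ_inverse_real_of_nat)
      then have "(\<lambda>k. (x \<bullet> x + inverse (real (Suc k))) powr (- p)) \<longlonglongrightarrow> (x \<bullet> x) powr (- p)"
        using elim by (intro tendsto_powr) auto
      moreover have "(\<lambda>k. \<bar>v k x\<bar> powr p) \<longlonglongrightarrow> \<bar>u x\<bar> powr p"
        using elim p by (intro tendsto_powr2 tendsto_intros) auto
      ultimately show ?case
        unfolding norm_powr_eq by (intro tendsto_ennrealI tendsto_mult) auto
    qed
  qed auto
  then show ?thesis by (intro integrableI_nonneg) (auto simp: less_top[symmetric] top_unique)
qed

lemma radial_D2p_estimate: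
  fixes p :: real
  assumes N: "real CARD('n::finite) > 2 * p" and p: "2 \<le> p"
  obtains M where "M > 0" "\<And>(u :: real^'n \<Rightarrow> real) \<eta> \<alpha> b D. u \<in> D2p p \<Longrightarrow> continuous_on UNIV \<eta> \<Longrightarrow> (\<And>t. \<eta> t \<ge> 0) \<Longrightarrow>
    \<alpha> > 0 \<Longrightarrow> (\<And>t. t \<le> \<alpha> \<Longrightarrow> \<eta> t = 0) \<Longrightarrow> (\<And>t. t \<ge> b \<Longrightarrow> \<eta> t = 0) \<Longrightarrow>
    (LINT x|lborel. \<bar>weak_laplacian u x\<bar> powr p) < D \<Longrightarrow>
    (\<integral>\<^sup>+x. ennreal (\<bar>u x\<bar> * \<eta> (x \<bullet> x)) \<partial>lborel)
      \<le> ennreal (M * D powr (1 / p)) * (\<integral>\<^sup>+(x::real^'n). ennreal (\<eta> (x \<bullet> x) * (x \<bullet> x) powr (1 - real CARD('n) / (2 * p))) \<partial>lborel)"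
proof -
  obtain M where M: "M > 0" "\<And>(\<phi> :: real^'n \<Rightarrow> real) \<eta> \<alpha> b D. test_function \<phi> \<Longrightarrow> continuous_on UNIV \<eta> \<Longrightarrow> (\<forall>t. \<eta> t \<ge> 0) \<Longrightarrow>
    \<alpha> > 0 \<Longrightarrow> (\<forall>t\<le>\<alpha>. \<eta> t = 0) \<Longrightarrow> (\<forall>t\<ge>b. \<eta> t = 0) \<Longrightarrow> D > 0 \<Longrightarrow> (LINT x|lborel. \<bar>laplacian \<phi> x\<bar> powr p) \<le> D \<Longrightarrow>
    (\<integral>\<^sup>+x. ennreal (\<bar>\<phi> x\<bar> * \<eta> (x \<bullet> x)) \<partial>lborel)
      \<le> ennreal (M * D powr (1 / p)) * (\<integral>\<^sup>+(x::real^'n). ennreal (\<eta> (x \<bullet> x) * (x \<bullet> x) powr (1 - real CARD('n) / (2 * p))) \<partial>lborel)"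
    using radial_test_estimate[OF N p] by blast
  show ?thesis
  \<comment> \<open>The approximants have energy at most 2^p D, and the p-th root of that factor is
    2.\<close>
  proof (rule that[of "2 * M"])
    show "2 * M > 0" using M by simp
    fix u :: "real^'n \<Rightarrow> real" and \<eta> :: "real \<Rightarrow> real" and \<alpha> b D
    assume u: "u \<in> D2p p" and \<eta>: "continuous_on UNIV \<eta>" "\<And>t. \<eta> t \<ge> 0" "\<alpha> > 0"
      "\<And>t. t \<le> \<alpha> \<Longrightarrow> \<eta> t = 0" "\<And>t. t \<ge> b \<Longrightarrow> \<eta> t = 0"
      and D: "(LINT x|lborel. \<bar>weak_laplacian u x\<bar> powr p) < D"
    have "(LINT x|lborel. \<bar>weak_laplacian u x\<bar> powr p) \<ge> 0" by (rule Bochner_Integration.integral_nonneg) simp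
    with D have D0: "D > 0" by linarith
    have [measurable]: "u \<in> borel_measurable borel" using u by (simp add: D2p_def)
    have [measurable]: "\<eta> \<in> borel_measurable borel" using \<eta>(1) by (rule borel_measurable_continuous_onI)
    obtain v where tf: "\<And>k. test_function (v k)" and v: "AE x in lborel. (\<lambda>k. v k x) \<longlonglongrightarrow> u x"
      and vD: "\<And>k. (LINT x|lborel. \<bar>laplacian (v k) x\<bar> powr p) \<le> 2 powr p * D"
      using D2p_approximation(2)[OF u _ N D] p by auto
    have [measurable]: "v k \<in> borel_measurable borel" for k
      using test_function_borel_measurable tf by auto
    have e: "M * (2 powr p * D) powr (1 / p) = 2 * M * D powr (1 / p)"
      using p D0 by (simp add: powr_mult powr_powr)
    show "(\<integral>\<^sup>+x. ennreal (\<bar>u x\<bar> * \<eta> (x \<bullet> x)) \<partial>lborel)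
      \<le> ennreal (2 * M * D powr (1 / p)) * (\<integral>\<^sup>+(x::real^'n). ennreal (\<eta> (x \<bullet> x) * (x \<bullet> x) powr (1 - real CARD('n) / (2 * p))) \<partial>lborel)"
    proof (rule nn_integral_Fatou_bound[of "\<lambda>k x. ennreal (\<bar>v k x\<bar> * \<eta> (x \<bullet> x))"])
      show "(\<integral>\<^sup>+x. ennreal (\<bar>v k x\<bar> * \<eta> (x \<bullet> x)) \<partial>lborel)
        \<le> ennreal (2 * M * D powr (1 / p)) * (\<integral>\<^sup>+(x::real^'n). ennreal (\<eta> (x \<bullet> x) * (x \<bullet> x) powr (1 - real CARD('n) / (2 * p))) \<partial>lborel)" for k
        unfolding e[symmetric] by (rule M(2)[where \<alpha> = \<alpha> and b = b]) (use tf \<eta> vD D0 in auto)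
      show "AE x in lborel. (\<lambda>k. ennreal (\<bar>v k x\<bar> * \<eta> (x \<bullet> x))) \<longlonglongrightarrow> ennreal (\<bar>u x\<bar> * \<eta> (x \<bullet> x))"
        using v by eventually_elim (intro tendsto_intros tendsto_ennrealI)
    qed auto
  qed
qed

section \<open>The pointwise bound for radial functions\<close>

text \<open>A large ball makes the measure finite and keeps it positive; inner regularity then gives
  a closed subset whose complement in the piece has smaller measure than the piece.\<close>

lemma compact_subset_positive_measure:
  fixes S :: "'a::euclidean_space set"
  assumes [measurable]: "S \<in> sets borel" and pos: "emeasure lborel S \<noteq> 0"
  obtains K where "compact K" "K \<subseteq> S" "emeasure lborel K \<noteq> 0"
proof -
  have "\<exists>n::nat. emeasure lborel (S \<inter> cball 0 (real n)) \<noteq> 0"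
  proof (rule ccontr)
    assume "\<not> ?thesis"
    then have "S \<inter> cball 0 (real n) \<in> null_sets lborel" for n by auto
    then have "(\<Union>n. S \<inter> cball 0 (real n)) \<in> null_sets lborel" by (rule null_sets_UN)
    moreover have "(\<Union>n. S \<inter> cball 0 (real n)) = S" using real_arch_simple by auto
    ultimately show False using pos by auto
  qed
  then obtain n :: nat where n: "emeasure lborel (S \<inter> cball 0 (real n)) \<noteq> 0" by blast
  let ?S = "S \<inter> cball 0 (real n)"
  have fin: "emeasure lborel ?S < \<infinity>" by (rule emeasure_bounded_finite) auto
  define m where "m = measure lborel ?S"
  have m: "emeasure lborel ?S = ennreal m" "m > 0"
    using n fin by (auto simp: m_def emeasure_eq_ennreal_measure zero_less_measure_iff top_unique less_top[symmetric])
  have "?S \<in> sets lebesgue" by simp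
  then obtain T where T: "closed T" "T \<subseteq> ?S" "emeasure lebesgue (?S - T) < ennreal m"
    by (rule sets_lebesgue_inner_closed[OF _ m(2)])
  have [measurable]: "T \<in> sets borel" using T(1) by (rule borel_closed)
  have "emeasure lborel (?S - T) < ennreal m" using T(3) by simp
  moreover have "emeasure lborel ?S \<le> emeasure lborel T + emeasure lborel (?S - T)"
  proof -
    have "emeasure lborel ?S = emeasure lborel (T \<union> (?S - T))" using T(2) by (intro arg_cong[of _ _ "emeasure lborel"]) blast
    also have "\<dots> \<le> emeasure lborel T + emeasure lborel (?S - T)" by (rule emeasure_subadditive) auto
    finally show ?thesis .
  qed
  ultimately have "emeasure lborel T \<noteq> 0" using m(1) by (auto simp: not_le[symmetric])
  moreover have "compact T"
    using T(1,2) by (meson bounded_cball bounded_subset compact_eq_bounded_closed le_inf_iff)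
  ultimately show ?thesis using that T(2) by blast
qed

text \<open>A radial profile need not be Borel a priori. The exceptional set of the bound is invariant under
  rotations only up to a null set, so it is replaced by the rotation hull of a compact subset.\<close>

lemma radial_pointwise_bound:
  fixes p :: real
  assumes N: "real CARD('n::finite) > 2 * p" and p: "2 \<le> p"
  obtains M where "M > 0" "\<And>(u :: real^'n \<Rightarrow> real) D. u \<in> D2p p \<Longrightarrow> radial u \<Longrightarrow>
    (LINT x|lborel. \<bar>weak_laplacian u x\<bar> powr p) < D \<Longrightarrow>
    AE x in lborel. \<bar>u x\<bar> \<le> M * D powr (1 / p) * (x \<bullet> x) powr (1 - real CARD('n) / (2 * p))"
proof -
  let ?d = "1 - real CARD('n) / (2 * p)"
  have d: "?d < 0" using N p by (simp add: field_simps)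
  obtain M where M: "M > 0" "\<And>(u :: real^'n \<Rightarrow> real) \<eta> \<alpha> b D. u \<in> D2p p \<Longrightarrow> continuous_on UNIV \<eta> \<Longrightarrow> (\<And>t. \<eta> t \<ge> 0) \<Longrightarrow>
    \<alpha> > 0 \<Longrightarrow> (\<And>t. t \<le> \<alpha> \<Longrightarrow> \<eta> t = 0) \<Longrightarrow> (\<And>t. t \<ge> b \<Longrightarrow> \<eta> t = 0) \<Longrightarrow>
    (LINT x|lborel. \<bar>weak_laplacian u x\<bar> powr p) < D \<Longrightarrow>
    (\<integral>\<^sup>+x. ennreal (\<bar>u x\<bar> * \<eta> (x \<bullet> x)) \<partial>lborel)
      \<le> ennreal (M * D powr (1 / p)) * (\<integral>\<^sup>+(x::real^'n). ennreal (\<eta> (x \<bullet> x) * (x \<bullet> x) powr ?d) \<partial>lborel)"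
    by (rule radial_D2p_estimate[OF N p]) (rule that, assumption, blast)
  show ?thesis
  proof (rule that[OF M(1)], rule ccontr)
    fix u :: "real^'n \<Rightarrow> real" and D
    assume u: "u \<in> D2p p" and "radial u" and D: "(LINT x|lborel. \<bar>weak_laplacian u x\<bar> powr p) < D"
    define L where "L = M * D powr (1 / p)"
    have L: "L \<ge> 0" using M(1) by (simp add: L_def)
    have [measurable]: "u \<in> borel_measurable borel" using u by (simp add: D2p_def)
    assume "\<not> (AE x in lborel. \<bar>u x\<bar> \<le> M * D powr (1 / p) * (x \<bullet> x) powr ?d)"
    then have nAE: "\<not> (AE x in lborel. \<bar>u x\<bar> \<le> L * (x \<bullet> x) powr ?d)" by (simp add: L_def)
    obtain f where f: "AE x in lborel. u x = f (norm x)" using \<open>radial u\<close> by (auto simp: radial_def)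
    then obtain Z where Z: "Z \<in> null_sets lborel" "\<And>x. x \<notin> Z \<Longrightarrow> u x = f (norm x)"
      by (auto simp: eventually_ae_filter)
    have [measurable]: "Z \<in> sets borel" using Z(1) by auto
    \<comment> \<open>Off \<open>Z\<close> the function equals its profile; without the origin the
      squared radii of a compact subset have a positive minimum.\<close>
    define A where "A = {x. L * (x \<bullet> x) powr ?d < \<bar>u x\<bar>} - Z - {0}"
    have [measurable]: "A \<in> sets borel" unfolding A_def by measurable
    have "emeasure lborel A \<noteq> 0"
    proof
      assume "emeasure lborel A = 0"
      then have "A \<in> null_sets lborel" by auto
      then have "AE x in lborel. x \<notin> A" by (rule AE_not_in)
      moreover have "AE x in lborel. x \<notin> Z" using Z(1) by (rule AE_not_in)
      moreover have "AE x in lborel. x \<noteq> (0 :: real^'n)" by (rule AE_lborel_singleton)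
      ultimately have "AE x in lborel. \<bar>u x\<bar> \<le> L * (x \<bullet> x) powr ?d"
        by eventually_elim (auto simp: A_def not_less)
      with nAE show False by contradiction
    qed
    then obtain K where K: "compact K" "K \<subseteq> A" "emeasure lborel K \<noteq> 0"
      by (rule compact_subset_positive_measure[rotated]) auto
    define R where "R = (\<lambda>x. x \<bullet> x) ` K"
    have R: "compact R" unfolding R_def by (intro compact_continuous_image K continuous_intros)
    have K0: "K \<noteq> {}" using K(3) by auto
    then have Rne: "R \<noteq> {}" by (simp add: R_def)
    have Rpos: "t > 0" if "t \<in> R" for t using that K(2) by (auto simp: R_def A_def)
    obtain t0 where t0: "t0 \<in> R" "\<And>t. t \<in> R \<Longrightarrow> t0 \<le> t" using compact_attains_inf[OF R Rne] by blast
    obtain t1 where t1: "t1 \<in> R" "\<And>t. t \<in> R \<Longrightarrow> t \<le> t1" using compact_attains_sup[OF R Rne] by blast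
    have t0pos: "t0 > 0" using Rpos t0 by simp
    \<comment> \<open>The rotation hull of \<open>K\<close>, closed as the preimage of a compact set
      of squared radii. Outside \<open>Z\<close> the bound fails on all of it, since
      \<open>u\<close> depends there on the norm only.\<close>
    define H where "H = {x::real^'n. x \<bullet> x \<in> R}"
    have "closed H"
      unfolding H_def using compact_imp_closed[OF R]
      by (intro closed_vimage[unfolded vimage_def] continuous_intros) auto
    then have [measurable]: "H \<in> sets borel" by (rule borel_closed)
    have KH: "K \<subseteq> H" by (auto simp: H_def R_def)
    have H_bad: "L * (x \<bullet> x) powr ?d < \<bar>u x\<bar>" if "x \<in> H" "x \<notin> Z" for x
    proof -
      obtain y where y: "y \<in> K" "x \<bullet> x = y \<bullet> y" using \<open>x \<in> H\<close> by (auto simp: H_def R_def)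
      then have "norm x = norm y" by (simp add: norm_eq_sqrt_inner)
      moreover have "y \<in> A" using y K(2) by blast
      ultimately show ?thesis using y(2) Z(2)[of x] Z(2)[of y] that by (auto simp: A_def)
    qed
    \<comment> \<open>The value 2 / t0 makes the cut-offs vanish up to t0 / 2, and the value 1 makes
      them vanish from t1 + 1 on, for every \<open>n\<close>; as \<open>n\<close> grows they
      decrease to the indicator of \<open>R\<close>.\<close>
    define c where "c = max 1 (2 / t0)"
    define \<eta> where "\<eta> n t = max 0 (1 - (c + real n) * infdist t R)" for n t
    have \<eta>_cont: "continuous_on UNIV (\<eta> n)" for n
      unfolding \<eta>_def by (intro continuous_intros)
    have [measurable]: "\<eta> n \<in> borel_measurable borel" for n
      using \<eta>_cont by (rule borel_measurable_continuous_onI)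
    have \<eta>_nonneg: "\<eta> n t \<ge> 0" for n t by (simp add: \<eta>_def)
    have \<eta>_le_1: "\<eta> n t \<le> 1" for n t
      using infdist_nonneg[of t R] by (simp add: \<eta>_def c_def)
    have \<eta>_R: "\<eta> n t = 1" if "t \<in> R" for n t using that by (simp add: \<eta>_def)
    have infdist_ge: "infdist t R \<ge> e" if "\<And>s. s \<in> R \<Longrightarrow> dist t s \<ge> e" for t e
      using that Rne by (auto simp: infdist_def intro!: cINF_greatest)
    have \<eta>_0: "\<eta> n t = 0" if "infdist t R \<ge> e" "c * e \<ge> 1" "e \<ge> 0" for n t e
    proof -
      have "1 \<le> c * e" by fact
      also have "\<dots> \<le> (c + real n) * infdist t R"
        using that infdist_nonneg[of t R] by (intro mult_mono) (auto simp: c_def)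
      finally show ?thesis by (simp add: \<eta>_def)
    qed
    have \<eta>_low: "\<eta> n t = 0" if "t \<le> t0 / 2" for n t
    proof (rule \<eta>_0)
      show "infdist t R \<ge> t0 / 2" 
      proof (rule infdist_ge)
        fix s assume "s \<in> R"
        then show "t0 / 2 \<le> dist t s" using t0(2)[of s] \<open>t \<le> t0 / 2\<close> by (simp add: dist_real_def abs_if)
      qed
      have "2 / t0 \<le> c" by (simp add: c_def)
      then show "1 \<le> c * (t0 / 2)" using t0pos by (simp add: field_simps)
    qed (use t0pos in simp)
    have \<eta>_high: "\<eta> n t = 0" if "t \<ge> t1 + 1" for n t
    proof (rule \<eta>_0)
      show "infdist t R \<ge> 1" 
      proof (rule infdist_ge)
        fix s assume "s \<in> R"
        then show "1 \<le> dist t s" using t1(2)[of s] \<open>t \<ge> t1 + 1\<close> by (simp add: dist_real_def abs_if)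
      qed
    qed (auto simp: c_def)
    have \<eta>_lim: "(\<lambda>n. \<eta> n t) \<longlonglongrightarrow> indicator R t" for t
    proof (cases "t \<in> R")
      case False
      then have pos: "infdist t R > 0" using infdist_pos_not_in_closed[OF compact_imp_closed[OF R] Rne] by simp
      have "\<forall>\<^sub>F n in sequentially. \<eta> n t = 0"
        using eventually_ge_at_top[of "nat \<lceil>1 / infdist t R\<rceil>"]
      proof eventually_elim
        case (elim n)
        then have "1 / infdist t R \<le> real n" by linarith
        then have "1 \<le> real n * infdist t R" using pos by (simp add: field_simps)
        also have "\<dots> \<le> (c + real n) * infdist t R" using pos by (intro mult_right_mono) (auto simp: c_def)
        finally show ?case by (simp add: \<eta>_def)
      qed
      then show ?thesis using False by (simp add: tendsto_eventually)
    qed (simp add: \<eta>_R)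
    let ?I = "\<lambda>n. \<integral>\<^sup>+(x::real^'n). ennreal (\<eta> n (x \<bullet> x) * (x \<bullet> x) powr ?d) \<partial>lborel"
    let ?J = "\<integral>\<^sup>+(x::real^'n). ennreal (indicator R (x \<bullet> x) * (x \<bullet> x) powr ?d) \<partial>lborel"
    let ?w = "\<lambda>x::real^'n. ennreal ((t0 / 2) powr ?d) * indicator (cball 0 (sqrt (t1 + 1))) x"
    have t1pos: "t1 > 0" using Rpos t1 by simp
    have w_fin: "integral\<^sup>N lborel ?w < \<infinity>"
      using t1pos by (simp add: nn_integral_cmult_indicator emeasure_cball ennreal_mult_less_top)
    have w_bound: "ennreal (\<eta> n (x \<bullet> x) * (x \<bullet> x) powr ?d) \<le> ?w x" for n and x :: "real^'n"
    proof (cases "x \<bullet> x \<le> t0 / 2 \<or> x \<bullet> x \<ge> t1 + 1")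
      case True
      then show ?thesis using \<eta>_low \<eta>_high by auto
    next
      case False
      then have "norm x \<le> sqrt (t1 + 1)" by (simp add: norm_eq_sqrt_inner)
      moreover have "(x \<bullet> x) powr ?d \<le> (t0 / 2) powr ?d"
        using False t0pos d by (intro powr_mono2') auto
      then have "\<eta> n (x \<bullet> x) * (x \<bullet> x) powr ?d \<le> 1 * (t0 / 2) powr ?d"
        by (intro mult_mono \<eta>_le_1) auto
      ultimately show ?thesis by (simp add: ennreal_leI)
    qed
    have [measurable]: "R \<in> sets borel" using compact_imp_closed[OF R] by (rule borel_closed)
    have [measurable]: "(\<lambda>x::real^'n. x \<bullet> x) \<in> borel_measurable borel" by (intro borel_measurable_continuous_onI continuous_intros)
    have pm[measurable]: "(\<lambda>x::real^'n. (x \<bullet> x) powr ?d) \<in> borel_measurable borel" by measurable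
    have m1: "(\<lambda>x::real^'n. ennreal (\<eta> n (x \<bullet> x) * (x \<bullet> x) powr ?d)) \<in> borel_measurable lborel" for n
      by measurable
    have m2: "(\<lambda>x::real^'n. ennreal (indicator R (x \<bullet> x) * (x \<bullet> x) powr ?d)) \<in> borel_measurable lborel"
      by measurable
    have m3: "?w \<in> borel_measurable lborel"
      by (rule borel_measurable_times_ennreal[OF borel_measurable_const borel_measurable_indicator]) simp
    have I_lim: "?I \<longlonglongrightarrow> ?J"
    proof (rule nn_integral_dominated_convergence[where w = ?w])
      show "AE x in lborel. (\<lambda>n. ennreal (\<eta> n (x \<bullet> x) * (x \<bullet> x) powr ?d)) \<longlonglongrightarrow> ennreal (indicator R (x \<bullet> x) * (x \<bullet> x) powr ?d)"
        by (intro AE_I2 tendsto_ennrealI tendsto_mult \<eta>_lim tendsto_const)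
      show "AE x in lborel. ennreal (\<eta> n (x \<bullet> x) * (x \<bullet> x) powr ?d) \<le> ?w x" for n
        by (intro AE_I2 w_bound)
      show "integral\<^sup>N lborel ?w < \<infinity>" by (rule w_fin)
    qed (rule m1 m2 m3)+
    have J_fin: "?J < \<infinity>"
    proof -
      have "?J \<le> integral\<^sup>N lborel ?w"
      proof (rule nn_integral_mono)
        fix x :: "real^'n"
        have "ennreal (indicator R (x \<bullet> x) * (x \<bullet> x) powr ?d) \<le> ennreal (\<eta> 0 (x \<bullet> x) * (x \<bullet> x) powr ?d)"
          using \<eta>_nonneg by (intro ennreal_leI mult_right_mono) (auto simp: indicator_def \<eta>_R)
        also note w_bound[of 0 x]
        finally show "ennreal (indicator R (x \<bullet> x) * (x \<bullet> x) powr ?d) \<le> ?w x" .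
      qed
      with w_fin show ?thesis by simp
    qed
    let ?U = "\<integral>\<^sup>+x. ennreal (\<bar>u x\<bar> * indicator R (x \<bullet> x)) \<partial>lborel"
    have "?U \<le> ennreal L * ?I n" for n
    proof -
      have "?U \<le> (\<integral>\<^sup>+x. ennreal (\<bar>u x\<bar> * \<eta> n (x \<bullet> x)) \<partial>lborel)"
        using \<eta>_nonneg by (intro nn_integral_mono ennreal_leI mult_left_mono) (auto simp: indicator_def \<eta>_R)
      also have "\<dots> \<le> ennreal L * ?I n"
        unfolding L_def
        by (rule M(2)[OF u \<eta>_cont \<eta>_nonneg, of "t0 / 2" n "t1 + 1"]) (use \<eta>_low \<eta>_high t0pos D in auto)
      finally show ?thesis .
    qed
    moreover have "(\<lambda>n. ennreal L * ?I n) \<longlonglongrightarrow> ennreal L * ?J"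
      by (rule ennreal_tendsto_cmult[OF _ I_lim]) simp
    ultimately have U_le: "?U \<le> ennreal L * ?J"
      by (intro LIMSEQ_le_const) auto
    have LJ: "ennreal L * ?J = (\<integral>\<^sup>+(x::real^'n). ennreal (L * (x \<bullet> x) powr ?d * indicator R (x \<bullet> x)) \<partial>lborel)"
      using L by (subst nn_integral_cmult[symmetric]) (auto simp: ennreal_mult''[symmetric] mult_ac)
    \<comment> \<open>Integrating the failed bound over \<open>H\<close>, a set of positive measure,
      gives a strict inequality because the smaller integral is finite; it contradicts
      \<open>U_le\<close>.\<close>
    have "ennreal L * ?J < ?U"
      unfolding LJ
    proof (rule nn_integral_less)
      show "(\<integral>\<^sup>+(x::real^'n). ennreal (L * (x \<bullet> x) powr ?d * indicator R (x \<bullet> x)) \<partial>lborel) \<noteq> \<infinity>"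
        using J_fin unfolding LJ[symmetric] by (simp add: ennreal_mult_eq_top_iff)
      have "AE x in lborel. x \<notin> Z" using Z(1) by (rule AE_not_in)
      then show "AE x in lborel. ennreal (L * (x \<bullet> x) powr ?d * indicator R (x \<bullet> x)) \<le> ennreal (\<bar>u x\<bar> * indicator R (x \<bullet> x))"
        by eventually_elim (use H_bad in \<open>force simp: H_def indicator_def intro!: ennreal_leI\<close>)
      show "\<not> (AE x in lborel. ennreal (\<bar>u x\<bar> * indicator R (x \<bullet> x)) \<le> ennreal (L * (x \<bullet> x) powr ?d * indicator R (x \<bullet> x)))"
      proof
        assume "AE x in lborel. ennreal (\<bar>u x\<bar> * indicator R (x \<bullet> x)) \<le> ennreal (L * (x \<bullet> x) powr ?d * indicator R (x \<bullet> x))"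
        moreover have "AE x in lborel. x \<notin> Z" using Z(1) by (rule AE_not_in)
        ultimately have "AE x in lborel. x \<notin> H"
        proof eventually_elim
          case (elim x)
          show ?case
          proof
            assume x: "x \<in> H"
            then have "\<bar>u x\<bar> \<le> L * (x \<bullet> x) powr ?d" using elim(1) L by (simp add: H_def ennreal_le_iff)
            then show False using H_bad[OF x elim(2)] by simp
          qed
        qed
        then have "H \<in> null_sets lborel" by (subst AE_iff_null_sets) auto
        moreover have "K \<in> sets lborel" using compact_imp_closed[OF K(1)] by simp
        ultimately have "K \<in> null_sets lborel" using null_sets_subset KH by blast
        then show False using K(3) by auto
      qed
    qed auto
    then show False using U_le by simp
  qed
qed

section \<open>Comparison of the two infima\<close>

text \<open>Split |u|^q into |u|^p and |u|^(q-p) and apply the pointwise bound to the second factor: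
  \<open>weight_exponent\<close> is exactly the exponent for which the remaining weight is that of
  the Hardy integral.\<close>

lemma radial_lower_bound:
  fixes p q :: real
  assumes N: "real CARD('n::finite) > 2 * p" and p: "2 \<le> p" and q: "p < q"
  obtains c where "c > 0" "\<And>\<mu> (u :: real^'n \<Rightarrow> real). \<mu> > 0 \<Longrightarrow> u \<in> D2p_nonzero p \<Longrightarrow> radial u \<Longrightarrow>
    c * \<mu> powr (p / q) \<le> Q p q (- \<mu>) u"
proof -
  let ?N = "real CARD('n)"
  let ?d = "1 - ?N / (2 * p)"
  let ?\<beta> = "weight_exponent ?N p q"
  obtain M where M: "M > 0" "\<And>(u :: real^'n \<Rightarrow> real) D. u \<in> D2p p \<Longrightarrow> radial u \<Longrightarrow>
    (LINT x|lborel. \<bar>weak_laplacian u x\<bar> powr p) < D \<Longrightarrow>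
    AE x in lborel. \<bar>u x\<bar> \<le> M * D powr (1 / p) * (x \<bullet> x) powr ?d"
    by (rule radial_pointwise_bound[OF N p]) (rule that, assumption, blast)
  define t where "t = p / q"
  have t: "0 < t" "t < 1" using p q by (auto simp: t_def)
  \<comment> \<open>Cancels the power of \<open>M\<close> in the estimate \<open>Et\<close>.\<close>
  define c where "c = M powr (- (q - p) * t)"
  show ?thesis
  proof (rule that)
    show "c > 0" using M(1) by (simp add: c_def)
    fix \<mu> :: real and u :: "real^'n \<Rightarrow> real"
    assume \<mu>: "\<mu> > 0" and "u \<in> D2p_nonzero p" and rad: "radial u"
    then have u: "u \<in> D2p p" and nz: "\<not> (AE x in lborel. u x = 0)" by (auto simp: D2p_nonzero_def)
    have [measurable]: "u \<in> borel_measurable borel" using u by (simp add: D2p_def)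
    define D where "D = (LINT x|lborel. \<bar>weak_laplacian u x\<bar> powr p)"
    define H where "H = (LINT x|lborel. norm x powr (- 2 * p) * \<bar>u x\<bar> powr p)"
    define E where "E = (LINT x|lborel. norm x powr (- ?\<beta>) * \<bar>u x\<bar> powr q)"
    have iH: "integrable lborel (\<lambda>x. norm x powr (- 2 * p) * \<bar>u x\<bar> powr p)"
      by (rule Rellich_D2p[OF N p u])
    have D0: "D \<ge> 0" and H0: "H \<ge> 0"
      unfolding D_def H_def by (intro Bochner_Integration.integral_nonneg mult_nonneg_nonneg powr_ge_zero)+
    \<comment> \<open>The pointwise bound asks for a strict upper bound D' of the energy. Letting D'
      decrease to D afterwards keeps the estimate homogeneous in \<open>u\<close>.\<close>
    have bound: "AE x in lborel. norm x powr (- ?\<beta>) * \<bar>u x\<bar> powr q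
        \<le> (M * D' powr (1 / p)) powr (q - p) * (norm x powr (- 2 * p) * \<bar>u x\<bar> powr p)" if "D' > D" for D'
    proof -
      have "AE x in lborel. \<bar>u x\<bar> \<le> M * D' powr (1 / p) * (x \<bullet> x) powr ?d"
        using M(2)[OF u rad] that unfolding D_def by simp
      moreover have "AE x in lborel. x \<noteq> (0 :: real^'n)" by (rule AE_lborel_singleton)
      ultimately show ?thesis
      proof eventually_elim
        case (elim x)
        have "\<bar>u x\<bar> powr (q - p) \<le> (M * D' powr (1 / p) * (x \<bullet> x) powr ?d) powr (q - p)"
          using elim(1) q by (intro powr_mono2) auto
        also have "\<dots> = (M * D' powr (1 / p)) powr (q - p) * norm x powr (2 * ?d * (q - p))"
        proof -
          have n: "norm x powr (2 * ?d * (q - p)) = (x \<bullet> x) powr (?d * (q - p))"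
            unfolding norm_powr_eq by (rule arg_cong[where f = "\<lambda>e. (x \<bullet> x) powr e"]) simp
          show ?thesis unfolding n using M(1) by (simp add: powr_mult powr_powr)
        qed
        finally have *: "\<bar>u x\<bar> powr (q - p) \<le> (M * D' powr (1 / p)) powr (q - p) * norm x powr (2 * ?d * (q - p))" .
        have ex: "- ?\<beta> + 2 * ?d * (q - p) = - 2 * p"
          using p by (simp add: weight_exponent_def field_simps)
        have "norm x powr (- ?\<beta>) * \<bar>u x\<bar> powr q = norm x powr (- ?\<beta>) * \<bar>u x\<bar> powr p * \<bar>u x\<bar> powr (q - p)"
          by (simp add: powr_add[symmetric] mult.assoc)
        also have "\<dots> \<le> norm x powr (- ?\<beta>) * \<bar>u x\<bar> powr p * ((M * D' powr (1 / p)) powr (q - p) * norm x powr (2 * ?d * (q - p)))"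
          by (intro mult_left_mono *) auto
        also have "\<dots> = (M * D' powr (1 / p)) powr (q - p) * (norm x powr (- ?\<beta> + 2 * ?d * (q - p)) * \<bar>u x\<bar> powr p)"
          by (simp only: powr_add mult_ac)
        finally show ?case unfolding ex .
      qed
    qed
    have iE: "integrable lborel (\<lambda>x. norm x powr (- ?\<beta>) * \<bar>u x\<bar> powr q)"
    proof (rule Bochner_Integration.integrable_bound)
      show "integrable lborel (\<lambda>x. (M * (D + 1) powr (1 / p)) powr (q - p) * (norm x powr (- 2 * p) * \<bar>u x\<bar> powr p))"
        using iH by (rule integrable_mult_right)
      show "AE x in lborel. norm (norm x powr (- ?\<beta>) * \<bar>u x\<bar> powr q)
          \<le> norm ((M * (D + 1) powr (1 / p)) powr (q - p) * (norm x powr (- 2 * p) * \<bar>u x\<bar> powr p))"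
        using bound[of "D + 1"] by simp
    qed measurable
    \<comment> \<open>This excludes a degenerate quotient, as division by 0 gives 0. Integrability
      is essential here: the integral of a non-integrable function would be 0 as well.\<close>
    have "E \<noteq> 0"
    proof
      assume "E = 0"
      then have "AE x in lborel. norm x powr (- ?\<beta>) * \<bar>u x\<bar> powr q = 0"
        unfolding E_def using iE by (subst (asm) integral_nonneg_eq_0_iff_AE) auto
      moreover have "AE x in lborel. x \<noteq> (0 :: real^'n)" by (rule AE_lborel_singleton)
      ultimately have "AE x in lborel. u x = 0" by eventually_elim simp
      with nz show False by contradiction
    qed
    moreover have "E \<ge> 0"
      unfolding E_def by (intro Bochner_Integration.integral_nonneg mult_nonneg_nonneg powr_ge_zero)
    ultimately have E: "E > 0" by simp
    have "E \<le> (M * D' powr (1 / p)) powr (q - p) * H" if "D' > D" for D'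
    proof -
      have "E \<le> (LINT x|lborel. (M * D' powr (1 / p)) powr (q - p) * (norm x powr (- 2 * p) * \<bar>u x\<bar> powr p))"
        unfolding E_def by (rule integral_mono_AE[OF iE integrable_mult_right[OF iH] bound[OF that]])
      then show ?thesis by (simp add: H_def)
    qed
    then have ev: "\<forall>\<^sub>F D' in at_right D. E \<le> (M * D' powr (1 / p)) powr (q - p) * H"
      using eventually_at_right_less by (rule eventually_mono[rotated])
    have "((\<lambda>D'. D' powr (1 / p)) \<longlongrightarrow> D powr (1 / p)) (at_right D)"
      using p D0 by (intro tendsto_powr2 tendsto_ident_at tendsto_const)
        (auto intro!: eventually_mono[OF eventually_at_right_less])
    then have "((\<lambda>D'. (M * D' powr (1 / p)) powr (q - p) * H) \<longlongrightarrow> (M * D powr (1 / p)) powr (q - p) * H) (at_right D)"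
      by (intro tendsto_mult[OF tendsto_powr2[OF tendsto_mult[OF tendsto_const] tendsto_const] tendsto_const])
        (use q M(1) in auto)
    then have E_le: "E \<le> (M * D powr (1 / p)) powr (q - p) * H"
      using ev by (rule tendsto_lowerbound) simp
    have Dpos: "D > 0" and Hpos: "H > 0"
      using E E_le D0 H0 q p by (cases "D = 0"; cases "H = 0"; auto)+
    have "E powr t \<le> ((M * D powr (1 / p)) powr (q - p) * H) powr t"
      using E E_le t by (intro powr_mono2) auto
    also have "\<dots> = M powr ((q - p) * t) * (D powr (1 / p * (q - p) * t) * H powr t)"
      using M(1) Dpos Hpos by (simp add: powr_mult powr_powr mult.assoc)
    \<comment> \<open>The powers of D and H add up to 1, so that D and \<mu> H can both be replaced
      by their sum \<open>X\<close>.\<close>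
    also have "1 / p * (q - p) * t = 1 - t" using p q by (simp add: t_def field_simps)
    finally have Et: "E powr t \<le> M powr ((q - p) * t) * (D powr (1 - t) * H powr t)" .
    define X where "X = D + \<mu> * H"
    have X: "X > 0" "D \<le> X" "\<mu> * H \<le> X" using Dpos Hpos \<mu> by (auto simp: X_def add_pos_pos)
    have "c * \<mu> powr t * E powr t \<le> c * \<mu> powr t * (M powr ((q - p) * t) * (D powr (1 - t) * H powr t))"
      by (intro mult_left_mono Et) (simp add: c_def)
    also have "\<dots> = (c * M powr ((q - p) * t)) * (D powr (1 - t) * (\<mu> * H) powr t)"
      using \<mu> Hpos by (simp add: powr_mult mult_ac)
    also have "c * M powr ((q - p) * t) = 1"
      using M(1) by (simp add: c_def powr_add[symmetric] algebra_simps)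
    also have "1 * (D powr (1 - t) * (\<mu> * H) powr t) \<le> X powr (1 - t) * X powr t"
      using X Dpos Hpos \<mu> t by (simp, intro mult_mono powr_mono2) auto
    also have "\<dots> = X" using X by (simp add: powr_add[symmetric])
    finally have "c * \<mu> powr t \<le> X / E powr t" using E by (simp add: pos_le_divide_eq)
    then show "c * \<mu> powr (p / q) \<le> Q p q (- \<mu>) u"
      by (simp add: Q_def D_def H_def E_def X_def t_def)
  qed
qed

text \<open>For \<mu> = \<epsilon>^(-2p) the energy of a bump of radius \<epsilon> and \<mu> times
  its Hardy integral both scale like \<epsilon>^(N-2p); this balance dictates the radius. The
  weighted integral in the denominator scales like \<epsilon>^N.\<close>

lemma concentrated_upper_bound:
  fixes p q :: real
  assumes N: "real CARD('n::finite) > 2 * p" and p: "2 \<le> p" and q: "p < q" "q < crit_exponent (real CARD('n)) p"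
  obtains K where "\<And>\<epsilon>. 0 < \<epsilon> \<Longrightarrow> \<epsilon> \<le> 1 \<Longrightarrow> \<exists>u :: real^'n \<Rightarrow> real. u \<in> D2p_nonzero p \<and>
    Q p q (- (\<epsilon> powr (- 2 * p))) u \<le> K * \<epsilon> powr (real CARD('n) - 2 * p - real CARD('n) * p / q)"
proof -
  let ?N = "real CARD('n)"
  let ?\<beta> = "weight_exponent ?N p q"
  let ?b = "bump :: real^'n \<Rightarrow> real"
  \<comment> \<open>Subcriticality of \<open>q\<close> means a positive weight exponent, so the
    weight decreases with the norm and its value at distance 3 bounds it from below on the
    bumps.\<close>
  have \<beta>: "?\<beta> > 0"
  proof -
    have "q * (?N - 2 * p) < ?N * p"
      using q(2) N by (simp add: crit_exponent_def pos_less_divide_eq)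
    then show ?thesis using p by (simp add: weight_exponent_def field_simps)
  qed
  have sm: "smooth ?b" by (rule smooth_bump)
  have [measurable]: "?b \<in> borel_measurable borel" "laplacian ?b \<in> borel_measurable borel"
    using test_function_borel_measurable[OF test_function_bump] by auto
  define A where "A = (LINT x|lborel. \<bar>laplacian ?b x\<bar> powr p)"
  define B where "B = (LINT x|lborel. \<bar>?b x\<bar> powr p)"
  define C where "C = 3 powr (- ?\<beta>) * (LINT x|lborel. \<bar>?b x\<bar> powr q)"
  have ib: "integrable lborel (\<lambda>x. \<bar>?b x\<bar> powr r)" if "r > 0" for r
    using that by (intro continuous_zero_outside_integrable[of _ 1])
      (auto intro!: continuous_intros continuous_on_powr' smooth_continuous_on[OF sm] simp: bump_eq_0)
  have "(LINT x|lborel. \<bar>?b x\<bar> powr q) \<noteq> 0"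
  proof
    assume "(LINT x|lborel. \<bar>?b x\<bar> powr q) = 0"
    then have "AE x in lborel. \<bar>?b x\<bar> powr q = 0"
      using ib[of q] p q by (subst (asm) integral_nonneg_eq_0_iff_AE) auto
    then have "AE x in lborel. ?b (1 *\<^sub>R (x - 0)) = 0" by eventually_elim simp
    then show False using bump_affine_nonzero[of 1 "0 :: real^'n"] by simp
  qed
  moreover have "(LINT x|lborel. \<bar>?b x\<bar> powr q) \<ge> 0" by (rule Bochner_Integration.integral_nonneg) simp
  ultimately have "(LINT x|lborel. \<bar>?b x\<bar> powr q) > 0" by linarith
  then have C: "C > 0" unfolding C_def by (rule mult_pos_pos[rotated]) simp
  have A: "A \<ge> 0" and B: "B \<ge> 0" unfolding A_def B_def by (rule Bochner_Integration.integral_nonneg, simp)+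
  show ?thesis
  proof (rule that[of "(A + B) / C powr (p / q)"])
    fix \<epsilon> :: real assume \<epsilon>: "0 < \<epsilon>" "\<epsilon> \<le> 1"
    obtain i :: 'n where True by simp
    \<comment> \<open>With the centre at distance 2 and radius at most 1, the support stays in the
      shell 1 \<le> |x| \<le> 3, where both weights lie between positive constants.\<close>
    define c :: "real^'n" where "c = 2 *\<^sub>R axis i 1"
    have c: "norm c = 2" by (simp add: c_def)
    define u where "u y = ?b (inverse \<epsilon> *\<^sub>R (y - c))" for y
    have tf: "test_function u" unfolding u_def[abs_def] by (rule test_function_bump_affine) (use \<epsilon> in simp)
    have unz: "u \<in> D2p_nonzero p" unfolding u_def[abs_def] by (rule bump_affine_in_D2p_nonzero) (use \<epsilon> in simp)
    have u: "u (c + \<epsilon> *\<^sub>R x) = ?b x" for x using \<epsilon> by (simp add: u_def)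
    have lap: "laplacian u (c + \<epsilon> *\<^sub>R x) = (inverse \<epsilon>)\<^sup>2 * laplacian ?b x" for x
      unfolding u_def[abs_def] using laplacian_affine[OF sm, of "inverse \<epsilon>" c "c + \<epsilon> *\<^sub>R x"] \<epsilon> by simp
    have [measurable]: "u \<in> borel_measurable borel" "laplacian u \<in> borel_measurable borel"
      using test_function_borel_measurable[OF tf] by auto
    have wm: "weak_laplacian u \<in> borel_measurable borel"
      by (rule weak_laplacian_borel_measurable[OF has_weak_laplacian_test_function[OF tf]])
    have eN: "\<bar>\<epsilon>\<bar> ^ DIM(real^'n) = \<epsilon> powr ?N" using \<epsilon> by (simp add: powr_realpow)
    have range: "1 \<le> norm (c + \<epsilon> *\<^sub>R x)" "norm (c + \<epsilon> *\<^sub>R x) \<le> 3" if "norm x < 1" for x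
    proof -
      have "norm (\<epsilon> *\<^sub>R x) \<le> 1" using \<epsilon> that by (simp add: mult_le_one)
      then show "1 \<le> norm (c + \<epsilon> *\<^sub>R x)" "norm (c + \<epsilon> *\<^sub>R x) \<le> 3"
        using norm_triangle_ineq[of c "\<epsilon> *\<^sub>R x"] norm_diff_ineq[of c "\<epsilon> *\<^sub>R x"] c by auto
    qed
    have D: "(LINT x|lborel. \<bar>weak_laplacian u x\<bar> powr p) = \<epsilon> powr (?N - 2 * p) * A"
    proof -
      have "(LINT x|lborel. \<bar>weak_laplacian u x\<bar> powr p) = (LINT x|lborel. \<bar>laplacian u x\<bar> powr p)"
      proof (rule integral_cong_AE)
        show "AE x in lborel. \<bar>weak_laplacian u x\<bar> powr p = \<bar>laplacian u x\<bar> powr p"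
          using weak_laplacian_test_function[OF tf] by eventually_elim simp
      qed (use wm in measurable)
      also have "\<dots> = \<epsilon> powr ?N * (LINT x|lborel. \<bar>laplacian u (c + \<epsilon> *\<^sub>R x)\<bar> powr p)"
        unfolding eN[symmetric] using \<epsilon> by (intro integral_lborel_affine) auto
      also have "(\<lambda>x. \<bar>laplacian u (c + \<epsilon> *\<^sub>R x)\<bar> powr p) = (\<lambda>x. \<epsilon> powr (- 2 * p) * \<bar>laplacian ?b x\<bar> powr p)"
      proof
        fix x
        have "((inverse \<epsilon>)\<^sup>2) powr p = \<epsilon> powr (- 2 * p)"
          using \<epsilon> by (simp add: powr_minus inverse_powr power_inverse powr_powr[symmetric] powr_numeral)
        then show "\<bar>laplacian u (c + \<epsilon> *\<^sub>R x)\<bar> powr p = \<epsilon> powr (- 2 * p) * \<bar>laplacian ?b x\<bar> powr p"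
          unfolding lap by (simp add: abs_mult powr_mult)
      qed
      finally show ?thesis by (simp add: A_def powr_add[symmetric] mult.assoc[symmetric])
    qed
    have H: "(LINT x|lborel. norm x powr (- 2 * p) * \<bar>u x\<bar> powr p) \<le> \<epsilon> powr ?N * B"
    proof -
      have "(LINT x|lborel. norm x powr (- 2 * p) * \<bar>u x\<bar> powr p)
         = \<epsilon> powr ?N * (LINT x|lborel. norm (c + \<epsilon> *\<^sub>R x) powr (- 2 * p) * \<bar>?b x\<bar> powr p)"
        unfolding eN[symmetric] u[symmetric] using \<epsilon> by (intro integral_lborel_affine) auto
      also have "(LINT x|lborel. norm (c + \<epsilon> *\<^sub>R x) powr (- 2 * p) * \<bar>?b x\<bar> powr p) \<le> B"
        unfolding B_def
      proof (rule integral_mono')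
        show "norm (c + \<epsilon> *\<^sub>R x) powr (- 2 * p) * \<bar>?b x\<bar> powr p \<le> \<bar>?b x\<bar> powr p" for x
        proof (cases "norm x < 1")
          case True
          have "norm (c + \<epsilon> *\<^sub>R x) powr (- 2 * p) \<le> norm (c + \<epsilon> *\<^sub>R x) powr 0"
            using range(1)[OF True] p by (intro powr_mono) auto
          also have "\<dots> \<le> 1" by simp
          finally show ?thesis by (intro mult_left_le_one_le) auto
        qed (simp add: bump_eq_0)
      qed (use ib[of p] p in auto)
      finally show ?thesis by (simp add: mult_left_mono)
    qed
    have E: "\<epsilon> powr ?N * C \<le> (LINT x|lborel. norm x powr (- ?\<beta>) * \<bar>u x\<bar> powr q)"
    proof -
      have "C = (LINT x|lborel. 3 powr (- ?\<beta>) * \<bar>?b x\<bar> powr q)" by (simp add: C_def)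
      also have "\<dots> \<le> (LINT x|lborel. norm (c + \<epsilon> *\<^sub>R x) powr (- ?\<beta>) * \<bar>?b x\<bar> powr q)"
      proof (rule integral_mono)
        show "integrable lborel (\<lambda>x. norm (c + \<epsilon> *\<^sub>R x) powr (- ?\<beta>) * \<bar>?b x\<bar> powr q)"
        proof (rule Bochner_Integration.integrable_bound[OF ib[of q]])
          show "AE x in lborel. norm (norm (c + \<epsilon> *\<^sub>R x) powr (- ?\<beta>) * \<bar>?b x\<bar> powr q) \<le> norm (\<bar>?b x\<bar> powr q)"
          proof (rule AE_I2)
            fix x
            show "norm (norm (c + \<epsilon> *\<^sub>R x) powr (- ?\<beta>) * \<bar>?b x\<bar> powr q) \<le> norm (\<bar>?b x\<bar> powr q)"
            proof (cases "norm x < 1")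
              case True
              have "norm (c + \<epsilon> *\<^sub>R x) powr (- ?\<beta>) \<le> norm (c + \<epsilon> *\<^sub>R x) powr 0"
                using range(1)[OF True] \<beta> by (intro powr_mono) auto
              also have "\<dots> \<le> 1" by simp
              finally show ?thesis by (simp add: abs_mult mult_left_le_one_le)
            qed (simp add: bump_eq_0)
          qed
        qed (use p q in auto)
        show "3 powr (- ?\<beta>) * \<bar>?b x\<bar> powr q \<le> norm (c + \<epsilon> *\<^sub>R x) powr (- ?\<beta>) * \<bar>?b x\<bar> powr q" for x
        proof (cases "norm x < 1")
          case True
          have "3 powr (- ?\<beta>) \<le> norm (c + \<epsilon> *\<^sub>R x) powr (- ?\<beta>)"
            using range[OF True] \<beta> by (intro powr_mono2') auto
          then show ?thesis by (rule mult_right_mono) simp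
        qed (simp add: bump_eq_0)
      qed (use ib[of q] p q in auto)
      finally have "\<epsilon> powr ?N * C \<le> \<epsilon> powr ?N * (LINT x|lborel. norm (c + \<epsilon> *\<^sub>R x) powr (- ?\<beta>) * \<bar>?b x\<bar> powr q)"
        by (rule mult_left_mono) simp
      also have "\<dots> = (LINT x|lborel. norm x powr (- ?\<beta>) * \<bar>u x\<bar> powr q)"
        unfolding eN[symmetric] u[symmetric] using \<epsilon> by (intro integral_lborel_affine[symmetric]) auto
      finally show ?thesis .
    qed
    have "Q p q (- (\<epsilon> powr (- 2 * p))) u \<le> (\<epsilon> powr (?N - 2 * p) * (A + B)) / (\<epsilon> powr ?N * C) powr (p / q)"
      unfolding Q_def
    proof (rule frac_le)
      have "\<epsilon> powr (- 2 * p) * (LINT x|lborel. norm x powr (- 2 * p) * \<bar>u x\<bar> powr p) \<le> \<epsilon> powr (- 2 * p) * (\<epsilon> powr ?N * B)"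
        by (rule mult_left_mono[OF H]) simp
      also have "\<dots> = \<epsilon> powr (?N - 2 * p) * B"
        by (simp add: powr_add[symmetric] mult.assoc[symmetric])
      finally show "(LINT x|lborel. \<bar>weak_laplacian u x\<bar> powr p)
          - - (\<epsilon> powr (- 2 * p)) * (LINT x|lborel. norm x powr (- 2 * p) * \<bar>u x\<bar> powr p) \<le> \<epsilon> powr (?N - 2 * p) * (A + B)"
        unfolding D by (simp add: distrib_left)
      show "0 < (\<epsilon> powr ?N * C) powr (p / q)" using \<epsilon> C by simp
      show "(\<epsilon> powr ?N * C) powr (p / q) \<le> (LINT x|lborel. norm x powr (- ?\<beta>) * \<bar>u x\<bar> powr q) powr (p / q)"
        using E p q C \<epsilon> by (intro powr_mono2) auto
      show "0 \<le> \<epsilon> powr (?N - 2 * p) * (A + B)" using A B by simp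
    qed
    also have "\<dots> = (A + B) / C powr (p / q) * \<epsilon> powr (?N - 2 * p - ?N * p / q)"
      using \<epsilon> C by (simp add: powr_mult powr_powr powr_diff mult_ac)
    finally show "\<exists>u :: real^'n \<Rightarrow> real. u \<in> D2p_nonzero p \<and>
      Q p q (- (\<epsilon> powr (- 2 * p))) u \<le> (A + B) / C powr (p / q) * \<epsilon> powr (?N - 2 * p - ?N * p / q)"
      using unz by blast
  qed
qed

theorem theorem3p2:
  fixes p q :: real
  assumes "real CARD('n::finite) > 2 * p"
    and "2 \<le> p" and "p < q" and "q < crit_exponent (real CARD('n)) p"
  shows "\<exists>lam0 :: real. \<forall>lam < lam0. lam < rellich_gamma (real CARD('n)) p powr p \<longrightarrow>
    S TYPE('n) p q lam < S_rad TYPE('n) p q lam \<and>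
    (\<forall>u :: real^'n \<Rightarrow> real. extremal p q lam u \<longrightarrow> \<not> radial u)"
proof -
  let ?N = "real CARD('n)"
  obtain c where c: "c > 0" "\<And>\<mu> (u :: real^'n \<Rightarrow> real). \<mu> > 0 \<Longrightarrow> u \<in> D2p_nonzero p \<Longrightarrow> radial u \<Longrightarrow>
    c * \<mu> powr (p / q) \<le> Q p q (- \<mu>) u"
    by (rule radial_lower_bound[OF assms(1-3)]) (rule that, assumption, blast)
  obtain K where K: "\<And>\<epsilon>. 0 < \<epsilon> \<Longrightarrow> \<epsilon> \<le> 1 \<Longrightarrow> \<exists>u :: real^'n \<Rightarrow> real. u \<in> D2p_nonzero p \<and>
    Q p q (- (\<epsilon> powr (- 2 * p))) u \<le> K * \<epsilon> powr (?N - 2 * p - ?N * p / q)"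
    by (rule concentrated_upper_bound[OF assms]) (rule that, blast)
  \<comment> \<open>The difference of the \<epsilon>-exponents of the two bounds; positive by N > 2p
    and q > p.\<close>
  define s where "s = (?N - 2 * p) * (1 - p / q)"
  have s: "s > 0" using assms by (simp add: s_def)
  have "((\<lambda>\<epsilon>. K * \<epsilon> powr s) \<longlongrightarrow> K * 0) (at_right 0)"
    using s by (intro tendsto_mult tendsto_const tendsto_zero_powrI[OF tendsto_ident_at])
      (auto intro!: eventually_mono[OF eventually_at_right_less])
  then have "\<forall>\<^sub>F \<epsilon> in at_right 0. K * \<epsilon> powr s < c"
    using c(1) by (intro order_tendstoD) auto
  then obtain \<epsilon>0 where \<epsilon>0: "\<epsilon>0 > 0" "\<And>\<epsilon>. 0 < \<epsilon> \<Longrightarrow> \<epsilon> < \<epsilon>0 \<Longrightarrow> K * \<epsilon> powr s < c"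
    by (auto simp: eventually_at_right_field)
  define \<epsilon>1 where "\<epsilon>1 = min 1 \<epsilon>0"
  have \<epsilon>1: "\<epsilon>1 > 0" using \<epsilon>0(1) by (simp add: \<epsilon>1_def)
  show ?thesis
  \<comment> \<open>Under lam = -\<epsilon>^(-2p) a smaller \<open>lam\<close> means a smaller
    radius, so this threshold is the value at \<open>\<epsilon>1\<close>.\<close>
  proof (intro exI[of _ "- (\<epsilon>1 powr (- 2 * p))"] allI impI)
    fix lam assume lam: "lam < - (\<epsilon>1 powr (- 2 * p))"
    define \<mu> where "\<mu> = - lam"
    define \<epsilon> where "\<epsilon> = \<mu> powr (- 1 / (2 * p))"
    have \<mu>: "\<mu> > \<epsilon>1 powr (- 2 * p)" using lam by (simp add: \<mu>_def)
    have "\<epsilon>1 powr (- 2 * p) > 0" using \<epsilon>1 by simp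
    then have \<mu>0: "\<mu> > 0" using \<mu> by linarith
    then have \<epsilon>: "\<epsilon> > 0" by (simp add: \<epsilon>_def)
    have \<epsilon>\<mu>: "\<epsilon> powr (- 2 * p) = \<mu>" using \<mu>0 assms(2) by (simp add: \<epsilon>_def powr_powr)
    have "\<epsilon> < \<epsilon>1"
    proof (rule ccontr)
      assume "\<not> \<epsilon> < \<epsilon>1"
      then have "\<epsilon> powr (- 2 * p) \<le> \<epsilon>1 powr (- 2 * p)"
        using \<epsilon>1 assms(2) by (intro powr_mono2') auto
      then show False using \<mu> \<epsilon>\<mu> by simp
    qed
    then have \<epsilon>_less: "\<epsilon> \<le> 1" "\<epsilon> < \<epsilon>0" by (auto simp: \<epsilon>1_def)
    obtain u0 :: "real^'n \<Rightarrow> real" where u0: "u0 \<in> D2p_nonzero p"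
      "Q p q (- \<mu>) u0 \<le> K * \<epsilon> powr (?N - 2 * p - ?N * p / q)"
      using K[OF \<epsilon> \<epsilon>_less(1)] unfolding \<epsilon>\<mu> by blast
    \<comment> \<open>For negative \<open>lam\<close> both terms of the numerator are nonnegative.
      Hence the families are bounded below and each infimum is at most every value.\<close>
    have "Q p q lam u \<ge> 0" for u :: "real^'n \<Rightarrow> real"
      unfolding Q_def using \<mu>0
      by (intro divide_nonneg_nonneg diff_ge_0_iff_ge[THEN iffD2] order_trans[OF mult_nonpos_nonneg]
            Bochner_Integration.integral_nonneg mult_nonneg_nonneg) (auto simp: \<mu>_def)
    then have "S TYPE('n) p q lam \<le> Q p q lam u0"
      unfolding S_def by (intro cINF_lower u0 bdd_belowI2[of _ 0])
    also have "\<dots> \<le> K * \<epsilon> powr (?N - 2 * p - ?N * p / q)"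
      using u0(2) by (simp add: \<mu>_def)
    \<comment> \<open>Splitting off \<mu>^(p/q) = \<epsilon>^(-2p p/q), the growth of the radial
      lower bound, leaves the small factor \<epsilon>^s.\<close>
    also have "\<dots> = K * \<epsilon> powr s * \<mu> powr (p / q)"
    proof -
      have "?N - 2 * p - ?N * p / q = s + (- 2 * p) * (p / q)"
        using assms by (simp add: s_def field_simps)
      then show ?thesis unfolding \<epsilon>\<mu>[symmetric] by (simp only: powr_add powr_powr mult.assoc)
    qed
    also have "\<dots> < c * \<mu> powr (p / q)"
      using \<epsilon>0(2)[OF \<epsilon> \<epsilon>_less(2)] \<mu>0 by (intro mult_strict_right_mono) auto
    also have "\<dots> \<le> S_rad TYPE('n) p q lam"
      unfolding S_rad_def
    proof (rule cINF_greatest[OF radial_D2p_nonempty])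
      fix u :: "real^'n \<Rightarrow> real" assume "u \<in> {u \<in> D2p_nonzero p. radial u}"
      then show "c * \<mu> powr (p / q) \<le> Q p q lam u" using c(2)[OF \<mu>0, of u] by (simp add: \<mu>_def)
    qed
    finally have less: "S TYPE('n) p q lam < S_rad TYPE('n) p q lam" .
    \<comment> \<open>A radial extremal would compete for \<open>S_rad\<close> with the value of
      \<open>S\<close>.\<close>
    have "\<not> radial u" if "extremal p q lam u" for u :: "real^'n \<Rightarrow> real"
    proof
      assume "radial u"
      then have "S_rad TYPE('n) p q lam \<le> Q p q lam u"
        unfolding S_rad_def using that \<open>\<And>u. Q p q lam u \<ge> 0\<close>
        by (intro cINF_lower bdd_belowI2[of _ 0]) (auto simp: extremal_def)
      then show False using that less by (simp add: extremal_def)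
    qed
    with less show "S TYPE('n) p q lam < S_rad TYPE('n) p q lam \<and>
      (\<forall>u :: real^'n \<Rightarrow> real. extremal p q lam u \<longrightarrow> \<not> radial u)" by blast
  qed
qed

end
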